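(* Let $\mathcal{P}$ be one of the five palettes $\mathcal{P}_0,\mathcal{P}_{\mathrm{compl}},\mathcal{P}_{\mathrm{orien}},\mathcal{P}_{\mathrm{undir}},\mathcal{P}_{\mathrm{tourn}}$, let $r$ be its dimension, and let $\mathcal{H}$ be a hereditary property of digraphs with respect to $\mathcal{P}$ containing digraphs on $n$ vertices for every $n$. Fix a density vector $\mathbf{p}=(p,q)$ with respect to $\mathcal{P}$. Then the limit $\mathrm{dist}(\mathbf{p},\mathcal{H}):=\lim_{n\to\infty}\mathrm{dist}_n(\mathbf{p},\mathcal{H})$ exists. Moreover: (1) $\mathrm{dist}(\mathbf{p},\mathcal{H})=\inf_{K\in\mathcal{K}(\mathcal{H})}f_K(\mathbf{p})=\inf_{K\in\mathcal{K}(\mathcal{H})}g_K(\mathbf{p})$. (2) For fixed $\epsilon>0$, with probability approaching $1$ as $n\to\infty$, $$\mathrm{dist}(\mathbf{p},\mathcal{H})-\epsilon\le\mathrm{dist}(G(n,\mathbf{p}),\mathcal{H})\le\mathrm{dist}(\mathbf{p},\mathcal{H}).$$ (3) $\mathrm{dist}(\mathbf{p},\mathcal{H})=\lim_{n\to\infty}\mathbf{E}[\mathrm{dist}(G(n,\mathbf{p}),\mathcal{H})]$. (4) As a function of $\mathbf{p}$, $\mathrm{dist}(\mathbf{p},\mathcal{H})$ is continuous over the domain of density vectors with respect to $\mathcal{P}$ and is concave down. (5) $\mathrm{dist}(\mathbf{p},\mathcal{H})$ achieves its maximum, which equals $\mathrm{dist}(\mathcal{H})$, at some density vector $\mathbf{p}^*_{\mathcal{H}}$,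 and so $$\mathrm{dist}(\mathcal{H})=\lim_{n\to\infty}\mathbf{E}[\mathrm{dist}(G(n,\mathbf{p}^*_{\mathcal{H}}),\mathcal{H})].$$ (6) Both $\mathbf{p}^*_{\mathcal{H}}$ and $\mathrm{dist}(\mathcal{H})$ exist, and, writing $\mathbf{p}^*_{\mathcal{H}}$ also for the set of all density vectors with respect to $\mathcal{P}$ at which the maximum is attained, this set is convex and closed in $[0,1]^{r-1}$ (density vectors with respect to $\mathcal{P}$ being identified with their $r-1$ free coordinates).
   Context: Digraphs. A (simple) digraph is a pair $G=(V,c)$ with $V$ a finite labeled vertex set and $c$ a function from the ordered pairs of distinct vertices to $\{\bigcirc,-,\leftarrow,\rightarrow\}$ such that, for distinct $v,w$: $c(v,w)=c(w,v)$ iff $c(v,w)\in\{\bigcirc,-\}$; and $c(v,w)=\,\rightarrow$ iff $c(w,v)=\,\leftarrow$. Here $\bigcirc$ means no arc, $-$ means both arcs, $\rightarrow$ means only the arc from $v$ to $w$. Directed edges are the pairs colored $\leftarrow$ or $\rightarrow$. The palettes are $\mathcal{P}_0=\{\bigcirc,\leftarrow,\rightarrow,-\}$, $\mathcal{P}_{\mathrm{compl}}=\{-,\leftarrow,\rightarrow\}$, $\mathcal{P}_{\mathrm{orien}}=\{\bigcirc,\leftarrow,\rightarrow\}$, $\mathcal{P}_{\mathrm{undir}}=\{\bigcirc,-\}$, $\mathcal{P}_{\mathrm{tourn}}=\{\leftarrow,\rightarrow\}$. The dimension $r$ of $\mathcal{P}$ is the number of members of $\{\bigcirc,\rightarrow,-\}$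 in $\mathcal{P}$. Hereditary properties. A hereditary property of digraphs with respect to $\mathcal{P}$ is a set of digraphs with all colors in $\mathcal{P}$, closed under vertex-deletion and isomorphism. $\mathrm{Forb}(H)$ is the set of digraphs with colors in $\mathcal{P}$ having no induced copy of $H$; $\mathcal{F}(\mathcal{H})$ is a family of digraphs with colors in $\mathcal{P}$ such that $\mathcal{H}=\bigcap_{H\in\mathcal{F}(\mathcal{H})}\mathrm{Forb}(H)$. Distance. For digraphs $G,G'$ with colors in $\mathcal{P}$ on the same $n$ labeled vertices, $\mathrm{dist}(G,G')$ is the number of unordered pairs on which the colors differ, divided by $\binom n2$; $\mathrm{dist}(G,\mathcal{H})=\min\{\mathrm{dist}(G,G'):V(G')=V(G),G'\in\mathcal{H}\}$; $\mathrm{dist}(n,\mathcal{H})=\max\{\mathrm{dist}(G,\mathcal{H}):|V(G)|=n\}$ over digraphs with colors in $\mathcal{P}$; $\mathrm{dist}(\mathcal{H})=\lim_{n\to\infty}\mathrm{dist}(n,\mathcal{H})$. Density vectors. A density vector with respect to $\mathcal{P}$ is a nonnegative real vector $\mathbf{p}=(p,q)$ with $p+2q\le1$, and additionally: $p+2q=1$ if $\mathcal{P}=\mathcal{P}_{\mathrm{compl}}$; $p=0$ if $\mathcal{P}=\mathcal{P}_{\mathrm{orien}}$; $q=0$ if $\mathcal{P}=\mathcal{P}_{\mathrm{undir}}$; $(p,q)=(0,1/2)$ if $\mathcal{P}=\mathcal{P}_{\mathrm{tourn}}$. $\mathrm{dist}_n(\mathbf{p},\mathcal{H})$ is the maximum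 of $\mathrm{dist}(G,\mathcal{H})$ over digraphs $G$ on vertices $v_1,\ldots,v_n$ with colors in $\mathcal{P}$ for which, among the pairs $(v_i,v_j)$ with $i<j$, exactly $p\binom n2$ have color $-$, $q\binom n2$ have color $\rightarrow$, $q\binom n2$ have color $\leftarrow$, and $(1-p-2q)\binom n2$ have color $\bigcirc$ (up to rounding to integers: e.g. take floors for all but one color of the palette, the last color receiving what remains). $G(n,\mathbf{p})$ is the random digraph on $v_1,\ldots,v_n$ in which, independently for each $i<j$, $c(v_i,v_j)$ is $-,\rightarrow,\leftarrow,\bigcirc$ with probabilities $p,q,q,1-p-2q$ respectively. Types. A $\mathcal{P}$-dir-type is a pair $K=(U,\phi)$ with $U$ a finite vertex set and $\phi:U\times U\to2^{\mathcal{P}}\setminus\{\emptyset\}$ such that for distinct $x,y$: for $a\in\{\bigcirc,-\}$, $a\in\phi(x,y)$ iff $a\in\phi(y,x)$; $\rightarrow\,\in\phi(x,y)$ iff $\leftarrow\,\in\phi(y,x)$; and $\phi(x,x)\neq\mathcal{P}$ for all $x$ (it is allowed that $\phi(x,x)$ contains exactly one of $\leftarrow,\rightarrow$). A digraph $H=(V,c)$ embeds in $K$ if there is a map $\gamma:V\to U$ such that: for distinct $v,v'$ with $\gamma(v)\ne\gamma(v')$, $c(v,v')\in\phi(\gamma(v),\gamma(v'))$; for each $u\in U$ and $c_0\in\{\bigcirc,-\}$ with $c_0\notin\phi(u,u)$, $\gamma^{-1}(u)$ has no pair of color $c_0$; if $\{\leftarrow,\rightarrow\}\cap\phi(u,u)=\emptyset$,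 $\gamma^{-1}(u)$ has no directed edge; if $|\{\leftarrow,\rightarrow\}\cap\phi(u,u)|=1$, the directed edges in $\gamma^{-1}(u)$ contain no directed cycle. $\mathcal{K}(\mathcal{H})$ is the set of all $\mathcal{P}$-dir-types $K$ such that no $H\in\mathcal{F}(\mathcal{H})$ embeds in $K$. For a dir-type $K$ with vertices $u_1,\ldots,u_k$, let $\mathbf{M}_K(\mathbf{p})$ be the $k\times k$ matrix with $(i,j)$ entry $$1-(1-p-2q)\mathbf 1_{\bigcirc\in\phi(u_i,u_j)}-p\,\mathbf 1_{-\in\phi(u_i,u_j)}-q\,|\{\leftarrow,\rightarrow\}\cap\phi(u_i,u_j)|.$$ With $\mathbf 1$ the all-ones vector, $f_K(\mathbf{p})=(\frac1k\mathbf 1)^T\mathbf{M}_K(\mathbf{p})(\frac1k\mathbf 1)$ and $g_K(\mathbf{p})=\min\{\mathbf{w}^T\mathbf{M}_K(\mathbf{p})\mathbf{w}:\mathbf{w}^T\mathbf 1=1,\ \mathbf{w}\ge\mathbf 0\}$. A function $\psi$ on density vectors is concave down if $\psi(t\mathbf{p}_1+(1-t)\mathbf{p}_2)\ge t\psi(\mathbf{p}_1)+(1-t)\psi(\mathbf{p}_2)$ for all density vectors $\mathbf{p}_1,\mathbf{p}_2$ and $t\in[0,1]$.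
   Formalization: In part (2) the upper bound is dist(p,H)+ε instead of dist(p,H); the literal bound fails, e.g. for arcless digraphs with palette {○,−} and p=(1/2,0), where it holds only with probability tending to 1/2. *)

theory Defs
  imports "HOL-Probability.Probability"
begin

datatype color = NoArc | Both | Bwd | Fwd

fun rev_color :: "color \<Rightarrow> color" where
  "rev_color NoArc = NoArc"
| "rev_color Both = Both"
| "rev_color Bwd = Fwd"
| "rev_color Fwd = Bwd"

definition palette_all :: "color set" where "palette_all = {NoArc, Bwd, Fwd, Both}"
definition palette_compl :: "color set" where "palette_compl = {Both, Bwd, Fwd}"
definition palette_orien :: "color set" where "palette_orien = {NoArc, Bwd, Fwd}"
definition palette_undir :: "color set" where "palette_undir = {NoArc, Both}"
definition palette_tourn :: "color set" where "palette_tourn = {Bwd, Fwd}"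

definition palettes :: "color set set" where
  "palettes = {palette_all, palette_compl, palette_orien, palette_undir, palette_tourn}"

definition palette_dim :: "color set \<Rightarrow> nat" where
  "palette_dim P = card ({NoArc, Fwd, Both} \<inter> P)"

text \<open>Vertices are labeled by natural numbers.  The values of \<open>col\<close> on the diagonal and outside
  the vertex set are junk; nothing below depends on them.\<close>

record digraph =
  verts :: "nat set"
  col :: "nat \<Rightarrow> nat \<Rightarrow> color"

definition is_digraph :: "color set \<Rightarrow> digraph \<Rightarrow> bool" where
  "is_digraph P G \<longleftrightarrow> finite (verts G) \<and>
     (\<forall>v\<in>verts G. \<forall>w\<in>verts G. v \<noteq> w \<longrightarrow>
        col G v w \<in> P \<and>
        (col G v w = col G w v \<longleftrightarrow> col G v w \<in> {NoArc, Both}) \<and>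
        (col G v w = Fwd \<longleftrightarrow> col G w v = Bwd))"

definition digraph_iso :: "digraph \<Rightarrow> digraph \<Rightarrow> bool" where
  "digraph_iso G H \<longleftrightarrow> (\<exists>f. bij_betw f (verts G) (verts H) \<and>
     (\<forall>v\<in>verts G. \<forall>w\<in>verts G. v \<noteq> w \<longrightarrow> col H (f v) (f w) = col G v w))"

definition induced_sub :: "digraph \<Rightarrow> nat set \<Rightarrow> digraph" where
  "induced_sub G W = \<lparr>verts = verts G \<inter> W, col = col G\<rparr>"

definition hereditary :: "color set \<Rightarrow> digraph set \<Rightarrow> bool" where
  "hereditary P \<H> \<longleftrightarrow>
     (\<forall>G\<in>\<H>. is_digraph P G) \<and>
     (\<forall>G\<in>\<H>. \<forall>v\<in>verts G. induced_sub G (verts G - {v}) \<in> \<H>) \<and>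
     (\<forall>G\<in>\<H>. \<forall>G'. is_digraph P G' \<longrightarrow> digraph_iso G G' \<longrightarrow> G' \<in> \<H>)"

definition Forb :: "color set \<Rightarrow> digraph \<Rightarrow> digraph set" where
  "Forb P H = {G. is_digraph P G \<and> \<not> (\<exists>W\<subseteq>verts G. digraph_iso H (induced_sub G W))}"

text \<open>The intersection is taken inside the set of all digraphs with colors in \<open>P\<close>, which
  matters only for \<open>F = {}\<close>.\<close>

definition forbidden_family :: "color set \<Rightarrow> digraph set \<Rightarrow> digraph set \<Rightarrow> bool" where
  "forbidden_family P \<H> F \<longleftrightarrow>
     (\<forall>H\<in>F. is_digraph P H) \<and> \<H> = {G. is_digraph P G} \<inter> (\<Inter>H\<in>F. Forb P H)"


subsection \<open>Edit distance\<close>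

definition edit_dist :: "digraph \<Rightarrow> digraph \<Rightarrow> real" where
  "edit_dist G G' =
     real (card {{v, w} |v w. v \<in> verts G \<and> w \<in> verts G \<and> v \<noteq> w \<and> col G v w \<noteq> col G' v w})
       / real (card (verts G) choose 2)"

text \<open>In the next three definitions \<open>Min\<close> and \<open>Max\<close> range over finite sets, since all values are
  of the form \<open>k / (n choose 2)\<close> with \<open>k \<le> n choose 2\<close>.\<close>

definition dist_prop :: "digraph \<Rightarrow> digraph set \<Rightarrow> real" where
  "dist_prop G \<H> = Min {edit_dist G G' |G'. G' \<in> \<H> \<and> verts G' = verts G}"

definition max_dist :: "color set \<Rightarrow> digraph set \<Rightarrow> nat \<Rightarrow> real" where
  "max_dist P \<H> n = Max {dist_prop G \<H> |G. is_digraph P G \<and> card (verts G) = n}"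

definition dist_lim :: "color set \<Rightarrow> digraph set \<Rightarrow> real" where
  "dist_lim P \<H> = lim (\<lambda>n. max_dist P \<H> n)"


subsection \<open>Density vectors\<close>

definition density_vector :: "color set \<Rightarrow> real \<times> real \<Rightarrow> bool" where
  "density_vector P d \<longleftrightarrow> (case d of (p, q) \<Rightarrow>
     0 \<le> p \<and> 0 \<le> q \<and> p + 2 * q \<le> 1 \<and>
     (P = palette_compl \<longrightarrow> p + 2 * q = 1) \<and>
     (P = palette_orien \<longrightarrow> p = 0) \<and>
     (P = palette_undir \<longrightarrow> q = 0) \<and>
     (P = palette_tourn \<longrightarrow> p = 0 \<and> q = 1 / 2))"

fun color_prob :: "real \<times> real \<Rightarrow> color \<Rightarrow> real" where
  "color_prob (p, q) NoArc = 1 - p - 2 * q"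
| "color_prob (p, q) Both = p"
| "color_prob (p, q) Bwd = q"
| "color_prob (p, q) Fwd = q"

text \<open>The free coordinates of a density vector.  For \<open>palette_compl\<close> the coordinate \<open>p\<close> is kept,
  as then \<open>q = (1 - p) / 2\<close>.\<close>

definition free_coord_list :: "color set \<Rightarrow> real \<times> real \<Rightarrow> real list" where
  "free_coord_list P d = (case d of (p, q) \<Rightarrow>
     if P = palette_all then [p, q]
     else if P = palette_compl \<or> P = palette_undir then [p]
     else if P = palette_orien then [q]
     else [])"

definition free_coords :: "color set \<Rightarrow> real \<times> real \<Rightarrow> nat \<Rightarrow> real" where
  "free_coords P d = (\<lambda>i\<in>{..<palette_dim P - 1}. free_coord_list P d ! i)"

definition real_cube :: "nat \<Rightarrow> (nat \<Rightarrow> real) set" where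
  "real_cube m = ({..<m} \<rightarrow>\<^sub>E {0..1})"

definition closed_in_cube :: "nat \<Rightarrow> (nat \<Rightarrow> real) set \<Rightarrow> bool" where
  "closed_in_cube m S \<longleftrightarrow>
     closedin (subtopology (product_topology (\<lambda>_. euclideanreal) {..<m}) (real_cube m)) S"

definition convex_in_cube :: "nat \<Rightarrow> (nat \<Rightarrow> real) set \<Rightarrow> bool" where
  "convex_in_cube m S \<longleftrightarrow> S \<subseteq> real_cube m \<and>
     (\<forall>x\<in>S. \<forall>y\<in>S. \<forall>t\<in>{0..1}. (\<lambda>i\<in>{..<m}. t * x i + (1 - t) * y i) \<in> S)"

text \<open>Rounding: every color of the palette other than \<open>c\<^sub>0\<close> occurs on the floor of its prescribed
  number of pairs \<open>i < j\<close>, and \<open>c\<^sub>0 \<in> P\<close> receives the remaining pairs.\<close>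

definition dist_dens :: "color set \<Rightarrow> color \<Rightarrow> digraph set \<Rightarrow> real \<times> real \<Rightarrow> nat \<Rightarrow> real" where
  "dist_dens P c\<^sub>0 \<H> d n = Max {dist_prop G \<H> |G. is_digraph P G \<and> verts G = {..<n} \<and>
     (\<forall>c\<in>P - {c\<^sub>0}. int (card {(i, j). i < j \<and> j < n \<and> col G i j = c})
                     = \<lfloor>color_prob d c * real (n choose 2)\<rfloor>)}"

definition dist_dens_lim :: "color set \<Rightarrow> color \<Rightarrow> digraph set \<Rightarrow> real \<times> real \<Rightarrow> real" where
  "dist_dens_lim P c\<^sub>0 \<H> d = lim (\<lambda>n. dist_dens P c\<^sub>0 \<H> d n)"

definition maximizers :: "color set \<Rightarrow> color \<Rightarrow> digraph set \<Rightarrow> (real \<times> real) set" where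
  "maximizers P c\<^sub>0 \<H> = {d. density_vector P d \<and>
     (\<forall>d'. density_vector P d' \<longrightarrow> dist_dens_lim P c\<^sub>0 \<H> d' \<le> dist_dens_lim P c\<^sub>0 \<H> d)}"


subsection \<open>Random digraphs\<close>

definition color_pmf :: "real \<times> real \<Rightarrow> color pmf" where
  "color_pmf d = embed_pmf (color_prob d)"

lemma UNIV_color: "(UNIV :: color set) = {NoArc, Both, Bwd, Fwd}"
  using color.exhaust by auto

lemma pmf_color_pmf:
  assumes "density_vector P d"
  shows "pmf (color_pmf d) c = color_prob d c"
proof -
  obtain p q where d: "d = (p, q)" by (cases d)
  from assms have pq: "0 \<le> p" "0 \<le> q" "p + 2 * q \<le> 1"
    by (auto simp: density_vector_def d)
  have nn: "0 \<le> color_prob d x" for x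
    using pq by (cases x) (auto simp: d)
  have fin: "finite (UNIV :: color set)" by (simp add: UNIV_color)
  have "(\<integral>\<^sup>+x. ennreal (color_prob d x) \<partial>count_space UNIV) = (\<Sum>x\<in>UNIV. ennreal (color_prob d x))"
    by (rule nn_integral_count_space_finite[OF fin])
  also have "\<dots> = ennreal (\<Sum>x\<in>UNIV. color_prob d x)"
    by (rule sum_ennreal) (rule nn)
  also have "\<dots> = 1" by (simp add: UNIV_color d)
  finally show ?thesis
    unfolding color_pmf_def by (intro pmf_embed_pmf nn)
qed

definition random_digraph :: "nat \<Rightarrow> real \<times> real \<Rightarrow> digraph pmf" where
  "random_digraph n d = map_pmf
     (\<lambda>\<omega>. \<lparr>verts = {..<n}, col = (\<lambda>i j. if i < j then \<omega> (i, j) else rev_color (\<omega> (j, i)))\<rparr>)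
     (Pi_pmf {(i, j). i < j \<and> j < n} NoArc (\<lambda>_. color_pmf d))"


subsection \<open>Types\<close>

text \<open>A type is required to have at least one vertex, as \<open>f_fun\<close> and \<open>g_fun\<close> make no sense
  otherwise.\<close>

record dir_type =
  tverts :: "nat set"
  tcol :: "nat \<Rightarrow> nat \<Rightarrow> color set"

definition is_dir_type :: "color set \<Rightarrow> dir_type \<Rightarrow> bool" where
  "is_dir_type P K \<longleftrightarrow> finite (tverts K) \<and> tverts K \<noteq> {} \<and>
     (\<forall>x\<in>tverts K. \<forall>y\<in>tverts K. tcol K x y \<subseteq> P \<and> tcol K x y \<noteq> {}) \<and>
     (\<forall>x\<in>tverts K. \<forall>y\<in>tverts K. x \<noteq> y \<longrightarrow>
        (\<forall>a\<in>{NoArc, Both}. a \<in> tcol K x y \<longleftrightarrow> a \<in> tcol K y x) \<and>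
        (Fwd \<in> tcol K x y \<longleftrightarrow> Bwd \<in> tcol K y x)) \<and>
     (\<forall>x\<in>tverts K. tcol K x x \<noteq> P)"

definition fiber_pairs :: "digraph \<Rightarrow> (nat \<Rightarrow> nat) \<Rightarrow> nat \<Rightarrow> (nat \<times> nat) set" where
  "fiber_pairs H \<gamma> u =
     {(v, w). v \<in> verts H \<and> w \<in> verts H \<and> v \<noteq> w \<and> \<gamma> v = u \<and> \<gamma> w = u}"

definition embeds :: "digraph \<Rightarrow> dir_type \<Rightarrow> bool" where
  "embeds H K \<longleftrightarrow> (\<exists>\<gamma>. \<gamma> ` verts H \<subseteq> tverts K \<and>
     (\<forall>v\<in>verts H. \<forall>w\<in>verts H. v \<noteq> w \<longrightarrow> \<gamma> v \<noteq> \<gamma> w \<longrightarrow>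
        col H v w \<in> tcol K (\<gamma> v) (\<gamma> w)) \<and>
     (\<forall>u\<in>tverts K.
        (\<forall>a\<in>{NoArc, Both}. a \<notin> tcol K u u \<longrightarrow>
           (\<forall>(v, w)\<in>fiber_pairs H \<gamma> u. col H v w \<noteq> a)) \<and>
        ({Bwd, Fwd} \<inter> tcol K u u = {} \<longrightarrow>
           (\<forall>(v, w)\<in>fiber_pairs H \<gamma> u. col H v w \<notin> {Bwd, Fwd})) \<and>
        (card ({Bwd, Fwd} \<inter> tcol K u u) = 1 \<longrightarrow>
           acyclic {(v, w)\<in>fiber_pairs H \<gamma> u. col H v w = Fwd})))"

definition type_family :: "color set \<Rightarrow> digraph set \<Rightarrow> dir_type set" where
  "type_family P F = {K. is_dir_type P K \<and> (\<forall>H\<in>F. \<not> embeds H K)}"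

definition type_matrix :: "dir_type \<Rightarrow> real \<times> real \<Rightarrow> nat \<Rightarrow> nat \<Rightarrow> real" where
  "type_matrix K d x y = (case d of (p, q) \<Rightarrow>
     1 - (1 - p - 2 * q) * of_bool (NoArc \<in> tcol K x y)
       - p * of_bool (Both \<in> tcol K x y)
       - q * real (card ({Bwd, Fwd} \<inter> tcol K x y)))"

definition type_form :: "dir_type \<Rightarrow> real \<times> real \<Rightarrow> (nat \<Rightarrow> real) \<Rightarrow> real" where
  "type_form K d w = (\<Sum>x\<in>tverts K. \<Sum>y\<in>tverts K. w x * type_matrix K d x y * w y)"

definition f_fun :: "dir_type \<Rightarrow> real \<times> real \<Rightarrow> real" where
  "f_fun K d = type_form K d (\<lambda>_. 1 / real (card (tverts K)))"

definition weightings :: "dir_type \<Rightarrow> (nat \<Rightarrow> real) set" where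
  "weightings K = {w. (\<Sum>x\<in>tverts K. w x) = 1 \<and> (\<forall>x\<in>tverts K. 0 \<le> w x)}"

text \<open>This infimum is a minimum, as the simplex of weightings is compact.\<close>

definition g_fun :: "dir_type \<Rightarrow> real \<times> real \<Rightarrow> real" where
  "g_fun K d = (INF w\<in>weightings K. type_form K d w)"

end

theory Submission
  imports Defs "HOL-Library.Ramsey" "HOL-Real_Asymp.Real_Asymp"
begin

text \<open>Write \<open>\<beta> d\<close> for the infimum of \<open>f_fun K d\<close> over the types \<open>K\<close> of the property.  A digraph
  \<open>G\<close> with color densities \<open>d\<close> can be edited into the property by distributing its vertices at random
  over the vertices of a type, so its distance is at most \<open>\<beta> d\<close>; as \<open>\<beta>\<close> is an infimum of uniformly
  Lipschitz affine functions, it is continuous and concave.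

  For the lower bound let \<open>G\<close> be quasirandom with densities \<open>d\<close> and let \<open>G'\<close> belong to the property.
  Instead of a regularity lemma one partitions the vertices by their arcs in \<open>G'\<close> to a bounded list
  \<open>u\<close> of reference vertices, chosen greedily such that further reference vertices hardly increase
  the energy of the partition.  Given the cells of finitely many randomly sampled vertices, the other
  sampled vertices are themselves additional reference vertices for any one pair, so the arcs of
  \<open>G'\<close> between them are almost independent.  Hence every pattern of colors that are not too rare between the
  cells occurs in \<open>G'\<close>, while by quasirandomness \<open>G\<close> and \<open>G'\<close> can agree on little more than those colors.
  A blow-up argument and Ramsey's theorem turn this into a type whose small digraphs
  all occur in \<open>G'\<close>, and the pigeonhole principle yields one type that works for all orders.\<close>


subsection \<open>Averaging over the cells of a partition\<close>

text \<open>The obstacle in the lower bound is the order of choices. The labels of the type, its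
  diagonal included, are read off one sampled tuple \<open>v\<close>, and only afterwards does a
  digraph \<open>H\<close> embedded in the type dictate which colours have to appear. So a single
  \<open>v\<close> must serve all admissible patterns at once; a union bound over the at most
  \<open>5 ^ card E\<close> patterns provides it, at the price of a very small
  \<open>\<tau>\<close>. The diagonal is the second difficulty: nothing is known about the arcs
  inside a class, so every class is sampled \<open>t\<close> times and Ramsey's theorem extracts
  \<open>m\<close> copies sharing one colour. A diagonal label with a single colour is legal in
  every palette, and giving up all diagonal entries of the matrix costs at most
  \<open>1 / real k\<close>. Quasirandomness enters only as an upper bound on colour counts, because
  only the number of agreeing pairs has to be bounded. The infimum of \<open>g_fun\<close> is not
  reduced to that of \<open>f_fun\<close> by blowing up types: both are compared with the distance
  of a typical digraph.\<close>

definition cavg :: "'z set \<Rightarrow> ('z \<Rightarrow> 't) \<Rightarrow> ('z \<Rightarrow> real) \<Rightarrow> 'z \<Rightarrow> real" where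
  "cavg Z h f z = (\<Sum>y\<in>{y \<in> Z. h y = h z}. f y) / real (card {y \<in> Z. h y = h z})"

lemma cavg_cong: "h y = h z \<Longrightarrow> cavg Z h f y = cavg Z h f z"
  by (simp add: cavg_def)

text \<open>\<open>cavg Z h f\<close> is the conditional expectation of \<open>f\<close> given
  \<open>h\<close> under the uniform measure on \<open>Z\<close>. This is its characterising
  property, tested against functions constant on the fibres of \<open>h\<close>.\<close>

lemma sum_cavg_mult:
  assumes "finite Z" and G: "\<And>y z. y \<in> Z \<Longrightarrow> z \<in> Z \<Longrightarrow> h y = h z \<Longrightarrow> G y = G z"
  shows "(\<Sum>z\<in>Z. cavg Z h f z * G z) = (\<Sum>z\<in>Z. f z * (G z :: real))"
proof -
  have "(\<Sum>z\<in>Z. cavg Z h f z * G z) = (\<Sum>t\<in>h ` Z. \<Sum>z\<in>{z \<in> Z. h z = t}. cavg Z h f z * G z)"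
    by (rule sum.image_gen[OF assms(1)])
  also have "\<dots> = (\<Sum>t\<in>h ` Z. \<Sum>z\<in>{z \<in> Z. h z = t}. f z * G z)"
  proof (rule sum.cong[OF refl])
    fix t assume "t \<in> h ` Z"
    then obtain z0 where z0: "z0 \<in> Z" "t = h z0" by auto
    let ?C = "{z \<in> Z. h z = h z0}"
    have "finite ?C" "z0 \<in> ?C" using assms(1) z0 by auto
    then have card: "card ?C \<noteq> 0" by auto
    have "(\<Sum>z\<in>?C. cavg Z h f z * G z) = (\<Sum>z\<in>?C. (\<Sum>y\<in>?C. f y) / real (card ?C) * G z0)"
      by (rule sum.cong) (auto simp: cavg_def intro: G z0)
    also have "\<dots> = (\<Sum>y\<in>?C. f y) * G z0" using card by simp
    also have "\<dots> = (\<Sum>z\<in>?C. f z * G z)"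
      unfolding sum_distrib_right by (rule sum.cong) (auto intro: G z0)
    finally show "(\<Sum>z\<in>{z \<in> Z. h z = t}. cavg Z h f z * G z) = (\<Sum>z\<in>{z \<in> Z. h z = t}. f z * G z)"
      using z0 by simp
  qed
  also have "\<dots> = (\<Sum>z\<in>Z. f z * G z)"
    by (rule sum.image_gen[OF assms(1), symmetric])
  finally show ?thesis .
qed

text \<open>Pythagoras: when \<open>h'\<close> refines \<open>h\<close>, the difference of the two
  conditional expectations is orthogonal to the coarser one.\<close>

lemma sum_cavg_diff_squared:
  assumes "finite Z" and ref: "\<And>y z. y \<in> Z \<Longrightarrow> z \<in> Z \<Longrightarrow> h' y = h' z \<Longrightarrow> h y = h z"
  shows "(\<Sum>z\<in>Z. (cavg Z h' f z - cavg Z h f z)\<^sup>2)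
    = (\<Sum>z\<in>Z. (cavg Z h' f z)\<^sup>2) - (\<Sum>z\<in>Z. (cavg Z h f z)\<^sup>2)"
proof -
  have 1: "(\<Sum>z\<in>Z. cavg Z h' f z * cavg Z h f z) = (\<Sum>z\<in>Z. f z * cavg Z h f z)"
    by (rule sum_cavg_mult[OF assms(1)]) (auto intro!: cavg_cong ref)
  have 2: "(\<Sum>z\<in>Z. cavg Z h f z * cavg Z h f z) = (\<Sum>z\<in>Z. f z * cavg Z h f z)"
    by (rule sum_cavg_mult[OF assms(1)]) (auto intro!: cavg_cong)
  have "(\<Sum>z\<in>Z. (cavg Z h' f z - cavg Z h f z)\<^sup>2)
    = (\<Sum>z\<in>Z. (cavg Z h' f z)\<^sup>2) + (\<Sum>z\<in>Z. (cavg Z h f z)\<^sup>2)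
       - 2 * (\<Sum>z\<in>Z. cavg Z h' f z * cavg Z h f z)"
    by (simp add: power2_diff sum.distrib sum_subtractf sum_distrib_left mult.assoc)
  then show ?thesis using 1 2 by (simp add: power2_eq_square)
qed

lemma cavg_bounds:
  assumes "finite Z" and "\<And>z. z \<in> Z \<Longrightarrow> 0 \<le> f z" and "\<And>z. z \<in> Z \<Longrightarrow> f z \<le> 1"
  shows "0 \<le> cavg Z h f z" and "cavg Z h f z \<le> 1"
proof -
  show "0 \<le> cavg Z h f z"
    unfolding cavg_def by (intro divide_nonneg_nonneg sum_nonneg) (auto intro: assms)
  have "(\<Sum>y\<in>{y \<in> Z. h y = h z}. f y) \<le> (\<Sum>y\<in>{y \<in> Z. h y = h z}. 1)"
    by (intro sum_mono) (auto intro: assms)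
  then show "cavg Z h f z \<le> 1"
    unfolding cavg_def by (cases "card {y \<in> Z. h y = h z} = 0") (auto simp: divide_le_eq_1)
qed

subsection \<open>Sums over extensional functions\<close>

lemma sum_PiE_Un:
  assumes "finite I" "finite J" "I \<inter> J = {}"
  shows "(\<Sum>v\<in>PiE (I \<union> J) (\<lambda>_. V). F v)
    = (\<Sum>a\<in>PiE I (\<lambda>_. V). \<Sum>b\<in>PiE J (\<lambda>_. V). F (\<lambda>x. if x \<in> I then a x else b x))"
proof -
  have "(\<Sum>a\<in>PiE I (\<lambda>_. V). \<Sum>b\<in>PiE J (\<lambda>_. V). F (\<lambda>x. if x \<in> I then a x else b x))
     = (\<Sum>(a, b)\<in>PiE I (\<lambda>_. V) \<times> PiE J (\<lambda>_. V). F (\<lambda>x. if x \<in> I then a x else b x))"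
    by (simp add: sum.cartesian_product)
  also have "\<dots> = (\<Sum>v\<in>PiE (I \<union> J) (\<lambda>_. V). F v)"
  proof (rule sum.reindex_bij_witness[where
        j = "\<lambda>(a, b) x. if x \<in> I then a x else b x" and i = "\<lambda>v. (restrict v I, restrict v J)"])
    fix c assume "c \<in> PiE I (\<lambda>_. V) \<times> PiE J (\<lambda>_. V)"
    then obtain a b where c: "c = (a, b)" "a \<in> PiE I (\<lambda>_. V)" "b \<in> PiE J (\<lambda>_. V)" by auto
    have "restrict (\<lambda>x. if x \<in> I then a x else b x) I = a"
      using c by (auto simp: fun_eq_iff PiE_def extensional_def)
    moreover have "restrict (\<lambda>x. if x \<in> I then a x else b x) J = b"
      using c assms by (auto simp: fun_eq_iff PiE_def extensional_def)
    ultimately show "(\<lambda>v. (restrict v I, restrict v J)) ((\<lambda>(a, b) x. if x \<in> I then a x else b x) c) = c"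
      by (simp add: c)
    show "(\<lambda>(a, b) x. if x \<in> I then a x else b x) c \<in> PiE (I \<union> J) (\<lambda>_. V)"
      using c by (auto simp: PiE_def extensional_def Pi_def)
  next
    fix v assume "v \<in> PiE (I \<union> J) (\<lambda>_. V)"
    then show "(\<lambda>(a, b) x. if x \<in> I then a x else b x) (restrict v I, restrict v J) = v"
      by (auto simp: PiE_def extensional_def Pi_def fun_eq_iff)
  qed (auto simp: PiE_def extensional_def Pi_def)
  finally show ?thesis by simp
qed

lemma sum_PiE_insert:
  assumes "finite I" "i \<notin> I"
  shows "(\<Sum>v\<in>PiE (insert i I) (\<lambda>_. V). F v) = (\<Sum>w\<in>PiE I (\<lambda>_. V). \<Sum>x\<in>V. F (w(i := x)))"
proof -
  have "(\<Sum>w\<in>PiE I (\<lambda>_. V). \<Sum>x\<in>V. F (w(i := x))) = (\<Sum>(w, x)\<in>PiE I (\<lambda>_. V) \<times> V. F (w(i := x)))"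
    by (simp add: sum.cartesian_product)
  also have "\<dots> = (\<Sum>v\<in>PiE (insert i I) (\<lambda>_. V). F v)"
    by (rule sum.reindex_bij_witness[where
        j = "\<lambda>(w, x). w(i := x)" and i = "\<lambda>v. (restrict v I, v i)"])
      (use assms in \<open>auto simp: PiE_def extensional_def Pi_def fun_eq_iff split: if_splits\<close>)
  finally show ?thesis by simp
qed

text \<open>Freezes all coordinates but two, so that a sum over tuples can be analysed one pair at a
  time.\<close>

lemma sum_PiE_two:
  assumes "finite I" "i \<in> I" "j \<in> I" "i \<noteq> j"
  shows "(\<Sum>v\<in>PiE I (\<lambda>_. V). F v)
    = (\<Sum>w\<in>PiE (I - {i, j}) (\<lambda>_. V). \<Sum>(x, y)\<in>V \<times> V. F (w(i := x, j := y)))"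
proof -
  have I: "I = insert j (insert i (I - {i, j}))" using assms by auto
  have "(\<Sum>v\<in>PiE I (\<lambda>_. V). F v) = (\<Sum>v\<in>PiE (insert j (insert i (I - {i, j}))) (\<lambda>_. V). F v)"
    using I by simp
  also have "\<dots> = (\<Sum>w\<in>PiE (I - {i, j}) (\<lambda>_. V). \<Sum>x\<in>V. \<Sum>y\<in>V. F (w(i := x, j := y)))"
    using assms by (subst sum_PiE_insert, simp, simp, subst sum_PiE_insert) auto
  finally show ?thesis by (simp add: sum.cartesian_product)
qed

subsection \<open>Power means and blow-ups\<close>

lemma power_mean_le:
  assumes "finite S" "S \<noteq> {}" and nn: "\<And>x. x \<in> S \<Longrightarrow> 0 \<le> g x"
  shows "((\<Sum>x\<in>S. g x) / real (card S)) ^ n \<le> (\<Sum>x\<in>S. g x ^ n) / real (card S)"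
proof -
  have cv: "convex_on {0::real..} (\<lambda>x. x ^ n)"
    by (cases "even n") (auto intro: convex_power_odd convex_on_subset[OF convex_power_even])
  have "(\<lambda>x. x ^ n) (\<Sum>x\<in>S. (1 / real (card S)) *\<^sub>R g x) \<le> (\<Sum>x\<in>S. (1 / real (card S)) * (g x) ^ n)"
    by (rule convex_on_sum[OF assms(1,2) cv]) (use assms in auto)
  then show ?thesis by (simp add: sum_divide_distrib)
qed

text \<open>Induction on \<open>k\<close>, peeling off the last coordinate. For fixed copies
  \<open>b\<close> of it the product is a blow-up of \<open>F b\<close> in one coordinate less. The
  power mean inequality is applied with exponent \<open>t\<close> over the first \<open>k\<close>
  coordinates and with exponent \<open>t ^ k\<close> over \<open>b\<close>. This is the Sidorenko
  property of complete k-partite k-uniform hypergraphs in weighted form.\<close>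

lemma blow_up_density:
  fixes f :: "(nat \<Rightarrow> 'v) \<Rightarrow> real"
  assumes "finite V" "V \<noteq> {}" and nn: "\<And>x. 0 \<le> f x"
  shows "((\<Sum>x\<in>PiE {..<k} (\<lambda>_. V). f x) / real (card V) ^ k) ^ (t ^ k)
    \<le> (\<Sum>v\<in>PiE ({..<k} \<times> {..<t}) (\<lambda>_. V).
         \<Prod>a\<in>PiE {..<k} (\<lambda>_. {..<t}). f (\<lambda>i\<in>{..<k}. v (i, a i))) / real (card V) ^ (k * t)"
  using nn
proof (induction k arbitrary: f)
  case 0
  then show ?case by (simp add: restrict_def)
next
  case (Suc k)
  define N where "N = real (card V)"
  have N: "N > 0" using assms by (simp add: N_def card_gt_0_iff)
  let ?K = "{..<k} \<times> {..<t}" and ?L = "{k} \<times> {..<t}"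
  define F where "F b x = (\<Prod>s<t. f (x(k := b (k, s))))" for b :: "nat \<times> nat \<Rightarrow> 'v" and x
  have F0: "0 \<le> F b x" for b x unfolding F_def by (intro prod_nonneg) (use Suc in auto)
  let ?B = "PiE ?L (\<lambda>_. V)"
  have finB: "finite ?B" using assms by (auto intro!: finite_PiE)
  have cardB: "real (card ?B) = N ^ t" by (simp add: card_PiE N_def card_cartesian_product)
  have neB: "?B \<noteq> {}" using assms(2) by (auto simp: PiE_eq_empty_iff)
  \<comment> \<open>A transversal of the larger array is a transversal of the first \<open>k\<close>
    rows together with one copy \<open>s\<close> of the last row.\<close>
  have split: "(\<Prod>a\<in>PiE {..<Suc k} (\<lambda>_. {..<t}). f (\<lambda>i\<in>{..<Suc k}. (if (i, a i) \<in> ?K then c (i, a i) else b (i, a i))))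
     = (\<Prod>a\<in>PiE {..<k} (\<lambda>_. {..<t}). F b (\<lambda>i\<in>{..<k}. c (i, a i)))" for b c :: "nat \<times> nat \<Rightarrow> 'v"
  proof -
    have "(\<Prod>(a, s)\<in>PiE {..<k} (\<lambda>_. {..<t}) \<times> {..<t}. f ((\<lambda>i\<in>{..<k}. c (i, a i))(k := b (k, s))))
       = (\<Prod>a\<in>PiE {..<Suc k} (\<lambda>_. {..<t}). f (\<lambda>i\<in>{..<Suc k}. (if (i, a i) \<in> ?K then c (i, a i) else b (i, a i))))"
    proof (rule prod.reindex_bij_witness[where j = "\<lambda>(a, s). a(k := s)" and i = "\<lambda>a. (restrict a {..<k}, a k)"])
      fix as assume as: "as \<in> PiE {..<k} (\<lambda>_. {..<t}) \<times> {..<t}"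
      obtain a s where [simp]: "as = (a, s)" by (cases as)
      have "(\<lambda>i\<in>{..<Suc k}. if (i, (a(k := s)) i) \<in> ?K then c (i, (a(k := s)) i) else b (i, (a(k := s)) i))
          = (\<lambda>i\<in>{..<k}. c (i, a i))(k := b (k, s))"
        using as by (auto simp: fun_eq_iff less_Suc_eq PiE_def Pi_def)
      then show "f (\<lambda>i\<in>{..<Suc k}. if (i, (case as of (a, s) \<Rightarrow> a(k := s)) i) \<in> ?K then c (i, (case as of (a, s) \<Rightarrow> a(k := s)) i) else b (i, (case as of (a, s) \<Rightarrow> a(k := s)) i)) =
         (case as of (a, s) \<Rightarrow> f ((\<lambda>i\<in>{..<k}. c (i, a i))(k := b (k, s))))"
        unfolding \<open>as = (a, s)\<close> prod.case by (rule arg_cong)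
    qed (auto simp: PiE_def extensional_def Pi_def fun_eq_iff less_Suc_eq split: if_splits)
    then show ?thesis unfolding F_def by (simp add: prod.cartesian_product)
  qed
  have KL: "{..<Suc k} \<times> {..<t} = ?K \<union> ?L" by auto
  have "(\<Sum>v\<in>PiE ({..<Suc k} \<times> {..<t}) (\<lambda>_. V). \<Prod>a\<in>PiE {..<Suc k} (\<lambda>_. {..<t}). f (\<lambda>i\<in>{..<Suc k}. v (i, a i)))
      = (\<Sum>c\<in>PiE ?K (\<lambda>_. V). \<Sum>b\<in>?B. \<Prod>a\<in>PiE {..<k} (\<lambda>_. {..<t}). F b (\<lambda>i\<in>{..<k}. c (i, a i)))"
    unfolding KL by (subst sum_PiE_Un) (auto simp: split simp del: mem_Sigma_iff)
  also have "\<dots> = (\<Sum>b\<in>?B. \<Sum>c\<in>PiE ?K (\<lambda>_. V). \<Prod>a\<in>PiE {..<k} (\<lambda>_. {..<t}). F b (\<lambda>i\<in>{..<k}. c (i, a i)))"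
    by (rule sum.swap)
  also have "\<dots> \<ge> (\<Sum>b\<in>?B. N ^ (k * t) * ((\<Sum>x\<in>PiE {..<k} (\<lambda>_. V). F b x) / N ^ k) ^ (t ^ k))"
  proof (rule sum_mono)
    fix b assume "b \<in> ?B"
    show "N ^ (k * t) * ((\<Sum>x\<in>PiE {..<k} (\<lambda>_. V). F b x) / N ^ k) ^ (t ^ k)
      \<le> (\<Sum>c\<in>PiE ?K (\<lambda>_. V). \<Prod>a\<in>PiE {..<k} (\<lambda>_. {..<t}). F b (\<lambda>i\<in>{..<k}. c (i, a i)))"
    proof -
      have "((\<Sum>x\<in>PiE {..<k} (\<lambda>_. V). F b x) / N ^ k) ^ (t ^ k)
        \<le> (\<Sum>c\<in>PiE ?K (\<lambda>_. V). \<Prod>a\<in>PiE {..<k} (\<lambda>_. {..<t}). F b (\<lambda>i\<in>{..<k}. c (i, a i))) / N ^ (k * t)"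
        unfolding N_def by (rule Suc.IH[OF F0])
      then show ?thesis
        using N by (simp only: pos_le_divide_eq zero_less_power mult.commute)
    qed
  qed
  finally have A: "(\<Sum>b\<in>?B. N ^ (k * t) * ((\<Sum>x\<in>PiE {..<k} (\<lambda>_. V). F b x) / N ^ k) ^ (t ^ k)) \<le>
     (\<Sum>v\<in>PiE ({..<Suc k} \<times> {..<t}) (\<lambda>_. V). \<Prod>a\<in>PiE {..<Suc k} (\<lambda>_. {..<t}). f (\<lambda>i\<in>{..<Suc k}. v (i, a i)))" (is "_ \<le> ?R") .
  define m where "m x = (\<Sum>y\<in>V. f (x(k := y)))" for x
  have m0: "0 \<le> m x" for x unfolding m_def by (intro sum_nonneg) (use Suc in auto)
  \<comment> \<open>For fixed \<open>x\<close> the \<open>t\<close> copies of the last coordinate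
    vary independently, so the sum factorises.\<close>
  have FB: "(\<Sum>b\<in>?B. F b x) = m x ^ t" for x
  proof -
    have "m x ^ t = (\<Prod>e\<in>?L. \<Sum>y\<in>V. f (x(k := y)))"
      by (simp add: m_def card_cartesian_product)
    also have "\<dots> = (\<Sum>b\<in>?B. \<Prod>e\<in>?L. f (x(k := b e)))"
      by (rule prod_sum_PiE) (use assms in auto)
    also have "\<dots> = (\<Sum>b\<in>?B. F b x)"
      unfolding F_def
      by (intro sum.cong[OF refl] prod.reindex_cong[of "Pair k"]) (auto simp: inj_on_def)
    finally show ?thesis by simp
  qed
  let ?P = "PiE {..<k} (\<lambda>_. V)"
  have finP: "finite ?P" using assms by (auto intro!: finite_PiE)
  have neP: "?P \<noteq> {}" using assms(2) by (auto simp: PiE_eq_empty_iff)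
  have cardP: "real (card ?P) = N ^ k" by (simp add: card_PiE N_def)
  have tot: "(\<Sum>x\<in>PiE {..<Suc k} (\<lambda>_. V). f x) = (\<Sum>x\<in>?P. m x)"
    unfolding m_def lessThan_Suc by (rule sum_PiE_insert) auto
  have "((\<Sum>x\<in>?P. m x) / N ^ Suc k) ^ t = (((\<Sum>x\<in>?P. m x) / N ^ k) ^ t) / N ^ t"
    by (simp add: power_divide field_simps)
  also have "\<dots> \<le> ((\<Sum>x\<in>?P. m x ^ t) / N ^ k) / N ^ t"
    by (intro divide_right_mono) (use power_mean_le[OF finP neP, of m t] m0 N in \<open>auto simp: cardP\<close>)
  also have "\<dots> = (\<Sum>x\<in>?P. \<Sum>b\<in>?B. F b x) / N ^ k / N ^ t" by (simp add: FB)
  also have "\<dots> = (\<Sum>b\<in>?B. (\<Sum>x\<in>?P. F b x) / N ^ k) / real (card ?B)"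
    by (subst sum.swap) (simp add: cardB sum_divide_distrib)
  finally have 1: "((\<Sum>x\<in>?P. m x) / N ^ Suc k) ^ t \<le> (\<Sum>b\<in>?B. (\<Sum>x\<in>?P. F b x) / N ^ k) / real (card ?B)" .
  have "((\<Sum>x\<in>?P. m x) / N ^ Suc k) ^ (t ^ Suc k) = (((\<Sum>x\<in>?P. m x) / N ^ Suc k) ^ t) ^ (t ^ k)"
    by (simp add: power_mult)
  also have "\<dots> \<le> ((\<Sum>b\<in>?B. (\<Sum>x\<in>?P. F b x) / N ^ k) / real (card ?B)) ^ (t ^ k)"
    using 1 by (rule power_mono) (use m0 N in \<open>auto intro!: zero_le_power divide_nonneg_nonneg sum_nonneg\<close>)
  also have "\<dots> \<le> (\<Sum>b\<in>?B. ((\<Sum>x\<in>?P. F b x) / N ^ k) ^ (t ^ k)) / real (card ?B)"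
    by (rule power_mean_le[OF finB neB]) (use F0 N in \<open>auto intro!: divide_nonneg_nonneg sum_nonneg\<close>)
  also have "\<dots> = (\<Sum>b\<in>?B. N ^ (k * t) * ((\<Sum>x\<in>?P. F b x) / N ^ k) ^ (t ^ k)) / N ^ (Suc k * t)"
    using N by (simp add: cardB sum_distrib_left[symmetric] power_add)
  also have "\<dots> \<le> ?R / N ^ (Suc k * t)"
    by (intro divide_right_mono A) (use N in auto)
  finally show ?case unfolding tot N_def .
qed


subsection \<open>Edge colourings sampled by their rows\<close>

text \<open>The flip \<open>r\<close> accommodates colours with a direction; because of it, the row
  of a vertex determines the corresponding column as well.\<close>

locale edge_colouring =
  fixes V :: "'v set" and X :: "'v \<Rightarrow> 'v \<Rightarrow> 'c" and r :: "'c \<Rightarrow> 'c" and C :: "'c set"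
  assumes finV: "finite V" and neV: "V \<noteq> {}" and finC: "finite C"
    and flip: "\<And>x y. x \<in> V \<Longrightarrow> y \<in> V \<Longrightarrow> X y x = r (X x y)"
begin

definition profile :: "'v list \<Rightarrow> 'v \<Rightarrow> 'c list" where
  "profile u x = map (X x) u"

definition cell :: "'v list \<Rightarrow> 'v \<times> 'v \<Rightarrow> 'c list \<times> 'c list" where
  "cell u = map_prod (profile u) (profile u)"

definition dens :: "'v list \<Rightarrow> 'c \<Rightarrow> 'v \<times> 'v \<Rightarrow> real" where
  "dens u c = cavg (V \<times> V) (cell u) (\<lambda>(x, y). of_bool (X x y = c))"

text \<open>The index of a partition known from Szemeredi's regularity lemma, summed over the
  colours.\<close>

definition energy :: "'v list \<Rightarrow> real" where
  "energy u = (\<Sum>c\<in>C. \<Sum>z\<in>V \<times> V. (dens u c z)\<^sup>2) / real (card V) ^ 2"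

lemma card_V_pos: "real (card V) > 0"
  using finV neV by (simp add: card_gt_0_iff)

lemma dens_bounds: "0 \<le> dens u c z" "dens u c z \<le> 1"
  unfolding dens_def by (auto intro!: cavg_bounds finite_cartesian_product finV)

lemma dens_cong:
  "profile u x = profile u x' \<Longrightarrow> profile u y = profile u y' \<Longrightarrow> dens u c (x, y) = dens u c (x', y')"
  unfolding dens_def by (rule cavg_cong) (simp add: cell_def)

lemma profile_append_eqD: "profile (u @ w) x = profile (u @ w) y \<Longrightarrow> profile u x = profile u y"
  by (simp add: profile_def)

lemma energy_le: "energy u \<le> real (card C)"
proof -
  have "(\<Sum>c\<in>C. \<Sum>z\<in>V \<times> V. (dens u c z)\<^sup>2) \<le> (\<Sum>c\<in>C. \<Sum>z\<in>V \<times> V. 1)"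
    by (intro sum_mono) (use dens_bounds in \<open>auto simp: power_le_one\<close>)
  also have "\<dots> = real (card C) * real (card V) ^ 2"
    by (simp add: card_cartesian_product power2_eq_square)
  finally show ?thesis
    unfolding energy_def using card_V_pos by (simp add: divide_le_eq)
qed

lemma energy_nonneg: "0 \<le> energy u"
  unfolding energy_def by (intro divide_nonneg_nonneg sum_nonneg) auto

text \<open>By Pythagoras the energy increment is the sum over all colours of the mean-square
  changes of density, each of them nonnegative; all but that of \<open>c\<close> are
  dropped.\<close>

lemma dens_append_diff:
  assumes "c \<in> C"
  shows "(\<Sum>z\<in>V \<times> V. (dens (u @ w) c z - dens u c z)\<^sup>2)
    \<le> (energy (u @ w) - energy u) * real (card V) ^ 2"
proof -
  have D: "(\<Sum>z\<in>V \<times> V. (dens (u @ w) c z - dens u c z)\<^sup>2)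
     = (\<Sum>z\<in>V \<times> V. (dens (u @ w) c z)\<^sup>2) - (\<Sum>z\<in>V \<times> V. (dens u c z)\<^sup>2)" for c
    unfolding dens_def
    by (rule sum_cavg_diff_squared)
      (use finV in \<open>auto simp: cell_def dest: profile_append_eqD\<close>)
  have "(\<Sum>z\<in>V \<times> V. (dens (u @ w) c z - dens u c z)\<^sup>2)
    \<le> (\<Sum>c\<in>C. \<Sum>z\<in>V \<times> V. (dens (u @ w) c z - dens u c z)\<^sup>2)"
    by (rule member_le_sum[OF assms]) (auto intro: finC sum_nonneg)
  also have "\<dots> = (energy (u @ w) - energy u) * real (card V) ^ 2"
    unfolding D energy_def using card_V_pos
    by (simp add: sum_subtractf diff_divide_distrib[symmetric])
  finally show ?thesis .
qed

section \<open>Energy-stable reference lists and the counting lemma\<close>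

definition stable :: "nat \<Rightarrow> real \<Rightarrow> 'v list \<Rightarrow> bool" where
  "stable M \<tau> u \<longleftrightarrow> (\<forall>w. set w \<subseteq> V \<longrightarrow> length w \<le> M \<longrightarrow> energy (u @ w) \<le> energy u + \<tau>)"

text \<open>Energy increment: a list that is not stable has an extension by at most \<open>M\<close>
  vertices whose energy is larger by more than \<open>\<tau>\<close>. As the energy never exceeds
  \<open>card C\<close>, this cannot be repeated more than \<open>card C / \<tau>\<close>
  times.\<close>

lemma exists_stable:
  assumes "\<tau> > 0"
  shows "\<exists>u. set u \<subseteq> V \<and> length u \<le> M * (nat \<lceil>real (card C) / \<tau>\<rceil> + 1) \<and> stable M \<tau> u"
proof (rule ccontr)
  define J where "J = nat \<lceil>real (card C) / \<tau>\<rceil> + 1"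
  assume "\<not> ?thesis"
  then have no: "\<not> stable M \<tau> u" if "set u \<subseteq> V" "length u \<le> M * J" for u
    using that unfolding J_def by blast
  have "j \<le> J \<Longrightarrow> \<exists>u. set u \<subseteq> V \<and> length u \<le> M * j \<and> energy u \<ge> real j * \<tau>" for j
  proof (induction j)
    case 0
    show ?case by (intro exI[of _ "[]"]) (auto simp: energy_nonneg)
  next
    case (Suc j)
    then obtain u where u: "set u \<subseteq> V" "length u \<le> M * j" "energy u \<ge> real j * \<tau>" by auto
    have "length u \<le> M * J" using u(2) Suc.prems by (meson Suc_leD le_trans mult_le_mono2)
    from no[OF u(1) this] obtain w where "set w \<subseteq> V" "length w \<le> M" "energy (u @ w) > energy u + \<tau>"
      unfolding stable_def by force
    then show ?case using u by (intro exI[of _ "u @ w"]) (auto simp: algebra_simps)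
  qed
  from this[of J] obtain u where "energy u \<ge> real J * \<tau>" by auto
  moreover have "real J * \<tau> > real (card C)"
  proof -
    have "real (card C) / \<tau> < real J" unfolding J_def by linarith
    then show ?thesis using assms by (simp add: divide_less_eq)
  qed
  ultimately show False using energy_le[of u] by linarith
qed

text \<open>Fixing all coordinates of \<open>v\<close> but the two in question, the other factor of the summand
  depends only on the rows of these two at \<open>u\<close> and at the fixed vertices \<open>w\<close>; hence the indicator may
  be replaced by its average over the cells of \<open>u @ w\<close>, which by stability is close in mean square to
  the average over the cells of \<open>u\<close>.\<close>

lemma replace_pair:
  fixes G :: "('i \<Rightarrow> 'v) \<Rightarrow> real"
  assumes st: "stable M \<tau> u" and "\<tau> \<ge> 0" and I: "finite I" "card I \<le> M"
    and ij: "i \<in> I" "j \<in> I" "i \<noteq> j" and c: "c \<in> C"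
    and bd: "\<And>v. v \<in> PiE I (\<lambda>_. V) \<Longrightarrow> \<bar>G v\<bar> \<le> 1"
    and det: "\<And>v v'. v \<in> PiE I (\<lambda>_. V) \<Longrightarrow> v' \<in> PiE I (\<lambda>_. V) \<Longrightarrow> (\<And>a. a \<in> I - {i, j} \<Longrightarrow> v a = v' a) \<Longrightarrow>
      (\<And>a. a \<in> {i, j} \<Longrightarrow> profile u (v a) = profile u (v' a)) \<Longrightarrow>
      (\<And>a b. a \<in> {i, j} \<Longrightarrow> b \<in> I - {i, j} \<Longrightarrow> X (v a) (v b) = X (v' a) (v' b)) \<Longrightarrow> G v = G v'"
  shows "\<bar>\<Sum>v\<in>PiE I (\<lambda>_. V). G v * (of_bool (X (v i) (v j) = c) - dens u c (v i, v j))\<bar>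
    \<le> sqrt \<tau> * real (card V) ^ card I"
proof -
  let ?I = "I - {i, j}" and ?Z = "V \<times> V"
  define N where "N = real (card V)"
  have N: "N > 0" using card_V_pos by (simp add: N_def)
  define F where "F v = G v * (of_bool (X (v i) (v j) = c) - dens u c (v i, v j))" for v
  obtain js where js: "set js = ?I" "distinct js"
    using I finite_distinct_list[of ?I] by auto
  have inner: "\<bar>\<Sum>(x, y)\<in>?Z. F (w(i := x, j := y))\<bar> \<le> sqrt \<tau> * N ^ 2" if w: "w \<in> PiE ?I (\<lambda>_. V)" for w
  proof -
    define ws where "ws = map w js"
    have ws: "set ws \<subseteq> V" "length ws \<le> M"
      using w js I card_mono[of I ?I] distinct_card[of js] by (auto simp: ws_def)
    define g where "g = (\<lambda>(x, y). G (w(i := x, j := y)))"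
    have ext: "w(i := x, j := y) \<in> PiE I (\<lambda>_. V)" if "x \<in> V" "y \<in> V" for x y
      using w that ij by (auto simp: PiE_def extensional_def Pi_def)
    have gdet: "g y = g z" if "y \<in> ?Z" "z \<in> ?Z" "cell (u @ ws) y = cell (u @ ws) z" for y z
    proof -
      obtain x y' where [simp]: "y = (x, y')" by (cases y)
      obtain x2 y2 where [simp]: "z = (x2, y2)" by (cases z)
      have V4: "x \<in> V" "y' \<in> V" "x2 \<in> V" "y2 \<in> V" using that by auto
      have p: "profile (u @ ws) x = profile (u @ ws) x2" "profile (u @ ws) y' = profile (u @ ws) y2"
        using that by (auto simp: cell_def)
      have row: "X x (w b) = X x2 (w b)" "X y' (w b) = X y2 (w b)" if "b \<in> ?I" for b
        using p that js by (auto simp: profile_def ws_def)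
      show ?thesis
        unfolding g_def
        by (simp, rule det[OF ext ext])
          (use V4 p row ij in \<open>auto dest: profile_append_eqD\<close>)
    qed
    have gb: "\<bar>g z\<bar> \<le> 1" if "z \<in> ?Z" for z
      using that bd ext by (auto simp: g_def)
    have "(\<Sum>(x, y)\<in>?Z. F (w(i := x, j := y)))
       = (\<Sum>z\<in>?Z. (case z of (x, y) \<Rightarrow> of_bool (X x y = c)) * g z) - (\<Sum>z\<in>?Z. dens u c z * g z)"
      unfolding F_def sum_subtractf[symmetric] g_def
      by (rule sum.cong) (use ij in \<open>auto simp: algebra_simps split_def\<close>)
    also have "(\<Sum>z\<in>?Z. (case z of (x, y) \<Rightarrow> of_bool (X x y = c)) * g z)
       = (\<Sum>z\<in>?Z. dens (u @ ws) c z * g z)"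
      unfolding dens_def
      by (rule sum_cavg_mult[symmetric]) (use finV in simp, rule gdet)
    also have "(\<Sum>z\<in>?Z. dens (u @ ws) c z * g z) - (\<Sum>z\<in>?Z. dens u c z * g z)
       = (\<Sum>z\<in>?Z. (dens (u @ ws) c z - dens u c z) * g z)"
      by (simp add: sum_subtractf algebra_simps)
    also have "\<bar>\<dots>\<bar> \<le> (\<Sum>z\<in>?Z. \<bar>dens (u @ ws) c z - dens u c z\<bar>)"
      by (rule order_trans[OF sum_abs sum_mono])
        (use gb in \<open>auto simp: abs_mult intro: mult_left_le\<close>)
    \<comment> \<open>Cauchy-Schwarz passes from the mean absolute to the mean square deviation,
      which the energy increment controls. This is the origin of the square root of
      \<open>\<tau>\<close> in all later bounds.\<close>
    also have "\<dots> \<le> sqrt (\<tau> * (N ^ 2) ^ 2)"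
    proof (rule real_le_rsqrt)
      have "(\<Sum>z\<in>?Z. \<bar>dens (u @ ws) c z - dens u c z\<bar>)\<^sup>2
        \<le> (\<Sum>z\<in>?Z. (dens (u @ ws) c z - dens u c z)\<^sup>2) * (\<Sum>z\<in>?Z. 1\<^sup>2)"
        using Cauchy_Schwarz_ineq_sum[of "\<lambda>z. \<bar>dens (u @ ws) c z - dens u c z\<bar>" "\<lambda>_. 1" ?Z] by simp
      also have "\<dots> = (\<Sum>z\<in>?Z. (dens (u @ ws) c z - dens u c z)\<^sup>2) * N ^ 2"
        by (simp add: N_def card_cartesian_product power2_eq_square)
      also have "\<dots> \<le> ((energy (u @ ws) - energy u) * N ^ 2) * N ^ 2"
        using dens_append_diff[OF c, of u ws] by (intro mult_right_mono) (auto simp: N_def)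
      also have "\<dots> \<le> (\<tau> * N ^ 2) * N ^ 2"
        using st ws unfolding stable_def by (intro mult_right_mono) (auto simp: algebra_simps)
      finally show "(\<Sum>z\<in>?Z. \<bar>dens (u @ ws) c z - dens u c z\<bar>)\<^sup>2 \<le> \<tau> * (N ^ 2) ^ 2"
        by (simp add: power2_eq_square mult.assoc)
    qed
    also have "\<dots> = sqrt \<tau> * N ^ 2"
      unfolding real_sqrt_mult real_sqrt_abs by simp
    finally show ?thesis .
  qed
  have "card ?I + 2 = card I"
  proof -
    have "card {i, j} = 2" "{i, j} \<subseteq> I" using ij by auto
    then show ?thesis
      using I card_Diff_subset[of "{i, j}" I] card_mono[of I "{i, j}"] by simp
  qed
  then have cI: "N ^ card ?I * N ^ 2 = N ^ card I" by (metis power_add)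
  have "(\<Sum>v\<in>PiE I (\<lambda>_. V). F v) = (\<Sum>w\<in>PiE ?I (\<lambda>_. V). \<Sum>(x, y)\<in>?Z. F (w(i := x, j := y)))"
    using I ij by (intro sum_PiE_two)
  also have "\<bar>\<dots>\<bar> \<le> (\<Sum>w\<in>PiE ?I (\<lambda>_. V). sqrt \<tau> * N ^ 2)"
    by (rule order_trans[OF sum_abs sum_mono[OF inner]])
  also have "\<dots> = sqrt \<tau> * (N ^ card ?I * N ^ 2)"
    using I by (simp add: card_PiE N_def)
  also have "\<dots> = sqrt \<tau> * N ^ card I" by (simp only: cI)
  finally show ?thesis unfolding F_def N_def .
qed

text \<open>A hybrid between the actual pattern and its independent model: pairs in \<open>S\<close>
  are tested in \<open>X\<close>, pairs in \<open>T\<close> contribute only the density of their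
  cell.\<close>

definition joint :: "'v list \<Rightarrow> ('i \<times> 'i \<Rightarrow> 'c) \<Rightarrow> ('i \<times> 'i) set \<Rightarrow> ('i \<times> 'i) set \<Rightarrow> ('i \<Rightarrow> 'v) \<Rightarrow> real" where
  "joint u p S T v = (\<Prod>e\<in>S. of_bool (X (v (fst e)) (v (snd e)) = p e))
     * (\<Prod>e\<in>T. dens u (p e) (v (fst e), v (snd e)))"

lemma joint_bounds: "0 \<le> joint u p S T v" "joint u p S T v \<le> 1"
proof -
  have "0 \<le> (\<Prod>e\<in>S. of_bool (X (v (fst e)) (v (snd e)) = p e) :: real)"
    "(\<Prod>e\<in>S. of_bool (X (v (fst e)) (v (snd e)) = p e) :: real) \<le> 1"
    "0 \<le> (\<Prod>e\<in>T. dens u (p e) (v (fst e), v (snd e)))"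
    "(\<Prod>e\<in>T. dens u (p e) (v (fst e), v (snd e))) \<le> 1"
    by (auto intro!: prod_nonneg prod_le_1 dens_bounds)
  then show "0 \<le> joint u p S T v" "joint u p S T v \<le> 1"
    unfolding joint_def by (auto intro: mult_le_one)
qed

text \<open>Hybrid argument: the pairs of \<open>S\<close> are exchanged one at a time, each
  exchange costing the error of \<open>replace_pair\<close>. As \<open>E\<close> has no loops and at
  most one orientation of each pair, no other factor reads the arc between the two vertices
  concerned, so the remaining product sees these vertices only through their rows and
  profiles.\<close>

lemma joint_telescope:
  fixes h :: "('i \<Rightarrow> 'v) \<Rightarrow> real"
  assumes st: "stable M \<tau> u" and "\<tau> \<ge> 0" and I: "finite I" "card I \<le> M"
    and E: "E \<subseteq> I \<times> I" and E': "\<And>i j. (i, j) \<in> E \<Longrightarrow> i \<noteq> j \<and> (j, i) \<notin> E"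
    and p: "\<And>e. e \<in> E \<Longrightarrow> p e \<in> C"
    and h: "\<And>v. 0 \<le> h v \<and> h v \<le> 1"
    and hdet: "\<And>v v'. v \<in> PiE I (\<lambda>_. V) \<Longrightarrow> v' \<in> PiE I (\<lambda>_. V) \<Longrightarrow>
      (\<And>a. a \<in> I \<Longrightarrow> profile u (v a) = profile u (v' a)) \<Longrightarrow> h v = h v'"
    and S: "S \<subseteq> E"
  shows "\<bar>(\<Sum>v\<in>PiE I (\<lambda>_. V). h v * joint u p S (E - S) v) - (\<Sum>v\<in>PiE I (\<lambda>_. V). h v * joint u p {} E v)\<bar>
     \<le> real (card S) * (sqrt \<tau> * real (card V) ^ card I)"
proof -
  have finE: "finite E" using E I by (meson finite_SigmaI finite_subset)
  have "finite S" using S finE finite_subset by blast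
  then show ?thesis using S
  proof (induction S)
    case empty
    then show ?case by simp
  next
    case (insert e S)
    obtain i j where e: "e = (i, j)" by (cases e)
    have eE: "e \<in> E" "S \<subseteq> E" "e \<notin> S" using insert by auto
    then have ij: "i \<in> I" "j \<in> I" "i \<noteq> j" using E E' by (auto simp: e)
    let ?T = "E - insert e S"
    define G where "G v = h v * joint u p S ?T v" for v
    have T: "E - S = insert e ?T" using eE by auto
    have 1: "h v * joint u p (insert e S) ?T v - h v * joint u p S (E - S) v
       = G v * (of_bool (X (v i) (v j) = p e) - dens u (p e) (v i, v j))" for v
      unfolding T G_def joint_def using insert finE by (simp add: e algebra_simps)
    have "\<bar>\<Sum>v\<in>PiE I (\<lambda>_. V). G v * (of_bool (X (v i) (v j) = p e) - dens u (p e) (v i, v j))\<bar>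
       \<le> sqrt \<tau> * real (card V) ^ card I"
    proof (rule replace_pair[OF st \<open>\<tau> \<ge> 0\<close> I ij])
      show "p e \<in> C" using p eE by auto
      show "\<bar>G v\<bar> \<le> 1" for v
        unfolding G_def using h[of v] joint_bounds[of u p S ?T v] by (auto simp: abs_mult intro: mult_le_one)
    next
      fix v v' :: "'i \<Rightarrow> 'v"
      assume v: "v \<in> PiE I (\<lambda>_. V)" "v' \<in> PiE I (\<lambda>_. V)"
        and eq: "\<And>a. a \<in> I - {i, j} \<Longrightarrow> v a = v' a"
        and prof: "\<And>a. a \<in> {i, j} \<Longrightarrow> profile u (v a) = profile u (v' a)"
        and row: "\<And>a b. a \<in> {i, j} \<Longrightarrow> b \<in> I - {i, j} \<Longrightarrow> X (v a) (v b) = X (v' a) (v' b)"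
      have prof': "profile u (v a) = profile u (v' a)" if "a \<in> I" for a
        using eq prof that by (cases "a \<in> {i, j}") auto
      have Xeq: "X (v a) (v b) = X (v' a) (v' b)" if abE: "(a, b) \<in> E" "(a, b) \<noteq> e" for a b
      proof -
        have ab: "a \<in> I" "b \<in> I" "a \<noteq> b" "(b, a) \<noteq> e" using abE E E' eE by (auto simp: e)
        have inV: "v a \<in> V" "v b \<in> V" "v' a \<in> V" "v' b \<in> V" using v ab by auto
        consider "a \<notin> {i, j}" "b \<notin> {i, j}" | "a \<in> {i, j}" "b \<notin> {i, j}" | "a \<notin> {i, j}" "b \<in> {i, j}"
          using ab abE unfolding e by (cases "a \<in> {i, j}"; cases "b \<in> {i, j}") auto
        then show ?thesis
        proof cases
          \<comment> \<open>Only rows starting at \<open>i\<close> or \<open>j\<close> are known to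
            agree; an edge ending there is first reversed by \<open>flip\<close>.\<close>
          case 3
          then have "X (v b) (v a) = X (v' b) (v' a)" using row ab by auto
          then show ?thesis using flip[of "v b" "v a"] flip[of "v' b" "v' a"] inV by simp
        qed (use eq row ab in auto)
      qed
      have "joint u p S ?T v = joint u p S ?T v'"
        unfolding joint_def
      proof (intro arg_cong2[where f = "(*)"] prod.cong refl)
        fix f assume f: "f \<in> S"
        then have "f \<noteq> e" "(fst f, snd f) \<in> E" using eE by auto
        then show "of_bool (X (v (fst f)) (v (snd f)) = p f) = of_bool (X (v' (fst f)) (v' (snd f)) = p f)"
          using Xeq[of "fst f" "snd f"] by simp
      next
        fix f assume "f \<in> ?T"
        then have "fst f \<in> I" "snd f \<in> I" using E by auto
        then show "dens u (p f) (v (fst f), v (snd f)) = dens u (p f) (v' (fst f), v' (snd f))"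
          by (intro dens_cong prof')
      qed
      moreover have "h v = h v'" by (rule hdet[OF v prof'])
      ultimately show "G v = G v'" unfolding G_def by simp
    qed
    then have 2: "\<bar>(\<Sum>v\<in>PiE I (\<lambda>_. V). h v * joint u p (insert e S) ?T v)
        - (\<Sum>v\<in>PiE I (\<lambda>_. V). h v * joint u p S (E - S) v)\<bar> \<le> sqrt \<tau> * real (card V) ^ card I"
      by (simp add: sum_subtractf[symmetric] 1)
    have "S \<subseteq> E" by fact
    from insert.IH[OF this] 2 have "\<bar>(\<Sum>v\<in>PiE I (\<lambda>_. V). h v * joint u p (insert e S) ?T v)
        - (\<Sum>v\<in>PiE I (\<lambda>_. V). h v * joint u p {} E v)\<bar>
      \<le> real (card S) * (sqrt \<tau> * real (card V) ^ card I) + sqrt \<tau> * real (card V) ^ card I"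
      by linarith
    also have "\<dots> = real (card (insert e S)) * (sqrt \<tau> * real (card V) ^ card I)"
      using insert by (simp add: algebra_simps)
    finally show ?case .
  qed
qed

text \<open>Otherwise every \<open>v\<close> in \<open>A\<close> has a pattern that its densities
  admit but that occurs nowhere. For a fixed pattern of this kind the sum of indicators vanishes,
  while the product of densities is at least \<open>\<eta> ^ card E\<close> at each such
  \<open>v\<close>; by \<open>joint_telescope\<close> there are few of them. The assumption
  \<open>small\<close> makes the union over all patterns too small to cover
  \<open>A\<close>.\<close>

lemma all_patterns_realised:
  fixes I :: "'i set"
  assumes st: "stable M \<tau> u" and "\<tau> \<ge> 0" and I: "finite I" "card I \<le> M"
    and E: "E \<subseteq> I \<times> I" and E': "\<And>i j. (i, j) \<in> E \<Longrightarrow> i \<noteq> j \<and> (j, i) \<notin> E"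
    and A: "A \<subseteq> PiE I (\<lambda>_. V)" "real (card A) \<ge> \<rho> * real (card V) ^ card I"
    and Adet: "\<And>v v'. v \<in> A \<Longrightarrow> v' \<in> PiE I (\<lambda>_. V) \<Longrightarrow>
      (\<And>a. a \<in> I \<Longrightarrow> profile u (v a) = profile u (v' a)) \<Longrightarrow> v' \<in> A"
    and \<eta>: "\<eta> > 0"
    and small: "real (card E) * sqrt \<tau> * real (card C) ^ card E < \<rho> * \<eta> ^ card E"
  shows "\<exists>v\<in>A. \<forall>p\<in>PiE E (\<lambda>_. C). (\<forall>e\<in>E. dens u (p e) (v (fst e), v (snd e)) > \<eta>) \<longrightarrow>
    (\<exists>v'\<in>PiE I (\<lambda>_. V). \<forall>e\<in>E. X (v' (fst e)) (v' (snd e)) = p e)"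
proof (rule ccontr)
  define N where "N = real (card V)"
  have N: "N > 0" using card_V_pos by (simp add: N_def)
  have finE: "finite E" using E I by (meson finite_SigmaI finite_subset)
  have finP: "finite (PiE I (\<lambda>_. V))" using I finV by (auto intro: finite_PiE)
  let ?Pat = "PiE E (\<lambda>_. C)"
  define ok where "ok p v \<longleftrightarrow> (\<forall>e\<in>E. dens u (p e) (v (fst e), v (snd e)) > \<eta>)" for p :: "'i \<times> 'i \<Rightarrow> 'c" and v
  define bad where "bad p \<longleftrightarrow> (\<forall>v'\<in>PiE I (\<lambda>_. V). \<exists>e\<in>E. X (v' (fst e)) (v' (snd e)) \<noteq> p e)"
    for p :: "'i \<times> 'i \<Rightarrow> 'c"
  assume "\<not> ?thesis"
  then have "\<not> (\<exists>v\<in>A. \<forall>p\<in>?Pat. ok p v \<longrightarrow> \<not> bad p)"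
    unfolding ok_def bad_def by simp
  then have ex: "\<exists>p\<in>?Pat. ok p v \<and> bad p" if "v \<in> A" for v
    using that by blast
  have est: "real (card {v \<in> A. ok p v}) * \<eta> ^ card E \<le> real (card E) * (sqrt \<tau> * N ^ card I)"
    if p: "p \<in> ?Pat" "bad p" for p
  proof -
    \<comment> \<open>Both membership in \<open>A\<close> and \<open>ok p\<close> depend on
      \<open>v\<close> through profiles only, which is what the telescoping argument demands of its
      weight.\<close>
    define h where "h v = (of_bool (v \<in> A \<and> ok p v) :: real)" for v
    have hdet: "h v = h v'" if v: "v \<in> PiE I (\<lambda>_. V)" "v' \<in> PiE I (\<lambda>_. V)"
      "\<And>a. a \<in> I \<Longrightarrow> profile u (v a) = profile u (v' a)" for v v'
    proof -
      have "v \<in> A \<longleftrightarrow> v' \<in> A"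
        using Adet[OF _ v(2) v(3)] Adet[OF _ v(1) v(3)[symmetric]] by blast
      moreover have "dens u (p e) (v (fst e), v (snd e)) = dens u (p e) (v' (fst e), v' (snd e))" if "e \<in> E" for e
      proof -
        have "fst e \<in> I" "snd e \<in> I" using that E by auto
        then show ?thesis by (intro dens_cong v(3))
      qed
      ultimately show ?thesis unfolding h_def ok_def by simp
    qed
    have zero: "(\<Sum>v\<in>PiE I (\<lambda>_. V). h v * joint u p E (E - E) v) = 0"
    proof (rule sum.neutral, rule ballI)
      fix v assume "v \<in> PiE I (\<lambda>_. V)"
      then obtain e where "e \<in> E" "X (v (fst e)) (v (snd e)) \<noteq> p e" using p unfolding bad_def by blast
      then have "(\<Prod>e\<in>E. of_bool (X (v (fst e)) (v (snd e)) = p e) :: real) = 0"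
        using finE by (intro prod_zero) auto
      then show "h v * joint u p E (E - E) v = 0" by (simp add: joint_def)
    qed
    have "real (card {v \<in> A. ok p v}) * \<eta> ^ card E = (\<Sum>v\<in>{v \<in> A. ok p v}. \<eta> ^ card E)" by simp
    also have "\<dots> \<le> (\<Sum>v\<in>{v \<in> A. ok p v}. h v * joint u p {} E v)"
    proof (rule sum_mono)
      fix v assume v: "v \<in> {v \<in> A. ok p v}"
      have "\<eta> ^ card E = (\<Prod>e\<in>E. \<eta>)" by simp
      also have "\<dots> \<le> (\<Prod>e\<in>E. dens u (p e) (v (fst e), v (snd e)))"
        using v \<eta> by (intro prod_mono) (auto simp: ok_def less_imp_le)
      finally show "\<eta> ^ card E \<le> h v * joint u p {} E v" using v by (simp add: h_def joint_def)
    qed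
    also have "\<dots> \<le> (\<Sum>v\<in>PiE I (\<lambda>_. V). h v * joint u p {} E v)"
      by (rule sum_mono2) (use finP A in \<open>auto simp: h_def intro: joint_bounds\<close>)
    also have "\<dots> \<le> real (card E) * (sqrt \<tau> * N ^ card I)"
    proof -
      have "\<bar>(\<Sum>v\<in>PiE I (\<lambda>_. V). h v * joint u p E (E - E) v) - (\<Sum>v\<in>PiE I (\<lambda>_. V). h v * joint u p {} E v)\<bar>
        \<le> real (card E) * (sqrt \<tau> * real (card V) ^ card I)"
      proof (rule joint_telescope[OF st \<open>\<tau> \<ge> 0\<close> I E])
        show "h v = h v'" if "v \<in> PiE I (\<lambda>_. V)" "v' \<in> PiE I (\<lambda>_. V)"
          "\<And>a. a \<in> I \<Longrightarrow> profile u (v a) = profile u (v' a)" for v v'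
          using that by (rule hdet)
        show "0 \<le> h v \<and> h v \<le> 1" for v by (simp add: h_def)
      qed (use E' p in auto)
      then show ?thesis unfolding zero N_def by linarith
    qed
    finally show ?thesis .
  qed
  have finPat: "finite ?Pat" using finE finC by (auto intro: finite_PiE)
  have "real (card A) * \<eta> ^ card E \<le> real (card (\<Union>p\<in>{p\<in>?Pat. bad p}. {v \<in> A. ok p v})) * \<eta> ^ card E"
  proof -
    have "A \<subseteq> (\<Union>p\<in>{p\<in>?Pat. bad p}. {v \<in> A. ok p v})" using ex by blast
    moreover have "finite (\<Union>p\<in>{p\<in>?Pat. bad p}. {v \<in> A. ok p v})"
      using finPat finite_subset[OF A(1) finP] by auto
    ultimately show ?thesis
      using \<eta> by (intro mult_right_mono of_nat_mono card_mono) auto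
  qed
  also have "\<dots> \<le> real (\<Sum>p\<in>{p\<in>?Pat. bad p}. card {v \<in> A. ok p v}) * \<eta> ^ card E"
    using \<eta> finPat by (intro mult_right_mono of_nat_mono card_UN_le) auto
  also have "\<dots> = (\<Sum>p\<in>{p\<in>?Pat. bad p}. real (card {v \<in> A. ok p v}) * \<eta> ^ card E)"
    by (simp add: sum_distrib_right)
  also have "\<dots> \<le> (\<Sum>p\<in>{p\<in>?Pat. bad p}. real (card E) * (sqrt \<tau> * N ^ card I))"
    by (rule sum_mono) (use est in auto)
  also have "\<dots> \<le> (\<Sum>p\<in>?Pat. real (card E) * (sqrt \<tau> * N ^ card I))"
    by (rule sum_mono2) (use finPat N \<open>\<tau> \<ge> 0\<close> in auto)
  also have "\<dots> = (real (card E) * sqrt \<tau> * real (card C) ^ card E) * N ^ card I"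
    using finE by (simp add: card_PiE)
  also have "\<dots> < (\<rho> * \<eta> ^ card E) * N ^ card I"
    using small N by (intro mult_strict_right_mono) auto
  also have "\<dots> = (\<rho> * N ^ card I) * \<eta> ^ card E" by simp
  also have "\<dots> \<le> real (card A) * \<eta> ^ card E"
    using A(2) \<eta> unfolding N_def by (intro mult_right_mono) auto
  finally show False by simp
qed

end


subsection \<open>Digraphs\<close>

lemma finite_UNIV_color [simp]: "finite (UNIV :: color set)" "finite (S :: color set)"
proof -
  show "finite (UNIV :: color set)" by (simp add: UNIV_color)
  then show "finite S" by (rule rev_finite_subset) simp
qed

lemma card_UNIV_color: "card (UNIV :: color set) = 4"
  by (simp add: UNIV_color)

lemma finite_UNIV_color_option: "finite (UNIV :: color option set)"
  by (simp add: UNIV_option_conv)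

lemma card_UNIV_color_option: "card (UNIV :: color option set) = 5"
  by (simp add: UNIV_option_conv card_image card_UNIV_color)

lemma rev_color_rev_color [simp]: "rev_color (rev_color c) = c"
  by (cases c) auto

lemma color_prob_rev [simp]: "color_prob d (rev_color c) = color_prob d c"
  by (cases d; cases c) auto

lemma palettes_rev: "P \<in> palettes \<Longrightarrow> rev_color c \<in> P \<longleftrightarrow> c \<in> P"
  by (cases c) (auto simp: palettes_def palette_all_def palette_compl_def palette_orien_def
      palette_undir_def palette_tourn_def)

lemma color_prob_outside:
  assumes "P \<in> palettes" "density_vector P d" "c \<notin> P"
  shows "color_prob d c = 0"
  using assms by (cases d; cases c) (auto simp: palettes_def density_vector_def palette_all_def
      palette_compl_def palette_orien_def palette_undir_def palette_tourn_def)

lemma color_prob_nonneg: "density_vector P d \<Longrightarrow> 0 \<le> color_prob d c"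
  by (cases d; cases c) (auto simp: density_vector_def)

lemma sum_color_prob: "(\<Sum>c\<in>UNIV. color_prob d c) = 1"
  by (cases d) (simp add: UNIV_color)

lemma sum_color_prob_le_1: "density_vector P d \<Longrightarrow> (\<Sum>c\<in>S. color_prob d c) \<le> 1"
  using sum_mono2[of UNIV S "color_prob d"] color_prob_nonneg[of P d] sum_color_prob[of d] by auto

lemma digraph_rev:
  assumes "is_digraph P G" "v \<in> verts G" "w \<in> verts G" "v \<noteq> w"
  shows "col G w v = rev_color (col G v w)"
proof -
  have A: "\<forall>v\<in>verts G. \<forall>w\<in>verts G. v \<noteq> w \<longrightarrow> col G v w \<in> P \<and>
      (col G v w = col G w v \<longleftrightarrow> col G v w \<in> {NoArc, Both}) \<and> (col G v w = Fwd \<longleftrightarrow> col G w v = Bwd)"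
    using assms(1) unfolding is_digraph_def by (rule conjunct2)
  note bspec[OF bspec[OF A assms(2)] assms(3), THEN mp, OF assms(4)]
    and bspec[OF bspec[OF A assms(3)] assms(2), THEN mp, OF assms(4)[symmetric]]
  then show ?thesis by (cases "col G v w"; cases "col G w v"; simp)
qed

lemma is_digraphI:
  assumes "finite (verts G)"
    and "\<And>v w. v \<in> verts G \<Longrightarrow> w \<in> verts G \<Longrightarrow> v \<noteq> w \<Longrightarrow> col G v w \<in> P"
    and "\<And>v w. v \<in> verts G \<Longrightarrow> w \<in> verts G \<Longrightarrow> v \<noteq> w \<Longrightarrow> col G w v = rev_color (col G v w)"
  shows "is_digraph P G"
  unfolding is_digraph_def
proof (intro conjI ballI impI)
  fix v w assume vw: "v \<in> verts G" "w \<in> verts G" "v \<noteq> w"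
  show "col G v w = col G w v \<longleftrightarrow> col G v w \<in> {NoArc, Both}"
    using assms(3)[OF vw] by (cases "col G v w") auto
  show "col G v w = Fwd \<longleftrightarrow> col G w v = Bwd"
    using assms(3)[OF vw] by (cases "col G v w") auto
qed (use assms(1,2) in auto)

text \<open>\<open>edit_dist\<close> counts unordered pairs, the averaging arguments run over
  ordered pairs, and colour counts use pairs with \<open>v < w\<close>; these are the
  conversions.\<close>

lemma card_ordered_pairs:
  fixes R :: "nat \<Rightarrow> nat \<Rightarrow> bool"
  assumes "finite V" and sym: "\<And>v w. v \<in> V \<Longrightarrow> w \<in> V \<Longrightarrow> R v w \<Longrightarrow> R w v"
  shows "card {{v, w} |v w. v \<in> V \<and> w \<in> V \<and> v \<noteq> w \<and> R v w} = card {(v, w). v \<in> V \<and> w \<in> V \<and> v < w \<and> R v w}"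
    and "card {(v, w). v \<in> V \<and> w \<in> V \<and> v \<noteq> w \<and> R v w} = 2 * card {(v, w). v \<in> V \<and> w \<in> V \<and> v < w \<and> R v w}"
proof -
  let ?L = "{(v, w). v \<in> V \<and> w \<in> V \<and> v < w \<and> R v w}"
  let ?G = "{(v, w). v \<in> V \<and> w \<in> V \<and> w < v \<and> R v w}"
  have fin: "finite ?L" "finite ?G"
    using assms(1) by (auto intro: finite_subset[of _ "V \<times> V"])
  have "{{v, w} |v w. v \<in> V \<and> w \<in> V \<and> v \<noteq> w \<and> R v w} = (\<lambda>(v, w). {v, w}) ` ?L"
  proof (intro equalityI subsetI)
    fix e assume "e \<in> {{v, w} |v w. v \<in> V \<and> w \<in> V \<and> v \<noteq> w \<and> R v w}"
    then obtain v w where e: "e = {v, w}" "v \<in> V" "w \<in> V" "v \<noteq> w" "R v w" by auto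
    then consider "v < w" | "w < v" by linarith
    then show "e \<in> (\<lambda>(v, w). {v, w}) ` ?L"
    proof cases
      case 2
      have "R w v" by (rule sym[OF e(2,3,5)])
      then have "(w, v) \<in> ?L" "e = (\<lambda>(v, w). {v, w}) (w, v)" using e 2 by (simp_all add: insert_commute)
      then show ?thesis by (rule rev_image_eqI)
    next
      case 1
      then have "(v, w) \<in> ?L" "e = (\<lambda>(v, w). {v, w}) (v, w)" using e by simp_all
      then show ?thesis by (rule rev_image_eqI)
    qed
  next
    fix e assume "e \<in> (\<lambda>(v, w). {v, w}) ` ?L"
    then obtain v w where "v \<in> V" "w \<in> V" "v < w" "R v w" "e = {v, w}" by blast
    then show "e \<in> {{v, w} |v w. v \<in> V \<and> w \<in> V \<and> v \<noteq> w \<and> R v w}" by blast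
  qed
  moreover have "inj_on (\<lambda>(v, w). {v, w}) ?L"
    by (auto simp: inj_on_def doubleton_eq_iff)
  ultimately show "card {{v, w} |v w. v \<in> V \<and> w \<in> V \<and> v \<noteq> w \<and> R v w} = card ?L"
    by (simp add: card_image)
  have "?G = prod.swap ` ?L"
  proof (intro equalityI subsetI)
    fix x assume "x \<in> ?G"
    then obtain v w where x: "x = (v, w)" "v \<in> V" "w \<in> V" "w < v" "R v w" by blast
    then have "(w, v) \<in> ?L" using sym[OF x(2,3,5)] by simp
    then show "x \<in> prod.swap ` ?L" by (rule rev_image_eqI) (simp add: x)
  next
    fix x assume "x \<in> prod.swap ` ?L"
    then obtain v w where x: "x = (w, v)" "v \<in> V" "w \<in> V" "v < w" "R v w" by auto
    then show "x \<in> ?G" using sym[OF x(2,3,5)] by simp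
  qed
  then have "card ?G = card ?L" by (simp add: card_image)
  moreover have "{(v, w). v \<in> V \<and> w \<in> V \<and> v \<noteq> w \<and> R v w} = ?L \<union> ?G" by auto
  moreover have "?L \<inter> ?G = {}" by auto
  ultimately show "card {(v, w). v \<in> V \<and> w \<in> V \<and> v \<noteq> w \<and> R v w} = 2 * card ?L"
    using fin by (simp add: card_Un_disjoint)
qed

lemma two_choose_two: "2 * real (n choose 2) = real n * (real n - 1)"
proof -
  show ?thesis by (induction n) (auto simp: numeral_2_eq_2 algebra_simps)
qed

lemma edit_dist_ordered:
  assumes "is_digraph P G" "is_digraph P G'" "verts G' = verts G" "card (verts G) = n"
  shows "real (card {(v, w). v \<in> verts G \<and> w \<in> verts G \<and> v \<noteq> w \<and> col G v w \<noteq> col G' v w})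
    = edit_dist G G' * (real n * (real n - 1))"
proof -
  let ?R = "\<lambda>v w. v \<noteq> w \<and> col G v w \<noteq> col G' v w"
  have fin: "finite (verts G)" using assms by (simp add: is_digraph_def)
  have sym: "?R w v" if "v \<in> verts G" "w \<in> verts G" "?R v w" for v w
  proof -
    have "col G w v = rev_color (col G v w)" "col G' w v = rev_color (col G' v w)"
      using that assms digraph_rev by metis+
    then show ?thesis using that by (metis rev_color_rev_color)
  qed
  have "card {(v, w). v \<in> verts G \<and> w \<in> verts G \<and> v \<noteq> w \<and> ?R v w}
      = 2 * card {{v, w} |v w. v \<in> verts G \<and> w \<in> verts G \<and> v \<noteq> w \<and> ?R v w}"
    using card_ordered_pairs[of "verts G" ?R, OF fin sym] by simp
  then have "real (card {(v, w). v \<in> verts G \<and> w \<in> verts G \<and> v \<noteq> w \<and> col G v w \<noteq> col G' v w})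
      = 2 * real (card {{v, w} |v w. v \<in> verts G \<and> w \<in> verts G \<and> v \<noteq> w \<and> col G v w \<noteq> col G' v w})"
    by simp
  also have "\<dots> = edit_dist G G' * (real n * (real n - 1))"
  proof (cases "n \<ge> 2")
    case True
    then have "real (n choose 2) > 0" by (simp add: zero_less_binomial)
    then show ?thesis unfolding edit_dist_def assms(4) two_choose_two[symmetric] by simp
  next
    \<comment> \<open>With fewer than two vertices both sides vanish, so the product form is
      unaffected by the division by zero in \<open>edit_dist\<close>.\<close>
    case False
    have "{{v, w} |v w. v \<in> verts G \<and> w \<in> verts G \<and> v \<noteq> w \<and> col G v w \<noteq> col G' v w} = {}"
    proof (rule ccontr)
      assume "\<not> ?thesis"
      then obtain v w where "v \<in> verts G" "w \<in> verts G" "v \<noteq> w" by auto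
      then have "card {v, w} \<le> n" using fin assms(4) by (metis bot.extremum card_mono insert_subset)
      then show False using \<open>v \<noteq> w\<close> False by simp
    qed
    then have c: "card {{v, w} |v w. v \<in> verts G \<and> w \<in> verts G \<and> v \<noteq> w \<and> col G v w \<noteq> col G' v w} = 0"
      by (rule ssubst) simp
    have "n = 0 \<or> n = 1" using False by auto
    then have "real n * (real n - 1) = 0" by auto
    then show ?thesis by (simp only: c)
  qed
  finally show ?thesis .
qed

lemma edit_dist_bounds:
  assumes "finite (verts G)"
  shows "0 \<le> edit_dist G G'" "edit_dist G G' \<le> 1"
proof -
  show "0 \<le> edit_dist G G'" by (simp add: edit_dist_def)
  have "{{v, w} |v w. v \<in> verts G \<and> w \<in> verts G \<and> v \<noteq> w \<and> col G v w \<noteq> col G' v w}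
    \<subseteq> {K. K \<subseteq> verts G \<and> card K = 2}" by auto
  then have "card {{v, w} |v w. v \<in> verts G \<and> w \<in> verts G \<and> v \<noteq> w \<and> col G v w \<noteq> col G' v w}
    \<le> card (verts G) choose 2"
    using assms by (subst n_subsets[symmetric]) (auto intro!: card_mono)
  then show "edit_dist G G' \<le> 1"
    unfolding edit_dist_def
    by (cases "card (verts G) choose 2 = 0") (simp_all add: divide_le_eq_1 del: binomial_eq_0_iff)
qed

subsection \<open>Ramsey's theorem for pair colourings\<close>

text \<open>Ramsey's theorem for four colours. As \<open>f\<close> need not be symmetric, a
  two-element set is read in increasing order through \<open>Min\<close> and \<open>Max\<close>;
  \<open>code\<close> numbers the colours.\<close>

lemma monochromatic_subset:
  shows "\<exists>t. \<forall>f :: nat \<Rightarrow> nat \<Rightarrow> color. \<exists>S c. S \<subseteq> {..<t} \<and> card S = m \<and> (\<forall>a\<in>S. \<forall>b\<in>S. a < b \<longrightarrow> f a b = c)"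
proof -
  obtain t :: nat where t: "partn_lst {..<t} [m, m, m, m] 2" using ramsey_full by blast
  have "\<exists>code :: color \<Rightarrow> nat. bij_betw code UNIV {..<4}"
    by (rule finite_same_card_bij) (auto simp: card_UNIV_color)
  then obtain code :: "color \<Rightarrow> nat" where code: "inj code" "\<And>c. code c < 4"
    by (auto simp: bij_betw_def)
  show ?thesis
  proof (intro exI[of _ t] allI)
    fix f :: "nat \<Rightarrow> nat \<Rightarrow> color"
    let ?f = "\<lambda>e. code (f (Min e) (Max e))"
    have len: "length [m, m, m, m] = 4" by simp
    have "?f \<in> nsets {..<t} 2 \<rightarrow> {..<length [m, m, m, m]}" using code unfolding len by auto
    then have "\<exists>i<4. monochromatic {..<t} ([m, m, m, m] ! i) 2 ?f i"
      using t unfolding partn_lst_def len by blast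
    then obtain i H where iH: "i < 4" "H \<in> nsets {..<t} ([m, m, m, m] ! i)" "?f ` nsets H 2 \<subseteq> {i}"
      unfolding monochromatic_def by blast
    have "[m, m, m, m] ! i = m" using iH(1) by (auto simp: less_Suc_eq numeral_eq_Suc)
    then have H: "H \<subseteq> {..<t}" "card H = m" using iH(2) by (auto simp: nsets_def)
    have eq: "code (f a b) = i" if "a \<in> H" "b \<in> H" "a < b" for a b
    proof -
      have "{a, b} \<in> nsets H 2" using that by simp
      then have "?f {a, b} = i" using iH(3) by blast
      then show ?thesis using that by simp
    qed
    have "\<forall>a\<in>H. \<forall>b\<in>H. a < b \<longrightarrow> f a b = inv code i"
      using eq code(1) by (metis inv_f_f)
    then show "\<exists>S c. S \<subseteq> {..<t} \<and> card S = m \<and> (\<forall>a\<in>S. \<forall>b\<in>S. a < b \<longrightarrow> f a b = c)"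
      using H by blast
  qed
qed

text \<open>An acyclic tournament is a linear order, and counting predecessors in the transitive
  closure ranks its vertices.\<close>

lemma acyclic_rank:
  assumes "finite Y" and ac: "acyclic {(v, w). v \<in> Y \<and> w \<in> Y \<and> R v w}"
    and tot: "\<And>v w. v \<in> Y \<Longrightarrow> w \<in> Y \<Longrightarrow> v \<noteq> w \<Longrightarrow> R v w \<or> R w v"
  shows "\<exists>pos. inj_on pos Y \<and> pos ` Y \<subseteq> {..<card Y} \<and> (\<forall>v\<in>Y. \<forall>w\<in>Y. pos v < (pos w :: nat) \<longrightarrow> R v w)"
proof -
  define T where "T = {(v, w). v \<in> Y \<and> w \<in> Y \<and> R v w}"
  define pos where "pos v = card {w. (w, v) \<in> T\<^sup>+}" for v
  have TY: "T\<^sup>+ \<subseteq> Y \<times> Y" by (rule trancl_subset_Sigma) (auto simp: T_def)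
  have fin: "finite {w. (w, v) \<in> T\<^sup>+}" for v
    by (rule finite_subset[OF _ assms(1)]) (use TY in auto)
  have less: "pos v < pos w" if "v \<in> Y" "w \<in> Y" "R v w" for v w
    unfolding pos_def
  proof (rule psubset_card_mono[OF fin], rule psubsetI)
    have vw: "(v, w) \<in> T\<^sup>+" using that by (auto simp: T_def)
    then show "{u. (u, v) \<in> T\<^sup>+} \<subseteq> {u. (u, w) \<in> T\<^sup>+}" by auto
    have "(v, v) \<notin> T\<^sup>+" using ac unfolding T_def[symmetric] acyclic_def by blast
    then show "{u. (u, v) \<in> T\<^sup>+} \<noteq> {u. (u, w) \<in> T\<^sup>+}" using vw by blast
  qed
  have "inj_on pos Y"
    by (rule inj_onI) (metis less less_irrefl tot)
  moreover have "pos ` Y \<subseteq> {..<card Y}"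
  proof clarsimp
    fix v assume "v \<in> Y"
    have "(v, v) \<notin> T\<^sup>+" using ac unfolding T_def[symmetric] acyclic_def by blast
    then have "{w. (w, v) \<in> T\<^sup>+} \<subset> Y" using TY \<open>v \<in> Y\<close> by auto
    then show "pos v < card Y" unfolding pos_def by (intro psubset_card_mono assms(1))
  qed
  moreover have "R v w" if "v \<in> Y" "w \<in> Y" "pos v < pos w" for v w
    using that less[of w v] tot[of v w] by (cases "v = w") auto
  ultimately show ?thesis by blast
qed


subsection \<open>Supports of cell pairs\<close>

text \<open>\<open>col\<close> is arbitrary on the diagonal, which therefore gets a colour of its
  own. As a consequence, two sampled vertices that realise a \<open>Some\<close> colour are
  distinct.\<close>

definition arc_colour :: "digraph \<Rightarrow> nat \<Rightarrow> nat \<Rightarrow> color option" where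
  "arc_colour G x y = (if x = y then None else Some (col G x y))"

text \<open>One-sided on purpose: a colour must not be too frequent between two vertex sets. This
  suffices for bounding the number of agreements with another digraph.\<close>

definition quasirandom :: "real \<Rightarrow> real \<times> real \<Rightarrow> nat \<Rightarrow> digraph \<Rightarrow> bool" where
  "quasirandom \<kappa> d n G \<longleftrightarrow> (\<forall>A\<subseteq>{..<n}. \<forall>B\<subseteq>{..<n}. \<forall>c.
     real (card {(x, y). x \<in> A \<and> y \<in> B \<and> x \<noteq> y \<and> col G x y = c})
       \<le> color_prob d c * (real (card A) * real (card B)) + \<kappa> * real n ^ 2)"

text \<open>The probability that a colour with law \<open>color_prob d\<close> avoids
  \<open>S\<close>; this is the matrix entry of a type for the label \<open>S\<close>.\<close>

definition miss :: "real \<times> real \<Rightarrow> color set \<Rightarrow> real" where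
  "miss d S = 1 - (\<Sum>c\<in>S. color_prob d c)"

lemma miss_bounds:
  assumes "density_vector P d"
  shows "0 \<le> miss d S" "miss d S \<le> 1"
  using sum_color_prob_le_1[OF assms, of S] sum_nonneg[of S "color_prob d"] color_prob_nonneg[OF assms]
  by (auto simp: miss_def)

lemma type_matrix_eq_miss: "type_matrix K d x y = miss d (tcol K x y)"
proof -
  obtain p q where d: "d = (p, q)" by (cases d)
  have "(\<Sum>c\<in>tcol K x y. color_prob d c) = (\<Sum>c\<in>UNIV. if c \<in> tcol K x y then color_prob d c else 0)"
    by (simp add: sum.If_cases)
  moreover have "{Bwd, Fwd} \<inter> tcol K x y = (if Bwd \<in> tcol K x y then {Bwd} else {}) \<union> (if Fwd \<in> tcol K x y then {Fwd} else {})"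
    by auto
  ultimately show ?thesis
    unfolding miss_def type_matrix_def d UNIV_color by (simp add: algebra_simps)
qed

locale sampled_digraph =
  fixes P :: "color set" and n :: nat and G' :: digraph
  assumes digraph: "is_digraph P G'" and verts: "verts G' = {..<n}" and n_pos: "n > 0"
begin

sublocale edge_colouring "{..<n}" "arc_colour G'" "map_option rev_color" UNIV
proof
  show "{..<n} \<noteq> {}" using n_pos by auto
  show "arc_colour G' y x = map_option rev_color (arc_colour G' x y)" if "x \<in> {..<n}" "y \<in> {..<n}" for x y
    using digraph_rev[OF digraph, of x y] that by (auto simp: arc_colour_def verts)
qed (auto simp: finite_UNIV_color_option)

text \<open>The colours that are not too rare between the two cells of \<open>z\<close>. The
  discarded ones account for few arcs, and those that are kept can be realised.\<close>

definition support :: "nat list \<Rightarrow> real \<Rightarrow> nat \<times> nat \<Rightarrow> color set" where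
  "support u \<eta> z = {c. dens u (Some c) z > \<eta>}"

lemma support_cong:
  "profile u x = profile u x' \<Longrightarrow> profile u y = profile u y' \<Longrightarrow> support u \<eta> (x, y) = support u \<eta> (x', y')"
  unfolding support_def by (simp add: dens_cong[of u x x' y y'])

lemma dens_flip:
  assumes "x < n" "y < n"
  shows "dens u (map_option rev_color c) (y, x) = dens u c (x, y)"
proof -
  let ?V = "{..<n}" and ?c = "map_option rev_color c"
  let ?C1 = "{z \<in> ?V \<times> ?V. cell u z = cell u (x, y)}"
  let ?C2 = "{z \<in> ?V \<times> ?V. cell u z = cell u (y, x)}"
  have bij: "bij_betw prod.swap ?C1 ?C2"
    by (rule bij_betw_byWitness[where f' = prod.swap]) (auto simp: cell_def)
  have inv: "map_option rev_color (map_option rev_color o1) = o1" for o1 :: "color option"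
    by (cases o1) auto
  have "(\<Sum>z\<in>?C2. (\<lambda>(x, y). of_bool (arc_colour G' x y = ?c) :: real) z)
    = (\<Sum>z\<in>?C1. (\<lambda>(x, y). of_bool (arc_colour G' x y = ?c) :: real) (prod.swap z))"
    by (rule sum.reindex_bij_betw[OF bij, symmetric])
  also have "\<dots> = (\<Sum>z\<in>?C1. (\<lambda>(x, y). of_bool (arc_colour G' x y = c) :: real) z)"
  proof (rule sum.cong[OF refl])
    fix z assume "z \<in> ?C1"
    then obtain a b where z: "z = (a, b)" "a \<in> ?V" "b \<in> ?V" by auto
    have "arc_colour G' b a = ?c \<longleftrightarrow> arc_colour G' a b = c"
      unfolding flip[OF z(2,3)] using inv by metis
    then show "(\<lambda>(x, y). of_bool (arc_colour G' x y = ?c) :: real) (prod.swap z)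
        = (\<lambda>(x, y). of_bool (arc_colour G' x y = c)) z"
      by (simp add: z)
  qed
  finally show ?thesis
    unfolding dens_def cavg_def using bij_betw_same_card[OF bij] by simp
qed

lemma support_flip:
  assumes "x < n" "y < n"
  shows "c \<in> support u \<eta> (y, x) \<longleftrightarrow> rev_color c \<in> support u \<eta> (x, y)"
  unfolding support_def using dens_flip[OF assms, of u "Some (rev_color c)"] by simp

lemma sum_dens:
  assumes "z \<in> {..<n} \<times> {..<n}"
  shows "(\<Sum>c\<in>UNIV. dens u c z) = 1"
proof -
  let ?C = "{y \<in> {..<n} \<times> {..<n}. cell u y = cell u z}"
  have "card ?C \<noteq> 0" using assms by auto
  have "(\<Sum>c\<in>UNIV. \<Sum>y\<in>?C. (\<lambda>(x, y). of_bool (arc_colour G' x y = c) :: real) y)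
    = (\<Sum>y\<in>?C. \<Sum>c\<in>UNIV. (\<lambda>(x, y). of_bool (arc_colour G' x y = c) :: real) y)"
    by (rule sum.swap)
  also have "\<dots> = (\<Sum>y\<in>?C. 1)"
    by (rule sum.cong) (auto simp: of_bool_def finite_UNIV_color_option)
  finally show ?thesis
    unfolding dens_def cavg_def sum_divide_distrib[symmetric] using \<open>card ?C \<noteq> 0\<close> by simp
qed

lemma support_subset:
  assumes "x < n" "y < n" "\<eta> \<ge> 0"
  shows "support u \<eta> (x, y) \<subseteq> P"
proof
  fix c assume c: "c \<in> support u \<eta> (x, y)"
  show "c \<in> P"
  proof (rule ccontr)
    assume "c \<notin> P"
    then have "arc_colour G' a b \<noteq> Some c" if "a < n" "b < n" for a b
      using digraph that unfolding is_digraph_def verts arc_colour_def by auto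
    then have "dens u (Some c) (x, y) = 0"
      unfolding dens_def cavg_def by (subst sum.neutral) auto
    then show False using c assms by (simp add: support_def)
  qed
qed

lemma sum_dens_None: "(\<Sum>z\<in>{..<n} \<times> {..<n}. dens u None z) = real n"
proof -
  have "(\<Sum>z\<in>{..<n} \<times> {..<n}. dens u None z * 1)
    = (\<Sum>z\<in>{..<n} \<times> {..<n}. (\<lambda>(x, y). of_bool (arc_colour G' x y = None)) z * 1)"
    unfolding dens_def by (rule sum_cavg_mult) auto
  also have "\<dots> = (\<Sum>x<n. \<Sum>y<n. of_bool (x = y))"
    unfolding sum.cartesian_product by (rule sum.cong) (auto simp: arc_colour_def)
  also have "\<dots> = real n" by (simp add: of_bool_def)
  finally show ?thesis by simp
qed

text \<open>Where the support is empty, the four colours together have density at most 1/2, so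
  \<open>None\<close> has density at least 1/2. But the total mass of \<open>None\<close> is that of
  the diagonal, namely \<open>n\<close>.\<close>

lemma card_empty_support:
  assumes "\<eta> \<le> 1 / 8"
  shows "real (card {z \<in> {..<n} \<times> {..<n}. support u \<eta> z = {}}) \<le> 2 * real n"
proof -
  let ?Z = "{z \<in> {..<n} \<times> {..<n}. support u \<eta> z = {}}"
  have "1 / 2 \<le> dens u None z" if z: "z \<in> ?Z" for z
  proof -
    have "(\<Sum>c\<in>UNIV. dens u (Some c) z) \<le> (\<Sum>c\<in>(UNIV :: color set). \<eta>)"
      using z by (intro sum_mono) (auto simp: support_def not_less)
    also have "\<dots> \<le> 1 / 2" using assms by (simp add: card_UNIV_color)
    finally have "(\<Sum>c\<in>UNIV. dens u (Some c) z) \<le> 1 / 2" .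
    moreover have "(\<Sum>c\<in>UNIV. dens u c z) = dens u None z + (\<Sum>c\<in>UNIV. dens u (Some c) z)"
      by (simp add: UNIV_option_conv sum.reindex)
    ultimately show ?thesis using sum_dens[of z u] z by auto
  qed
  then have "(\<Sum>z\<in>?Z. 1 / 2) \<le> (\<Sum>z\<in>?Z. dens u None z)" by (rule sum_mono)
  also have "\<dots> \<le> (\<Sum>z\<in>{..<n} \<times> {..<n}. dens u None z)"
    by (rule sum_mono2) (auto intro: dens_bounds)
  finally show ?thesis by (simp add: sum_dens_None)
qed

text \<open>Four colours and \<open>None\<close> allow at most \<open>5 ^ l\<close> profiles, and a
  cell of pairs is given by two of them.\<close>

lemma card_cells:
  assumes "length u \<le> l"
  shows "real (card (cell u ` Z)) \<le> (5 ^ l) ^ 2"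
proof -
  let ?L = "{xs :: color option list. set xs \<subseteq> UNIV \<and> length xs = length u}"
  have fin: "finite ?L" by (rule finite_lists_length_eq[OF finite_UNIV_color_option])
  have "cell u ` Z \<subseteq> ?L \<times> ?L" by (auto simp: cell_def profile_def)
  then have "card (cell u ` Z) \<le> card (?L \<times> ?L)" using fin by (intro card_mono) auto
  also have "\<dots> = (5 ^ length u) ^ 2"
    using card_lists_length_eq[OF finite_UNIV_color_option, of "length u"]
    by (simp add: card_cartesian_product power2_eq_square card_UNIV_color_option)
  also have "\<dots> \<le> (5 ^ l) ^ 2"
    using assms by (intro power_mono power_increasing) auto
  finally show ?thesis by (metis of_nat_le_iff of_nat_numeral of_nat_power)
qed

text \<open>The agreements of \<open>G\<close> and \<open>G'\<close> are bounded colour by colour.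
  Where \<open>c\<close> is outside the support, \<open>G'\<close> itself rarely has it, which costs
  \<open>\<eta>\<close>. Where \<open>c\<close> is inside, quasirandomness limits how often
  \<open>G\<close> has it on each product of cells, which costs \<open>\<kappa>\<close> for each of
  at most \<open>(5 ^ l) ^ 2\<close> products. All other pairs are edits or lie on the
  diagonal.\<close>

lemma sum_miss_support_le:
  assumes G: "is_digraph P G" "verts G = {..<n}" and qr: "quasirandom \<kappa> d n G"
    and dv: "density_vector P d" and "\<eta> \<ge> 0" "\<kappa> \<ge> 0" and u: "length u \<le> l"
  shows "(\<Sum>z\<in>{..<n} \<times> {..<n}. miss d (support u \<eta> z))
    \<le> (edit_dist G G' + 4 * \<eta> + 4 * \<kappa> * (5 ^ l) ^ 2) * real n ^ 2 + real n"
proof -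
  let ?Z = "{..<n} \<times> {..<n}"
  define R :: real where "R = (5 ^ l) ^ 2"
  define g where "g c = (\<lambda>(x, y). of_bool (x \<noteq> y \<and> col G x y = c) :: real)" for c
  define f where "f c = (\<lambda>(x, y). of_bool (arc_colour G' x y = Some c) :: real)" for c
  have fg: "0 \<le> f c z" "f c z \<le> 1" "0 \<le> g c z" "g c z \<le> 1" for c z
    by (auto simp: f_def g_def split_def)
  have cls: "(\<Sum>z\<in>?Z. f c z * g c z) \<le> color_prob d c * real (card {z \<in> ?Z. c \<in> support u \<eta> z})
      + R * (\<kappa> * real n ^ 2) + \<eta> * real n ^ 2" for c
  proof -
    let ?Y = "{z \<in> ?Z. c \<in> support u \<eta> z}" and ?Y' = "{z \<in> ?Z. c \<notin> support u \<eta> z}"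
    have "(\<Sum>z\<in>?Z. f c z * g c z) = (\<Sum>z\<in>?Y. f c z * g c z) + (\<Sum>z\<in>?Y'. f c z * g c z)"
      by (subst sum.union_disjoint[symmetric]) (auto intro!: sum.cong)
    also have "(\<Sum>z\<in>?Y'. f c z * g c z) \<le> (\<Sum>z\<in>?Y'. f c z)"
      using fg by (intro sum_mono) (auto intro: mult_left_le)
    also have "(\<Sum>z\<in>?Y'. f c z) = (\<Sum>z\<in>?Z. f c z * of_bool (c \<notin> support u \<eta> z))"
      by (rule sum.mono_neutral_cong_left) auto
    also have "\<dots> = (\<Sum>z\<in>?Z. dens u (Some c) z * of_bool (c \<notin> support u \<eta> z))"
      unfolding dens_def f_def
    proof (rule sum_cavg_mult[symmetric])
      fix y z assume "cell u y = cell u z"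
      then have "support u \<eta> y = support u \<eta> z"
        using support_cong[of u "fst y" "fst z" "snd y" "snd z"] by (auto simp: cell_def map_prod_def split_def)
      then show "of_bool (c \<notin> support u \<eta> y) = of_bool (c \<notin> support u \<eta> z)" by simp
    qed auto
    also have "\<dots> \<le> (\<Sum>z\<in>?Z. \<eta>)"
      using \<open>\<eta> \<ge> 0\<close> by (intro sum_mono) (auto simp: support_def not_less)
    also have "\<dots> = \<eta> * real n ^ 2" by (simp add: card_cartesian_product power2_eq_square)
    finally have 1: "(\<Sum>z\<in>?Z. f c z * g c z) \<le> (\<Sum>z\<in>?Y. f c z * g c z) + \<eta> * real n ^ 2" by simp
    have "(\<Sum>z\<in>?Y. f c z * g c z) \<le> (\<Sum>z\<in>?Y. g c z)"
      using fg by (intro sum_mono) (auto intro: mult_left_le_one_le)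
    also have "\<dots> = (\<Sum>t\<in>cell u ` ?Y. \<Sum>z\<in>{z \<in> ?Y. cell u z = t}. g c z)"
      by (rule sum.image_gen) auto
    also have "\<dots> \<le> (\<Sum>t\<in>cell u ` ?Y. color_prob d c * real (card {z \<in> ?Y. cell u z = t}) + \<kappa> * real n ^ 2)"
    proof (rule sum_mono)
      fix t assume "t \<in> cell u ` ?Y"
      then obtain x0 y0 where xy: "x0 < n" "y0 < n" "c \<in> support u \<eta> (x0, y0)" "t = cell u (x0, y0)"
        by auto
      define A B where "A = {x. x < n \<and> profile u x = profile u x0}" and "B = {x. x < n \<and> profile u x = profile u y0}"
      have AB: "A \<subseteq> {..<n}" "B \<subseteq> {..<n}" by (auto simp: A_def B_def)
      have "c \<in> support u \<eta> z" if "cell u z = t" for z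
        using that xy support_cong[of u "fst z" x0 "snd z" y0 \<eta>] by (cases z) (simp add: cell_def)
      \<comment> \<open>The support is constant on cells, so the part inside one cell is a full
        product of two vertex sets, to which quasirandomness applies.\<close>
      then have "{z \<in> ?Y. cell u z = t} = {z \<in> ?Z. cell u z = t}" by blast
      also have "\<dots> = A \<times> B" by (auto simp: xy(4) A_def B_def cell_def)
      finally have eq: "{z \<in> ?Y. cell u z = t} = A \<times> B" .
      have fin: "finite (A \<times> B)" using AB by (auto intro: finite_subset)
      have "(\<Sum>z\<in>A \<times> B. g c z) = real (card {(x, y). x \<in> A \<and> y \<in> B \<and> x \<noteq> y \<and> col G x y = c})"
        unfolding g_def split_def
        by (subst sum_of_bool_eq, rule fin) (intro arg_cong[where f = "\<lambda>S. real (card S)"], auto)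
      also have "\<dots> \<le> color_prob d c * (real (card A) * real (card B)) + \<kappa> * real n ^ 2"
        using qr AB unfolding quasirandom_def by blast
      finally show "(\<Sum>z\<in>{z \<in> ?Y. cell u z = t}. g c z)
          \<le> color_prob d c * real (card {z \<in> ?Y. cell u z = t}) + \<kappa> * real n ^ 2"
        unfolding eq by (simp add: card_cartesian_product)
    qed
    also have "\<dots> = color_prob d c * (\<Sum>t\<in>cell u ` ?Y. \<Sum>z\<in>{z \<in> ?Y. cell u z = t}. 1)
        + real (card (cell u ` ?Y)) * (\<kappa> * real n ^ 2)"
      by (simp add: sum.distrib sum_distrib_left)
    also have "(\<Sum>t\<in>cell u ` ?Y. \<Sum>z\<in>{z \<in> ?Y. cell u z = t}. 1) = (\<Sum>z\<in>?Y. 1 :: real)"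
      by (rule sum.image_gen[symmetric]) auto
    also have "real (card (cell u ` ?Y)) * (\<kappa> * real n ^ 2) \<le> R * (\<kappa> * real n ^ 2)"
      unfolding R_def using card_cells[OF u] \<open>\<kappa> \<ge> 0\<close> by (intro mult_right_mono) auto
    finally show ?thesis using 1 by simp
  qed
  have agree: "(\<Sum>c\<in>UNIV. f c z * g c z) = of_bool (fst z \<noteq> snd z \<and> col G (fst z) (snd z) = col G' (fst z) (snd z))"
    if "z \<in> ?Z" for z
  proof -
    obtain x y where z: "z = (x, y)" by (cases z)
    have "(\<Sum>c\<in>UNIV. f c z * g c z) = (\<Sum>c\<in>UNIV. if c = col G x y then of_bool (x \<noteq> y \<and> col G x y = col G' x y) else 0)"
      by (rule sum.cong) (auto simp: z f_def g_def arc_colour_def)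
    then show ?thesis by (simp add: z)
  qed
  have "real n ^ 2 = (\<Sum>z\<in>?Z. 1)" by (simp add: card_cartesian_product power2_eq_square)
  also have "\<dots> = (\<Sum>z\<in>?Z. of_bool (fst z \<noteq> snd z \<and> col G (fst z) (snd z) = col G' (fst z) (snd z))
      + of_bool (fst z = snd z) + of_bool (fst z \<noteq> snd z \<and> col G (fst z) (snd z) \<noteq> col G' (fst z) (snd z)))"
    by (rule sum.cong) auto
  also have "\<dots> = (\<Sum>z\<in>?Z. \<Sum>c\<in>UNIV. f c z * g c z) + (\<Sum>z\<in>?Z. of_bool (fst z = snd z))
      + (\<Sum>z\<in>?Z. of_bool (fst z \<noteq> snd z \<and> col G (fst z) (snd z) \<noteq> col G' (fst z) (snd z)))"
    using agree by (simp add: sum.distrib)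
  also have "(\<Sum>z\<in>?Z. of_bool (fst z = snd z)) = real n"
  proof -
    have "(\<Sum>z\<in>?Z. of_bool (fst z = snd z)) = (\<Sum>x<n. \<Sum>y<n. of_bool (x = y) :: real)"
      unfolding sum.cartesian_product by (rule sum.cong) auto
    then show ?thesis by (simp add: of_bool_def)
  qed
  also have "(\<Sum>z\<in>?Z. of_bool (fst z \<noteq> snd z \<and> col G (fst z) (snd z) \<noteq> col G' (fst z) (snd z)))
    = real (card {(x, y). x \<in> verts G \<and> y \<in> verts G \<and> x \<noteq> y \<and> col G x y \<noteq> col G' x y})"
    unfolding G by (subst sum_of_bool_eq, simp)
      (intro arg_cong[where f = "\<lambda>S. real (card S)"], auto)
  also have "\<dots> = edit_dist G G' * (real n * (real n - 1))"
    by (rule edit_dist_ordered[OF G(1) digraph]) (auto simp: verts G)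
  also have "\<dots> \<le> edit_dist G G' * real n ^ 2"
  proof (rule mult_left_mono)
    show "real n * (real n - 1) \<le> real n ^ 2" by (simp add: power2_eq_square algebra_simps)
    show "0 \<le> edit_dist G G'" by (rule edit_dist_bounds(1)) (simp add: G(2))
  qed
  also have "(\<Sum>z\<in>?Z. \<Sum>c\<in>UNIV. f c z * g c z) = (\<Sum>c\<in>UNIV. \<Sum>z\<in>?Z. f c z * g c z)"
    by (rule sum.swap)
  also have "\<dots> \<le> (\<Sum>c\<in>UNIV. color_prob d c * real (card {z \<in> ?Z. c \<in> support u \<eta> z})
      + R * (\<kappa> * real n ^ 2) + \<eta> * real n ^ 2)"
    by (rule sum_mono[OF cls])
  also have "\<dots> = (\<Sum>c\<in>UNIV. color_prob d c * real (card {z \<in> ?Z. c \<in> support u \<eta> z}))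
      + 4 * (R * (\<kappa> * real n ^ 2) + \<eta> * real n ^ 2)"
    by (simp add: sum.distrib card_UNIV_color)
  also have "(\<Sum>c\<in>UNIV. color_prob d c * real (card {z \<in> ?Z. c \<in> support u \<eta> z}))
      = (\<Sum>c\<in>UNIV. \<Sum>z\<in>?Z. color_prob d c * of_bool (c \<in> support u \<eta> z))"
    by (simp add: sum_distrib_left[symmetric] sum_of_bool_eq Int_def conj_commute)
  also have "\<dots> = (\<Sum>z\<in>?Z. \<Sum>c\<in>UNIV. color_prob d c * of_bool (c \<in> support u \<eta> z))"
    by (rule sum.swap)
  also have "\<dots> = (\<Sum>z\<in>?Z. \<Sum>c\<in>support u \<eta> z. color_prob d c)"
    by (intro sum.cong[OF refl] sum.mono_neutral_cong_right) auto
  also have "\<dots> = real n ^ 2 - (\<Sum>z\<in>?Z. miss d (support u \<eta> z))"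
    by (simp add: miss_def sum_subtractf card_cartesian_product power2_eq_square)
  finally show ?thesis unfolding R_def by (simp add: algebra_simps)
qed

end


section \<open>Support patterns of random k-tuples\<close>

lemma sum_PiE_pair:
  fixes F :: "'v \<times> 'v \<Rightarrow> real"
  assumes "finite V" "finite I" "i \<in> I" "j \<in> I" "i \<noteq> j"
  shows "real (card V) ^ 2 * (\<Sum>v\<in>PiE I (\<lambda>_. V). F (v i, v j)) = real (card V) ^ card I * (\<Sum>z\<in>V \<times> V. F z)"
proof -
  have "card {i, j} = 2" "{i, j} \<subseteq> I" using assms by auto
  then have "card (I - {i, j}) + 2 = card I"
    using assms card_Diff_subset[of "{i, j}" I] card_mono[of I "{i, j}"] by simp
  then have c: "real (card V) ^ 2 * real (card V) ^ card (I - {i, j}) = real (card V) ^ card I"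
    by (metis power_add add.commute)
  have "(\<Sum>v\<in>PiE I (\<lambda>_. V). F (v i, v j))
      = (\<Sum>w\<in>PiE (I - {i, j}) (\<lambda>_. V). \<Sum>(x, y)\<in>V \<times> V. F (x, y))"
    using assms by (subst sum_PiE_two[OF assms(2-5)]) (auto intro!: sum.cong)
  also have "\<dots> = real (card V) ^ card (I - {i, j}) * (\<Sum>z\<in>V \<times> V. F z)"
    using assms by (simp add: card_PiE)
  finally show ?thesis using c by (simp add: mult.assoc[symmetric])
qed

definition off_diag :: "nat \<Rightarrow> (nat \<times> nat) set" where
  "off_diag k = {(i, j). i < k \<and> j < k \<and> i \<noteq> j}"

lemma off_diag: "finite (off_diag k)" "real (card (off_diag k)) \<le> real k ^ 2"
proof -
  have sub: "off_diag k \<subseteq> {..<k} \<times> {..<k}" by (auto simp: off_diag_def)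
  then show "finite (off_diag k)" by (rule finite_subset) simp
  have "card (off_diag k) \<le> k * k"
    using card_mono[OF _ sub] by (simp add: card_cartesian_product)
  then show "real (card (off_diag k)) \<le> real k ^ 2"
    by (simp add: power2_eq_square flip: of_nat_mult)
qed

definition type_on :: "nat \<Rightarrow> (nat \<times> nat \<Rightarrow> color set) \<Rightarrow> dir_type" where
  "type_on k lab = \<lparr>tverts = {..<k}, tcol = (\<lambda>i j. lab (i, j))\<rparr>"

text \<open>The labels are extensional functions so that the set is finite, as the pigeonhole
  argument over the orders \<open>m\<close> requires.\<close>

definition types_on :: "nat \<Rightarrow> dir_type set" where
  "types_on k = type_on k ` PiE ({..<k} \<times> {..<k}) (\<lambda>_. UNIV)"

lemma finite_types_on: "finite (types_on k)"
  unfolding types_on_def by (intro finite_imageI finite_PiE) (auto simp: Finite_Set.finite_set)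

text \<open>Each of the \<open>k\<close> diagonal entries is at most 1 and has weight
  \<open>1 / real k ^ 2\<close>, whence the summand \<open>1 / real k\<close>.\<close>

lemma f_fun_type_on_le:
  assumes "density_vector P d" "k > 0" and le: "(\<Sum>(i, j)\<in>off_diag k. miss d (lab (i, j))) \<le> real k ^ 2 * b"
  shows "f_fun (type_on k lab) d \<le> b + 1 / real k"
proof -
  have split: "{..<k} \<times> {..<k} = off_diag k \<union> (\<lambda>i. (i, i)) ` {..<k}"
    by (auto simp: off_diag_def)
  have "(\<Sum>i<k. \<Sum>j<k. miss d (lab (i, j))) = (\<Sum>(i, j)\<in>{..<k} \<times> {..<k}. miss d (lab (i, j)))"
    by (rule sum.cartesian_product)
  also have "\<dots> = (\<Sum>(i, j)\<in>off_diag k. miss d (lab (i, j))) + (\<Sum>(i, j)\<in>(\<lambda>i. (i, i)) ` {..<k}. miss d (lab (i, j)))"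
    unfolding split using off_diag(1) by (intro sum.union_disjoint) (auto simp: off_diag_def)
  also have "(\<Sum>(i, j)\<in>(\<lambda>i. (i, i)) ` {..<k}. miss d (lab (i, j))) = (\<Sum>i<k. miss d (lab (i, i)))"
    by (subst sum.reindex) (auto simp: inj_on_def)
  also have "\<dots> \<le> (\<Sum>i<k. 1)"
    by (intro sum_mono miss_bounds(2)[OF assms(1)])
  finally have "(\<Sum>i<k. \<Sum>j<k. miss d (lab (i, j))) \<le> real k ^ 2 * b + real k" using le by simp
  then have "(\<Sum>i<k. \<Sum>j<k. miss d (lab (i, j))) / real k ^ 2 \<le> (real k ^ 2 * b + real k) / real k ^ 2"
    by (intro divide_right_mono) auto
  moreover have "f_fun (type_on k lab) d = (\<Sum>i<k. \<Sum>j<k. miss d (lab (i, j))) / real k ^ 2"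
    unfolding f_fun_def type_form_def type_matrix_eq_miss
    by (simp add: type_on_def sum_divide_distrib power2_eq_square)
  moreover have "(real k ^ 2 * b + real k) / real k ^ 2 = b + 1 / real k"
    using assms(2) by (simp add: field_simps power2_eq_square)
  ultimately show ?thesis by simp
qed

context sampled_digraph
begin

text \<open>First moment and pigeonhole. A random k-tuple has mean total loss at most
  \<open>real k ^ 2 * (b + \<epsilon> / 2)\<close>. If every pattern of loss at most
  \<open>real k ^ 2 * (b + \<epsilon>)\<close> were rare, then the at most
  \<open>16 ^ (k * k)\<close> patterns would cover only a fraction \<open>\<epsilon> / 8\<close> of
  the tuples, and the others would push the mean too high, because \<open>(1 - \<epsilon> / 8) * (b
  + \<epsilon>) \<ge> b + 3 * \<epsilon> / 4\<close>. Here 16 is the number of sets of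
  colours.\<close>

lemma pattern_density:
  assumes dv: "density_vector P0 d" and k: "k > 0" and \<epsilon>: "0 < \<epsilon>" "\<epsilon> \<le> 1" and b: "0 \<le> b" "b \<le> 1"
    and le: "(\<Sum>z\<in>{..<n} \<times> {..<n}. miss d (support u \<eta> z)) \<le> (b + \<epsilon> / 2) * real n ^ 2"
  shows "\<exists>L. (\<Sum>(i, j)\<in>off_diag k. miss d (L (i, j))) \<le> real k ^ 2 * (b + \<epsilon>)
    \<and> \<epsilon> / 8 / 16 ^ (k * k) * real n ^ k
       \<le> real (card {x \<in> PiE {..<k} (\<lambda>_. {..<n}). \<forall>i<k. \<forall>j<k. support u \<eta> (x i, x j) = L (i, j)})"
proof (rule ccontr)
  let ?X = "PiE {..<k} (\<lambda>_. {..<n})" and ?LS = "PiE ({..<k} \<times> {..<k}) (\<lambda>_. UNIV :: color set set)"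
  define Lx where "Lx x = (\<lambda>(i, j)\<in>{..<k} \<times> {..<k}. support u \<eta> (x i, x j))" for x
  define tot where "tot L = (\<Sum>(i, j)\<in>off_diag k. miss d (L (i, j)))" for L
  define \<rho> where "\<rho> = \<epsilon> / 8 / 16 ^ (k * k)"
  assume "\<not> ?thesis"
  then have few: "real (card {x \<in> ?X. \<forall>i<k. \<forall>j<k. support u \<eta> (x i, x j) = L (i, j)}) < \<rho> * real n ^ k"
    if "tot L \<le> real k ^ 2 * (b + \<epsilon>)" for L
    using that unfolding tot_def \<rho>_def by (meson not_le)
  have finX: "finite ?X" by (auto intro: finite_PiE)
  have cardX: "real (card ?X) = real n ^ k" by (simp add: card_PiE)
  have finLS: "finite ?LS" by (intro finite_PiE) (auto simp: Finite_Set.finite_set)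
  have "card (UNIV :: color set set) = 16"
    using card_Pow[OF finite_UNIV_color(1)] by (simp add: card_UNIV_color)
  then have cardLS: "card ?LS = 16 ^ (k * k)" by (simp add: card_PiE card_cartesian_product)
  have tot0: "0 \<le> tot L" for L
    unfolding tot_def by (intro sum_nonneg) (auto intro: miss_bounds[OF dv])
  have LxLS: "Lx x \<in> ?LS" for x by (auto simp: Lx_def)
  have Lx_iff: "Lx x = Lx y \<longleftrightarrow> (\<forall>i<k. \<forall>j<k. support u \<eta> (x i, x j) = Lx y (i, j))" for x y
    by (auto simp: Lx_def fun_eq_iff restrict_def)
  have totLx: "tot (Lx x) = (\<Sum>(i, j)\<in>off_diag k. miss d (support u \<eta> (x i, x j)))" for x
    unfolding tot_def by (rule sum.cong) (auto simp: off_diag_def Lx_def)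
  have "real n ^ 2 * (\<Sum>x\<in>?X. tot (Lx x))
      = (\<Sum>(i, j)\<in>off_diag k. real n ^ 2 * (\<Sum>x\<in>?X. miss d (support u \<eta> (x i, x j))))"
    unfolding totLx split_def by (subst sum.swap) (simp add: sum_distrib_left)
  also have "\<dots> = (\<Sum>(i, j)\<in>off_diag k. real n ^ k * (\<Sum>z\<in>{..<n} \<times> {..<n}. miss d (support u \<eta> z)))"
  proof (intro sum.cong refl, clarify)
    fix i j assume "(i, j) \<in> off_diag k"
    then show "real n ^ 2 * (\<Sum>x\<in>?X. miss d (support u \<eta> (x i, x j)))
        = real n ^ k * (\<Sum>z\<in>{..<n} \<times> {..<n}. miss d (support u \<eta> z))"
      using sum_PiE_pair[of "{..<n}" "{..<k}" i j "\<lambda>z. miss d (support u \<eta> z)"] by (auto simp: off_diag_def)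
  qed
  also have "\<dots> = real (card (off_diag k)) * (real n ^ k * (\<Sum>z\<in>{..<n} \<times> {..<n}. miss d (support u \<eta> z)))"
    by simp
  also have "\<dots> \<le> real k ^ 2 * (real n ^ k * ((b + \<epsilon> / 2) * real n ^ 2))"
    using off_diag(2) le miss_bounds(1)[OF dv]
    by (intro mult_mono mult_left_mono mult_nonneg_nonneg sum_nonneg) auto
  also have "\<dots> = real n ^ 2 * (real k ^ 2 * (real n ^ k * (b + \<epsilon> / 2)))" by (simp add: algebra_simps)
  finally have up: "(\<Sum>x\<in>?X. tot (Lx x)) \<le> real k ^ 2 * (real n ^ k * (b + \<epsilon> / 2))"
    using n_pos by (simp add: mult_le_cancel_left)
  let ?good = "{x \<in> ?X. tot (Lx x) \<le> real k ^ 2 * (b + \<epsilon>)}"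
  have sub: "?good \<subseteq> (\<Union>L\<in>{L \<in> Lx ` ?X. tot L \<le> real k ^ 2 * (b + \<epsilon>)}. {x \<in> ?X. Lx x = L})"
    by auto
  have finL: "finite {L \<in> Lx ` ?X. tot L \<le> real k ^ 2 * (b + \<epsilon>)}" using finX by simp
  have "real (card ?good) \<le> real (\<Sum>L\<in>{L \<in> Lx ` ?X. tot L \<le> real k ^ 2 * (b + \<epsilon>)}. card {x \<in> ?X. Lx x = L})"
    by (intro of_nat_mono order_trans[OF card_mono[OF _ sub] card_UN_le[OF finL]]) (use finL finX in auto)
  also have "\<dots> = (\<Sum>L\<in>{L \<in> Lx ` ?X. tot L \<le> real k ^ 2 * (b + \<epsilon>)}. real (card {x \<in> ?X. Lx x = L}))"
    by simp
  also have "\<dots> \<le> (\<Sum>L\<in>{L \<in> Lx ` ?X. tot L \<le> real k ^ 2 * (b + \<epsilon>)}. \<rho> * real n ^ k)"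
  proof (rule sum_mono)
    fix L assume L: "L \<in> {L \<in> Lx ` ?X. tot L \<le> real k ^ 2 * (b + \<epsilon>)}"
    then obtain y where y: "L = Lx y" by auto
    show "real (card {x \<in> ?X. Lx x = L}) \<le> \<rho> * real n ^ k"
      using few[of L] L unfolding y Lx_iff by auto
  qed
  also have "\<dots> = real (card {L \<in> Lx ` ?X. tot L \<le> real k ^ 2 * (b + \<epsilon>)}) * (\<rho> * real n ^ k)" by simp
  also have "\<dots> \<le> real (card ?LS) * (\<rho> * real n ^ k)"
    using \<epsilon> LxLS finLS by (intro mult_right_mono of_nat_mono card_mono) (auto simp: \<rho>_def)
  also have "\<dots> = \<epsilon> / 8 * real n ^ k" by (simp add: cardLS \<rho>_def)
  finally have good: "real (card ?good) \<le> \<epsilon> / 8 * real n ^ k" .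
  have "real (card (?X - ?good)) * (real k ^ 2 * (b + \<epsilon>)) = (\<Sum>x\<in>?X - ?good. real k ^ 2 * (b + \<epsilon>))" by simp
  also have "\<dots> \<le> (\<Sum>x\<in>?X - ?good. tot (Lx x))"
  proof (rule sum_mono)
    fix x assume "x \<in> ?X - ?good"
    then have "\<not> tot (Lx x) \<le> real k ^ 2 * (b + \<epsilon>)" by blast
    then show "real k ^ 2 * (b + \<epsilon>) \<le> tot (Lx x)" by (simp only: not_le less_imp_le)
  qed
  also have "\<dots> \<le> (\<Sum>x\<in>?X. tot (Lx x))" by (rule sum_mono2[OF finX Diff_subset tot0])
  also note up
  finally have lo: "real (card (?X - ?good)) * (real k ^ 2 * (b + \<epsilon>)) \<le> real k ^ 2 * (real n ^ k * (b + \<epsilon> / 2))" .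
  have gX: "?good \<subseteq> ?X" by blast
  have "card (?X - ?good) = card ?X - card ?good"
    by (rule card_Diff_subset[OF finite_subset[OF gX finX] gX])
  then have "real (card (?X - ?good)) = real (card ?X) - real (card ?good)"
    using card_mono[OF finX gX] by (simp only: of_nat_diff)
  then have "(1 - \<epsilon> / 8) * real n ^ k \<le> real (card (?X - ?good))"
    using good cardX unfolding left_diff_distrib by linarith
  then have "(1 - \<epsilon> / 8) * real n ^ k * (real k ^ 2 * (b + \<epsilon>)) \<le> real (card (?X - ?good)) * (real k ^ 2 * (b + \<epsilon>))"
    by (rule mult_right_mono) (use b \<epsilon> in simp)
  from order_trans[OF this lo]
  have "(real k ^ 2 * real n ^ k) * ((1 - \<epsilon> / 8) * (b + \<epsilon>)) \<le> (real k ^ 2 * real n ^ k) * (b + \<epsilon> / 2)"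
    by (simp only: mult_ac)
  then have "(1 - \<epsilon> / 8) * (b + \<epsilon>) \<le> b + \<epsilon> / 2"
    by (rule mult_left_le_imp_le) (use k n_pos in simp)
  moreover have "\<epsilon> * (b + \<epsilon>) \<le> \<epsilon> * 2" using b \<epsilon> by (intro mult_left_mono) auto
  moreover have "(1 - \<epsilon> / 8) * (b + \<epsilon>) = b + \<epsilon> - \<epsilon> * (b + \<epsilon>) / 8" by (simp add: algebra_simps)
  ultimately show False using \<epsilon> by linarith
qed

end


subsection \<open>Realising the digraphs of a type\<close>

text \<open>The strict lexicographic order on the positions of a k-by-t array: every unordered pair
  of positions occurs exactly once.\<close>

definition blow_up_pairs :: "nat \<Rightarrow> nat \<Rightarrow> ((nat \<times> nat) \<times> (nat \<times> nat)) set" where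
  "blow_up_pairs k t = {((i, a), (j, b)). i < k \<and> j < k \<and> a < t \<and> b < t \<and> (i < j \<or> i = j \<and> a < b)}"

lemma blow_up_pairs_total:
  assumes "x \<in> {..<k} \<times> {..<t}" "y \<in> {..<k} \<times> {..<t}" "x \<noteq> y"
  shows "(x, y) \<in> blow_up_pairs k t \<or> (y, x) \<in> blow_up_pairs k t"
proof -
  obtain i a j b where "x = (i, a)" "y = (j, b)" by (cases x; cases y)
  then show ?thesis
    using assms by (cases i j rule: linorder_cases; cases a b rule: linorder_cases) (auto simp: blow_up_pairs_def)
qed

lemma prod_of_bool:
  "finite S \<Longrightarrow> (\<Prod>a\<in>S. of_bool (Q a)) = (of_bool (\<forall>a\<in>S. Q a) :: real)"
  by (induction S rule: finite_induct) auto

text \<open>Every palette has at least two colours, so a single colour is a legal diagonal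
  label.\<close>

lemma palette_not_singleton: "P \<in> palettes \<Longrightarrow> {c} \<noteq> P"
  by (cases c) (auto simp: palettes_def palette_all_def palette_compl_def palette_orien_def
      palette_undir_def palette_tourn_def)

text \<open>For an undirected colour all pairs in \<open>Y\<close> have colour \<open>c\<close> and
  any numbering will do. For a directed one \<open>Y\<close> is an acyclic tournament and is listed
  along its linear order, or against it if \<open>c = Bwd\<close>.\<close>

lemma fibre_rank:
  assumes H: "is_digraph P H" and Y: "Y \<subseteq> verts H"
    and sym: "\<And>v w. c \<in> {NoArc, Both} \<Longrightarrow> v \<in> Y \<Longrightarrow> w \<in> Y \<Longrightarrow> v \<noteq> w \<Longrightarrow> col H v w = c"
    and dir: "\<And>v w. c \<in> {Fwd, Bwd} \<Longrightarrow> v \<in> Y \<Longrightarrow> w \<in> Y \<Longrightarrow> v \<noteq> w \<Longrightarrow> col H v w \<in> {Fwd, Bwd}"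
    and ac: "c \<in> {Fwd, Bwd} \<Longrightarrow> acyclic {(v, w). v \<in> Y \<and> w \<in> Y \<and> v \<noteq> w \<and> col H v w = Fwd}"
  shows "\<exists>pos. inj_on pos Y \<and> pos ` Y \<subseteq> {..<card Y} \<and> (\<forall>v\<in>Y. \<forall>w\<in>Y. pos v < (pos w :: nat) \<longrightarrow> col H v w = c)"
proof -
  have fin: "finite Y" using H Y by (auto simp: is_digraph_def intro: finite_subset)
  have revY: "col H w v = rev_color (col H v w)" if "v \<in> Y" "w \<in> Y" "v \<noteq> w" for v w
    using digraph_rev[OF H] that Y by blast
  show ?thesis
  proof (cases "c \<in> {NoArc, Both}")
    case True
    obtain pos :: "nat \<Rightarrow> nat" where "bij_betw pos Y {..<card Y}"
      using ex_bij_betw_finite_nat[OF fin] by (auto simp: atLeast0LessThan)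
    then show ?thesis
      using sym[OF True] by (intro exI[of _ pos]) (auto simp: bij_betw_def)
  next
    case False
    then have c: "c \<in> {Fwd, Bwd}" by (cases c) auto
    have "acyclic {(v, w). v \<in> Y \<and> w \<in> Y \<and> (v \<noteq> w \<and> col H v w = c)}"
    proof (cases "c = Fwd")
      case True
      then show ?thesis using ac[OF c] by simp
    next
      case False
      then have "c = Bwd" using c by auto
      have "col H w v = Fwd" if "v \<in> Y" "w \<in> Y" "v \<noteq> w" "col H v w = c" for v w
        using revY[OF that(1-3)] that(4) \<open>c = Bwd\<close> by simp
      then have "{(v, w). v \<in> Y \<and> w \<in> Y \<and> v \<noteq> w \<and> col H v w = c}
          \<subseteq> {(v, w). v \<in> Y \<and> w \<in> Y \<and> v \<noteq> w \<and> col H v w = Fwd}\<inverse>"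
        by auto
      moreover have "acyclic ({(v, w). v \<in> Y \<and> w \<in> Y \<and> v \<noteq> w \<and> col H v w = Fwd}\<inverse>)"
        unfolding acyclic_converse by (rule ac[OF c])
      ultimately show ?thesis by (rule acyclic_subset[rotated])
    qed
    moreover have "(v \<noteq> w \<and> col H v w = c) \<or> (w \<noteq> v \<and> col H w v = c)"
      if "v \<in> Y" "w \<in> Y" "v \<noteq> w" for v w
      using dir[OF c that] revY[OF that] that(3) c by (cases "col H v w") auto
    ultimately obtain pos where "inj_on pos Y" "pos ` Y \<subseteq> {..<card Y}"
      "\<forall>v\<in>Y. \<forall>w\<in>Y. pos v < (pos w :: nat) \<longrightarrow> (v \<noteq> w \<and> col H v w = c)"
      using acyclic_rank[OF fin, of "\<lambda>v w. v \<noteq> w \<and> col H v w = c"] by auto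
    then show ?thesis by blast
  qed
qed

text \<open>When the diagonal label is the single colour \<open>c\<close>, the fibre conditions of
  an embedding leave only \<open>c\<close> up to direction, without directed cycles; this is the
  situation of \<open>fibre_rank\<close>.\<close>

lemma embeds_singleton_fibre:
  assumes H: "is_digraph P H" and u: "u \<in> tverts K" "tcol K u u = {c}"
    and emb: "\<forall>u\<in>tverts K.
        (\<forall>a\<in>{NoArc, Both}. a \<notin> tcol K u u \<longrightarrow>
           (\<forall>(v, w)\<in>fiber_pairs H \<gamma> u. col H v w \<noteq> a)) \<and>
        ({Bwd, Fwd} \<inter> tcol K u u = {} \<longrightarrow>
           (\<forall>(v, w)\<in>fiber_pairs H \<gamma> u. col H v w \<notin> {Bwd, Fwd})) \<and>
        (card ({Bwd, Fwd} \<inter> tcol K u u) = 1 \<longrightarrow>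
           acyclic {(v, w)\<in>fiber_pairs H \<gamma> u. col H v w = Fwd})"
  shows "\<exists>pos. inj_on pos {v \<in> verts H. \<gamma> v = u} \<and> pos ` {v \<in> verts H. \<gamma> v = u} \<subseteq> {..<card (verts H)}
    \<and> (\<forall>v w. v \<in> verts H \<longrightarrow> w \<in> verts H \<longrightarrow> \<gamma> v = u \<longrightarrow> \<gamma> w = u \<longrightarrow> pos v < (pos w :: nat) \<longrightarrow> col H v w = c)"
proof -
  let ?Y = "{v \<in> verts H. \<gamma> v = u}"
  have e: "\<And>a v w. a \<in> {NoArc, Both} \<Longrightarrow> a \<noteq> c \<Longrightarrow> v \<in> ?Y \<Longrightarrow> w \<in> ?Y \<Longrightarrow> v \<noteq> w \<Longrightarrow> col H v w \<noteq> a"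
    "\<And>v w. c \<notin> {Bwd, Fwd} \<Longrightarrow> v \<in> ?Y \<Longrightarrow> w \<in> ?Y \<Longrightarrow> v \<noteq> w \<Longrightarrow> col H v w \<notin> {Bwd, Fwd}"
    "c \<in> {Bwd, Fwd} \<Longrightarrow> acyclic {(v, w)\<in>fiber_pairs H \<gamma> u. col H v w = Fwd}"
    using bspec[OF emb u(1)] u(2) by (auto simp: fiber_pairs_def Int_insert_right)
  have "\<exists>pos. inj_on pos ?Y \<and> pos ` ?Y \<subseteq> {..<card ?Y} \<and> (\<forall>v\<in>?Y. \<forall>w\<in>?Y. pos v < (pos w :: nat) \<longrightarrow> col H v w = c)"
  proof (rule fibre_rank[OF H])
    fix v w assume vw: "v \<in> ?Y" "w \<in> ?Y" "v \<noteq> w"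
    { assume "c \<in> {NoArc, Both}"
      then show "col H v w = c"
        using e(1)[OF _ _ vw] e(2)[OF _ vw] by (cases "col H v w") auto }
    { assume "c \<in> {Fwd, Bwd}"
      then show "col H v w \<in> {Fwd, Bwd}"
        using e(1)[OF _ _ vw] by (cases "col H v w") auto }
  next
    assume "c \<in> {Fwd, Bwd}"
    moreover have "{(v, w)\<in>fiber_pairs H \<gamma> u. col H v w = Fwd}
        = {(v, w). v \<in> ?Y \<and> w \<in> ?Y \<and> v \<noteq> w \<and> col H v w = Fwd}"
      by (auto simp: fiber_pairs_def)
    ultimately show "acyclic {(v, w). v \<in> ?Y \<and> w \<in> ?Y \<and> v \<noteq> w \<and> col H v w = Fwd}"
      using e(3) by auto
  qed auto
  moreover have "card ?Y \<le> card (verts H)"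
    using H by (intro card_mono) (auto simp: is_digraph_def)
  ultimately show ?thesis by fastforce
qed

text \<open>The type carries a frequent support pattern \<open>L\<close> off the diagonal and one
  Ramsey colour on each diagonal entry. A digraph \<open>H\<close> embedded in it is laid out on an
  array of \<open>t\<close> copies of each class: a vertex goes to the copy whose number in the
  Ramsey set is its rank in the fibre. Then each pair has a colour from its support, and
  \<open>all_patterns_realised\<close> yields a copy of \<open>H\<close> in
  \<open>G'\<close>.\<close>

lemma (in sampled_digraph) types_realised:
  assumes P: "P \<in> palettes" and dv: "density_vector P d" and k: "k > 0" and t: "t > 0"
    and ram: "\<And>f :: nat \<Rightarrow> nat \<Rightarrow> color. \<exists>S c. S \<subseteq> {..<t} \<and> card S = m \<and> (\<forall>a\<in>S. \<forall>b\<in>S. a < b \<longrightarrow> f a b = c)"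
    and m: "m \<ge> 2"
    and \<epsilon>: "0 < \<epsilon>" "\<epsilon> \<le> 1" and b: "0 \<le> b" "b \<le> 1"
    and le: "(\<Sum>z\<in>{..<n} \<times> {..<n}. miss d (support u \<eta> z)) \<le> (b + \<epsilon> / 2) * real n ^ 2"
    and st: "stable (k * t) \<tau> u" and \<tau>: "\<tau> \<ge> 0" and \<eta>: "0 < \<eta>" "\<eta> \<le> 1 / 8"
    and \<rho>: "\<rho> = (\<epsilon> / 8 / 16 ^ (k * k)) ^ (t ^ k)"
    and n: "4 * real (card (blow_up_pairs k t)) \<le> \<rho> * real n"
    and small: "real (card (blow_up_pairs k t)) * sqrt \<tau> * 5 ^ card (blow_up_pairs k t) < \<rho> / 2 * \<eta> ^ card (blow_up_pairs k t)"
  shows "\<exists>K\<in>types_on k. is_dir_type P K \<and> f_fun K d \<le> b + \<epsilon> + 1 / real k \<and>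
    (\<forall>H. is_digraph P H \<longrightarrow> card (verts H) \<le> m \<longrightarrow> embeds H K \<longrightarrow>
      (\<exists>W\<subseteq>{..<n}. digraph_iso H (induced_sub G' W)))"
proof -
  let ?V = "{..<n}" and ?I = "{..<k} \<times> {..<t}" and ?E = "blow_up_pairs k t"
  let ?X = "PiE {..<k} (\<lambda>_. ?V)" and ?Y = "PiE ?I (\<lambda>_. ?V)" and ?S = "PiE {..<k} (\<lambda>_. {..<t})"
  define N where "N = real n"
  have N: "N > 0" using n_pos by (simp add: N_def)
  have E: "?E \<subseteq> ?I \<times> ?I" "\<And>x y. (x, y) \<in> ?E \<Longrightarrow> x \<noteq> y \<and> (y, x) \<notin> ?E"
    by (auto simp: blow_up_pairs_def)
  have finE: "finite ?E" by (rule finite_subset[OF E(1)]) auto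
  have finY: "finite ?Y" by (auto intro: finite_PiE)
  have finS: "finite ?S" by (auto intro: finite_PiE)
  have finX: "finite ?X" by (auto intro: finite_PiE)
  have cardI: "card ?I = k * t" by simp
  obtain L where L: "(\<Sum>(i, j)\<in>off_diag k. miss d (L (i, j))) \<le> real k ^ 2 * (b + \<epsilon>)"
    and dL: "\<epsilon> / 8 / 16 ^ (k * k) * N ^ k
       \<le> real (card {x \<in> ?X. \<forall>i<k. \<forall>j<k. support u \<eta> (x i, x j) = L (i, j)})"
    using pattern_density[OF dv k \<epsilon> b le] unfolding N_def by blast
  define A0 where "A0 = {x \<in> ?X. \<forall>i<k. \<forall>j<k. support u \<eta> (x i, x j) = L (i, j)}"
  \<comment> \<open>Arrays all of whose transversals show the pattern;
    \<open>blow_up_density\<close> keeps a fraction \<open>\<rho>\<close> of all arrays.\<close>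
  define A where "A = {v \<in> ?Y. \<forall>a\<in>?S. (\<lambda>i\<in>{..<k}. v (i, a i)) \<in> A0}"
  have cardA: "\<rho> * N ^ (k * t) \<le> real (card A)"
  proof -
    have "(\<Sum>x\<in>?X. of_bool (x \<in> A0) :: real) = real (card A0)"
      using finX by (simp add: A0_def Int_def conj_ac)
    moreover have "(\<Sum>v\<in>?Y. \<Prod>a\<in>?S. of_bool ((\<lambda>i\<in>{..<k}. v (i, a i)) \<in> A0) :: real) = real (card A)"
      unfolding prod_of_bool[OF finS] using finY by (simp add: A_def Int_def)
    ultimately have bu: "(real (card A0) / N ^ k) ^ (t ^ k) \<le> real (card A) / N ^ (k * t)"
      using blow_up_density[of ?V "\<lambda>x. of_bool (x \<in> A0)" k t] n_pos unfolding N_def by auto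
    have "\<epsilon> / 8 / 16 ^ (k * k) \<le> real (card A0) / N ^ k"
      using dL N unfolding A0_def by (simp add: pos_le_divide_eq)
    then have "\<rho> \<le> (real (card A0) / N ^ k) ^ (t ^ k)"
      unfolding \<rho> by (rule power_mono) (use \<epsilon> in simp)
    with bu have "\<rho> \<le> real (card A) / N ^ (k * t)" by (rule order_trans[rotated])
    then show ?thesis using N by (simp add: pos_le_divide_eq)
  qed
  \<comment> \<open>A pair with empty support would have no colour to offer. Such pairs are so rare
    for large \<open>n\<close> that a fraction \<open>\<rho> / 2\<close> of all arrays
    remains.\<close>
  define A1 where "A1 = {v \<in> A. \<forall>e\<in>?E. support u \<eta> (v (fst e), v (snd e)) \<noteq> {}}"
  have cardA1: "\<rho> / 2 * N ^ (k * t) \<le> real (card A1)"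
  proof -
    define B where "B e = {v \<in> ?Y. support u \<eta> (v (fst e), v (snd e)) = {}}" for e :: "(nat \<times> nat) \<times> (nat \<times> nat)"
    have cardB: "N * real (card (B e)) \<le> 2 * N ^ (k * t)" if e: "e \<in> ?E" for e
    proof -
      have ij: "fst e \<in> ?I" "snd e \<in> ?I" "fst e \<noteq> snd e"
        using e E(1) E(2)[of "fst e" "snd e"] by auto
      have "N ^ 2 * (\<Sum>v\<in>?Y. of_bool (support u \<eta> (v (fst e), v (snd e)) = {}))
          = N ^ (k * t) * (\<Sum>z\<in>?V \<times> ?V. of_bool (support u \<eta> z = {}))"
        using sum_PiE_pair[of ?V ?I "fst e" "snd e" "\<lambda>z. of_bool (support u \<eta> z = {})"] ij
        unfolding N_def cardI by simp
      moreover have "(\<Sum>v\<in>?Y. of_bool (support u \<eta> (v (fst e), v (snd e)) = {})) = real (card (B e))"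
        using finY by (simp add: B_def Int_def)
      moreover have "(\<Sum>z\<in>?V \<times> ?V. of_bool (support u \<eta> z = {})) = real (card {z \<in> ?V \<times> ?V. support u \<eta> z = {}})"
        by (simp add: Int_def)
      ultimately have "N ^ 2 * real (card (B e)) \<le> N ^ (k * t) * (2 * N)"
        using card_empty_support[OF \<eta>(2), of u] N unfolding N_def by simp
      then have "N * (N * real (card (B e))) \<le> N * (2 * N ^ (k * t))"
        by (simp add: power2_eq_square mult_ac)
      then show ?thesis by (rule mult_left_le_imp_le[OF _ N])
    qed
    have sub: "A - A1 \<subseteq> (\<Union>e\<in>?E. B e)" by (auto simp: A_def A1_def B_def)
    have "finite (\<Union>e\<in>?E. B e)" using finE finY by (auto simp: B_def)
    then have "card (A - A1) \<le> (\<Sum>e\<in>?E. card (B e))"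
      using card_mono[OF _ sub] card_UN_le[OF finE, of B] by linarith
    then have "N * real (card (A - A1)) \<le> N * real (\<Sum>e\<in>?E. card (B e))"
      using N by (intro mult_left_mono of_nat_mono) auto
    also have "\<dots> = (\<Sum>e\<in>?E. N * real (card (B e)))" by (simp add: sum_distrib_left)
    also have "\<dots> \<le> (\<Sum>e\<in>?E. 2 * N ^ (k * t))" by (rule sum_mono[OF cardB])
    also have "\<dots> = (4 * real (card ?E)) * (N ^ (k * t) / 2)" by simp
    also have "\<dots> \<le> (\<rho> * N) * (N ^ (k * t) / 2)"
      using n N unfolding N_def by (intro mult_right_mono) auto
    also have "\<dots> = N * (\<rho> / 2 * N ^ (k * t))" by simp
    finally have "real (card (A - A1)) \<le> \<rho> / 2 * N ^ (k * t)" by (rule mult_left_le_imp_le[OF _ N])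
    moreover have "real (card (A - A1)) = real (card A) - real (card A1)"
    proof -
      have "finite A" "A1 \<subseteq> A" using finY by (auto simp: A_def A1_def)
      then show ?thesis
        using card_Diff_subset[of A1 A] card_mono[of A A1] finite_subset[of A1 A] by simp
    qed
    ultimately show ?thesis using cardA by simp
  qed
  have "\<exists>v\<in>A1. \<forall>p\<in>PiE ?E (\<lambda>_. UNIV). (\<forall>e\<in>?E. dens u (p e) (v (fst e), v (snd e)) > \<eta>) \<longrightarrow>
    (\<exists>v'\<in>?Y. \<forall>e\<in>?E. arc_colour G' (v' (fst e)) (v' (snd e)) = p e)"
  proof (rule all_patterns_realised[OF st \<tau> _ _ E(1), of A1 "\<rho> / 2"])
    show "A1 \<subseteq> ?Y" by (auto simp: A1_def A_def)
    show "\<rho> / 2 * real (card ?V) ^ card ?I \<le> real (card A1)" using cardA1 by (simp add: N_def)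
    show "x \<noteq> y \<and> (y, x) \<notin> ?E" if "(x, y) \<in> ?E" for x y using E(2)[OF that] .
    show "real (card ?E) * sqrt \<tau> * real (card (UNIV :: color option set)) ^ card ?E < \<rho> / 2 * \<eta> ^ card ?E"
      using small by (simp add: card_UNIV_color_option)
  next
    fix v v' assume v: "v \<in> A1" "v' \<in> ?Y" and prof: "\<And>a. a \<in> ?I \<Longrightarrow> profile u (v a) = profile u (v' a)"
    have supp_eq: "support u \<eta> (v x, v y) = support u \<eta> (v' x, v' y)" if "x \<in> ?I" "y \<in> ?I" for x y
      by (rule support_cong; rule prof; fact)
    have "(\<lambda>i\<in>{..<k}. v' (i, a i)) \<in> A0" if a: "a \<in> ?S" for a
    proof -
      have aI: "(i, a i) \<in> ?I" if "i < k" for i using a that by auto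
      have "(\<lambda>i\<in>{..<k}. v (i, a i)) \<in> A0" using v a by (auto simp: A1_def A_def)
      then have "\<forall>i<k. \<forall>j<k. support u \<eta> (v (i, a i), v (j, a j)) = L (i, j)" by (auto simp: A0_def)
      then have "\<forall>i<k. \<forall>j<k. support u \<eta> (v' (i, a i), v' (j, a j)) = L (i, j)"
        using supp_eq[OF aI aI] by simp
      moreover have "v' (i, a i) < n" if "i < k" for i using PiE_mem[OF v(2) aI[OF that]] by simp
      ultimately show ?thesis by (auto simp: A0_def)
    qed
    moreover have "support u \<eta> (v' (fst e), v' (snd e)) \<noteq> {}" if "e \<in> ?E" for e
    proof -
      have "fst e \<in> ?I" "snd e \<in> ?I" using that E(1) by auto
      from supp_eq[OF this] show ?thesis using v(1) that by (auto simp: A1_def)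
    qed
    ultimately show "v' \<in> A1" using v(2) by (auto simp: A1_def A_def)
  qed (use \<eta> in auto)
  then obtain v where v: "v \<in> A1" and real0: "\<forall>p\<in>PiE ?E (\<lambda>_. UNIV).
      (\<forall>e\<in>?E. dens u (p e) (v (fst e), v (snd e)) > \<eta>) \<longrightarrow>
      (\<exists>v'\<in>?Y. \<forall>e\<in>?E. arc_colour G' (v' (fst e)) (v' (snd e)) = p e)" ..
  have real: "\<exists>v'\<in>?Y. \<forall>e\<in>?E. arc_colour G' (v' (fst e)) (v' (snd e)) = p e"
    if "p \<in> PiE ?E (\<lambda>_. UNIV)" "\<And>e. e \<in> ?E \<Longrightarrow> dens u (p e) (v (fst e), v (snd e)) > \<eta>" for p
    by (rule mp[OF bspec[OF real0 that(1)]], rule ballI, rule that(2))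
  define \<Phi> where "\<Phi> x y = support u \<eta> (v x, v y)" for x y
  have vY: "v \<in> ?Y" using v by (auto simp: A1_def A_def)
  have vn: "v x < n" if "x \<in> ?I" for x using PiE_mem[OF vY that] by simp
  have \<Phi>P: "\<Phi> x y \<subseteq> P" if "x \<in> ?I" "y \<in> ?I" for x y
    unfolding \<Phi>_def using support_subset[OF vn[OF that(1)] vn[OF that(2)]] \<eta> by simp
  have \<Phi>ne: "\<Phi> x y \<noteq> {}" if "(x, y) \<in> ?E" for x y
    using v that unfolding A1_def \<Phi>_def by fastforce
  have \<Phi>flip: "c \<in> \<Phi> y x \<longleftrightarrow> rev_color c \<in> \<Phi> x y" if "x \<in> ?I" "y \<in> ?I" for x y c
    unfolding \<Phi>_def by (rule support_flip[OF vn[OF that(1)] vn[OF that(2)]])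
  have \<Phi>L: "\<Phi> (i, a) (j, b) = L (i, j)" if "i < k" "j < k" "i \<noteq> j" "a < t" "b < t" for i j a b
  proof -
    define g where "g = (\<lambda>l\<in>{..<k}. if l = i then a else b)"
    have "g \<in> ?S" using that by (auto simp: g_def)
    then have "(\<lambda>i\<in>{..<k}. v (i, g i)) \<in> A0" using v by (auto simp: A1_def A_def)
    then have "support u \<eta> ((\<lambda>i\<in>{..<k}. v (i, g i)) i, (\<lambda>i\<in>{..<k}. v (i, g i)) j) = L (i, j)"
      using that(1,2) unfolding A0_def by blast
    then show ?thesis using that by (simp add: g_def \<Phi>_def)
  qed
  \<comment> \<open>Nothing prescribes the support between two copies of one class; an arbitrary
    colour is chosen from it and made uniform by Ramsey's theorem.\<close>
  have "\<exists>S c. S \<subseteq> {..<t} \<and> card S = m \<and> (\<forall>a\<in>S. \<forall>b\<in>S. a < b \<longrightarrow> (SOME c. c \<in> \<Phi> (i, a) (i, b)) = c)" for i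
    by (rule ram)
  then obtain S cc where S: "\<And>i. S i \<subseteq> {..<t}" "\<And>i. card (S i) = m"
    and cc: "\<And>i a b. a \<in> S i \<Longrightarrow> b \<in> S i \<Longrightarrow> a < b \<Longrightarrow> (SOME c. c \<in> \<Phi> (i, a) (i, b)) = cc i"
    by metis
  define en where "en i q = sorted_list_of_set (S i) ! q" for i q
  have finS': "finite (S i)" for i using S(1) by (rule finite_subset) simp
  have enS: "en i q \<in> S i" if "q < m" for i q
    unfolding en_def using that S(2) finS'
    by (metis length_sorted_list_of_set nth_mem set_sorted_list_of_set)
  have en_t: "en i q < t" if "q < m" for i q using enS[OF that] S(1) by blast
  have en_less: "en i q < en i q'" if "q < q'" "q' < m" for i q q'
    unfolding en_def using that S(2)[of i] strict_sorted_list_of_set[of "S i"]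
    by (auto simp: sorted_wrt_iff_nth_less)
  have cc\<Phi>: "cc i \<in> \<Phi> (i, en i q) (i, en i q')" if "i < k" "q < q'" "q' < m" for i q q'
  proof -
    have "((i, en i q), (i, en i q')) \<in> ?E"
      using that en_less[OF that(2,3)] en_t by (auto simp: blow_up_pairs_def)
    from \<Phi>ne[OF this] have "(SOME c. c \<in> \<Phi> (i, en i q) (i, en i q')) \<in> \<Phi> (i, en i q) (i, en i q')"
      by (simp add: some_in_eq)
    then show ?thesis using cc[of "en i q" i "en i q'"] enS en_less that by simp
  qed
  \<comment> \<open>The colour \<open>cc i\<close> is attested only by a pair of copies, hence the
    requirement \<open>m \<ge> 2\<close>.\<close>
  have ccP: "cc i \<in> P" if "i < k" for i
    using cc\<Phi>[OF that, of 0 1] \<Phi>P[of "(i, en i 0)" "(i, en i 1)"] en_t[of 0 i] en_t[of 1 i] m that by auto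
  define lab where "lab = (\<lambda>(i, j)\<in>{..<k} \<times> {..<k}. if i = j then {cc i} else L (i, j))"
  define K where "K = type_on k lab"
  have Kv: "tverts K = {..<k}" by (simp add: K_def type_on_def)
  have Kd: "tcol K i i = {cc i}" if "i < k" for i using that by (simp add: K_def type_on_def lab_def)
  have Ko: "tcol K i j = L (i, j)" if "i < k" "j < k" "i \<noteq> j" for i j
    using that by (simp add: K_def type_on_def lab_def)
  have Lne: "L (i, j) \<noteq> {}" if "i < j" "j < k" for i j
    using \<Phi>ne[of "(i, 0)" "(j, 0)"] \<Phi>L[of i j 0 0] that t by (auto simp: blow_up_pairs_def)
  have Lflip: "c \<in> L (j, i) \<longleftrightarrow> rev_color c \<in> L (i, j)" if "i < k" "j < k" "i \<noteq> j" for i j c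
    using \<Phi>flip[of "(i, 0)" "(j, 0)" c] \<Phi>L[of i j 0 0] \<Phi>L[of j i 0 0] that t by auto
  have Lne': "L (i, j) \<noteq> {}" if "i < k" "j < k" "i \<noteq> j" for i j
  proof (cases "i < j")
    case False
    then have "L (j, i) \<noteq> {}" using Lne that by auto
    then show ?thesis using Lflip[of i j] that by blast
  qed (use Lne that in auto)
  have type: "is_dir_type P K"
    unfolding is_dir_type_def Kv
  proof (intro conjI ballI impI)
    fix x y assume xy: "x \<in> {..<k}" "y \<in> {..<k}"
    show "tcol K x y \<subseteq> P"
      using xy Kd[of x] ccP[of x] Ko[of x y] \<Phi>L[of x y 0 0] \<Phi>P[of "(x, 0)" "(y, 0)"] t by (cases "x = y") auto
    show "tcol K x y \<noteq> {}"
      using xy Kd[of x] Ko[of x y] Lne'[of x y] by (cases "x = y") auto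
    assume "x \<noteq> y"
    then have sym: "c \<in> tcol K y x \<longleftrightarrow> rev_color c \<in> tcol K x y" for c
      using xy Lflip[of x y c] Ko[of x y] Ko[of y x] by simp
    show "a \<in> tcol K x y \<longleftrightarrow> a \<in> tcol K y x" if "a \<in> {NoArc, Both}" for a
      using that sym[of a] by auto
    show "Fwd \<in> tcol K x y \<longleftrightarrow> Bwd \<in> tcol K y x" using sym[of Bwd] by simp
  next
    fix x assume "x \<in> {..<k}"
    then show "tcol K x x \<noteq> P" using Kd[of x] palette_not_singleton[OF P] by simp
  qed (use k in auto)
  have Kty: "K \<in> types_on k"
    unfolding types_on_def K_def by (rule imageI, unfold lab_def restrict_PiE_iff) blast
  have fK: "f_fun K d \<le> b + \<epsilon> + 1 / real k"
    unfolding K_def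
  proof (rule f_fun_type_on_le[OF dv k])
    have "(\<Sum>(i, j)\<in>off_diag k. miss d (lab (i, j))) = (\<Sum>(i, j)\<in>off_diag k. miss d (L (i, j)))"
      by (rule sum.cong) (auto simp: off_diag_def lab_def)
    then show "(\<Sum>(i, j)\<in>off_diag k. miss d (lab (i, j))) \<le> real k ^ 2 * (b + \<epsilon>)" using L by simp
  qed
  have "\<exists>W\<subseteq>?V. digraph_iso H (induced_sub G' W)"
    if H: "is_digraph P H" and Hm: "card (verts H) \<le> m" and emb: "embeds H K" for H
  proof -
    from emb obtain \<gamma> where \<gamma>: "\<gamma> ` verts H \<subseteq> tverts K"
      and \<gamma>o: "\<And>v w. v \<in> verts H \<Longrightarrow> w \<in> verts H \<Longrightarrow> v \<noteq> w \<Longrightarrow> \<gamma> v \<noteq> \<gamma> w \<Longrightarrow> col H v w \<in> tcol K (\<gamma> v) (\<gamma> w)"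
      and \<gamma>d: "\<forall>u\<in>tverts K.
        (\<forall>a\<in>{NoArc, Both}. a \<notin> tcol K u u \<longrightarrow>
           (\<forall>(v, w)\<in>fiber_pairs H \<gamma> u. col H v w \<noteq> a)) \<and>
        ({Bwd, Fwd} \<inter> tcol K u u = {} \<longrightarrow>
           (\<forall>(v, w)\<in>fiber_pairs H \<gamma> u. col H v w \<notin> {Bwd, Fwd})) \<and>
        (card ({Bwd, Fwd} \<inter> tcol K u u) = 1 \<longrightarrow>
           acyclic {(v, w)\<in>fiber_pairs H \<gamma> u. col H v w = Fwd})"
      unfolding embeds_def by blast
    have \<gamma>k: "\<gamma> x < k" if "x \<in> verts H" for x using \<gamma> that Kv by auto
    define good_pos where "good_pos i pos \<longleftrightarrow> inj_on pos {v \<in> verts H. \<gamma> v = i} \<and>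
      pos ` {v \<in> verts H. \<gamma> v = i} \<subseteq> {..<card (verts H)} \<and>
      (\<forall>v w. v \<in> verts H \<longrightarrow> w \<in> verts H \<longrightarrow> \<gamma> v = i \<longrightarrow> \<gamma> w = i \<longrightarrow> pos v < (pos w :: nat) \<longrightarrow> col H v w = cc i)"
      for i pos
    have ex: "\<exists>pos. good_pos i pos" if "i < k" for i
      unfolding good_pos_def by (rule embeds_singleton_fibre[OF H _ _ \<gamma>d]) (use that Kv Kd in auto)
    define pos where "pos i = (SOME pos. good_pos i pos)" for i
    have gp: "good_pos i (pos i)" if "i < k" for i unfolding pos_def by (rule someI_ex[OF ex[OF that]])
    have pos: "inj_on (pos i) {v \<in> verts H. \<gamma> v = i}"
        "pos i ` {v \<in> verts H. \<gamma> v = i} \<subseteq> {..<card (verts H)}" if "i < k" for i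
      using gp[OF that] unfolding good_pos_def by blast+
    have pos3: "col H v w = cc i"
      if "i < k" "v \<in> verts H" "w \<in> verts H" "\<gamma> v = i" "\<gamma> w = i" "pos i v < pos i w" for i v w
      using gp[OF that(1)] that(2-) unfolding good_pos_def by blast
    define q where "q x = pos (\<gamma> x) x" for x
    have qm: "q x < m" if "x \<in> verts H" for x
      using pos(2)[OF \<gamma>k[OF that]] that Hm unfolding q_def by fastforce
    define place where "place x = (\<gamma> x, en (\<gamma> x) (q x))" for x
    have placeI: "place x \<in> ?I" if "x \<in> verts H" for x
      using \<gamma>k[OF that] en_t[OF qm[OF that]] by (simp add: place_def)
    have inj: "inj_on place (verts H)"
    proof (rule inj_onI)
      fix x y assume xy: "x \<in> verts H" "y \<in> verts H" "place x = place y"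
      then have g: "\<gamma> x = \<gamma> y" "en (\<gamma> x) (q x) = en (\<gamma> x) (q y)" by (auto simp: place_def)
      have "q x = q y"
        using en_less[of "q x" "q y" "\<gamma> x"] en_less[of "q y" "q x" "\<gamma> x"] g(2) qm[OF xy(1)] qm[OF xy(2)]
        by (cases "q x" "q y" rule: linorder_cases) auto
      then show "x = y"
        using inj_onD[OF pos(1)[OF \<gamma>k[OF xy(1)]], of x y] xy g(1) unfolding q_def by auto
    qed
    define \<psi> where "\<psi> = inv_into (verts H) place"
    have \<psi>: "\<psi> (place x) = x" if "x \<in> verts H" for x
      unfolding \<psi>_def by (rule inv_into_f_f[OF inj that])
    \<comment> \<open>Pairs of occupied positions take their colour from \<open>H\<close>; the
      others take any colour of their support, so that the whole pattern is admissible.\<close>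
    define p where "p = (\<lambda>e\<in>?E. Some (if fst e \<in> place ` verts H \<and> snd e \<in> place ` verts H
      then col H (\<psi> (fst e)) (\<psi> (snd e)) else (SOME c. c \<in> \<Phi> (fst e) (snd e))))"
    have colE: "col H x y \<in> \<Phi> (place x) (place y)"
      if x: "x \<in> verts H" and y: "y \<in> verts H" and e: "(place x, place y) \<in> ?E" for x y
    proof (cases "\<gamma> x = \<gamma> y")
      case True
      have lt: "en (\<gamma> x) (q x) < en (\<gamma> x) (q y)" using e True by (auto simp: blow_up_pairs_def place_def)
      have "q x < q y"
        using en_less[of "q y" "q x" "\<gamma> x"] lt qm[OF x] by (cases "q x" "q y" rule: linorder_cases) auto
      then have "col H x y = cc (\<gamma> x)"
        using pos3[OF \<gamma>k[OF x] x y refl True[symmetric]] True by (simp add: q_def)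
      then show ?thesis using cc\<Phi>[OF \<gamma>k[OF x] \<open>q x < q y\<close> qm[OF y]] True by (simp add: place_def)
    next
      case False
      then have "x \<noteq> y" by auto
      from \<gamma>o[OF x y this False] show ?thesis
        using Ko[OF \<gamma>k[OF x] \<gamma>k[OF y] False] \<Phi>L[OF \<gamma>k[OF x] \<gamma>k[OF y] False] en_t qm x y
        by (simp add: place_def)
    qed
    have dp: "dens u (p e) (v (fst e), v (snd e)) > \<eta>" if e: "e \<in> ?E" for e
    proof -
      have "(if fst e \<in> place ` verts H \<and> snd e \<in> place ` verts H
          then col H (\<psi> (fst e)) (\<psi> (snd e)) else (SOME c. c \<in> \<Phi> (fst e) (snd e))) \<in> \<Phi> (fst e) (snd e)"
      proof (cases "fst e \<in> place ` verts H \<and> snd e \<in> place ` verts H")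
        case True
        then obtain x y where xy: "x \<in> verts H" "y \<in> verts H" "fst e = place x" "snd e = place y" by auto
        then have "(place x, place y) \<in> ?E" using e by (metis prod.collapse)
        from colE[OF xy(1,2) this] show ?thesis using True xy \<psi> by simp
      next
        case False
        have "\<Phi> (fst e) (snd e) \<noteq> {}" using \<Phi>ne[of "fst e" "snd e"] e by simp
        then show ?thesis unfolding if_not_P[OF False] by (simp add: some_in_eq)
      qed
      then show ?thesis using e by (simp add: p_def \<Phi>_def support_def)
    qed
    have "p \<in> PiE ?E (\<lambda>_. UNIV)" unfolding p_def restrict_PiE_iff by blast
    from real[OF this dp] obtain v' where v': "v' \<in> ?Y"
      and v'0: "\<forall>e\<in>?E. arc_colour G' (v' (fst e)) (v' (snd e)) = p e" ..
    define \<phi> where "\<phi> x = v' (place x)" for x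
    have \<phi>n: "\<phi> x < n" if "x \<in> verts H" for x
      using PiE_mem[OF v' placeI[OF that]] by (simp add: \<phi>_def)
    have fwd: "\<phi> x \<noteq> \<phi> y \<and> col G' (\<phi> x) (\<phi> y) = col H x y"
      if x: "x \<in> verts H" and y: "y \<in> verts H" and e: "(place x, place y) \<in> ?E" for x y
    proof -
      have "arc_colour G' (\<phi> x) (\<phi> y) = Some (col H x y)"
        using bspec[OF v'0 e] x y e \<psi> by (simp add: p_def \<phi>_def)
      then show ?thesis by (auto simp: arc_colour_def split: if_splits)
    qed
    have both: "\<phi> x \<noteq> \<phi> y \<and> col G' (\<phi> x) (\<phi> y) = col H x y"
      if x: "x \<in> verts H" and y: "y \<in> verts H" and ne: "x \<noteq> y" for x y
    proof -
      have "place x \<noteq> place y" using inj x y ne by (auto dest: inj_onD)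
      then consider "(place x, place y) \<in> ?E" | "(place y, place x) \<in> ?E"
        using blow_up_pairs_total[OF placeI[OF x] placeI[OF y]] by blast
      then show ?thesis
      proof cases
        case 1 then show ?thesis using fwd x y by blast
      next
        case 2
        from fwd[OF y x this] have f: "\<phi> y \<noteq> \<phi> x" "col G' (\<phi> y) (\<phi> x) = col H y x" by auto
        have "col G' (\<phi> x) (\<phi> y) = rev_color (col G' (\<phi> y) (\<phi> x))"
          by (rule digraph_rev[OF digraph]) (use \<phi>n x y f verts in auto)
        moreover have "col H x y = rev_color (col H y x)"
          by (rule digraph_rev[OF H y x ne[symmetric]])
        ultimately show ?thesis using f by auto
      qed
    qed
    have "digraph_iso H (induced_sub G' (\<phi> ` verts H))"
      unfolding digraph_iso_def
    proof (intro exI[of _ \<phi>] conjI ballI impI)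
      show "bij_betw \<phi> (verts H) (verts (induced_sub G' (\<phi> ` verts H)))"
        using both \<phi>n by (auto simp: bij_betw_def inj_on_def induced_sub_def verts)
    qed (use both in \<open>auto simp: induced_sub_def\<close>)
    then show ?thesis using \<phi>n by (intro exI[of _ "\<phi> ` verts H"]) auto
  qed
  then show ?thesis using Kty type fK by blast
qed


section \<open>From nearby members of the property to types\<close>

text \<open>The constants are fixed here. In \<open>sum_miss_support_le\<close> the errors from
  \<open>\<eta>\<close> and \<open>\<kappa>\<close> are \<open>\<epsilon> / 8\<close> each and the
  diagonal takes \<open>\<epsilon> / 4\<close>, together \<open>\<epsilon> / 2\<close>. As
  \<open>l\<close> depends on \<open>\<tau>\<close>, and \<open>\<tau>\<close> on
  \<open>\<eta>\<close> and the array, \<open>\<kappa>\<close> comes last.\<close>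

lemma ex_close_type:
  assumes P: "P \<in> palettes" and dv: "density_vector P d" and k: "k > 0" and \<epsilon>: "0 < \<epsilon>" "\<epsilon> \<le> 1"
  shows "\<exists>\<kappa>>0. \<exists>n0. \<forall>n\<ge>n0. \<forall>G G'. is_digraph P G \<longrightarrow> verts G = {..<n} \<longrightarrow> is_digraph P G' \<longrightarrow> verts G' = {..<n} \<longrightarrow>
    quasirandom \<kappa> d n G \<longrightarrow> (\<exists>K\<in>types_on k. is_dir_type P K \<and> f_fun K d \<le> edit_dist G G' + \<epsilon> + 1 / real k \<and>
      (\<forall>H. is_digraph P H \<longrightarrow> card (verts H) \<le> m \<longrightarrow> embeds H K \<longrightarrow>
        (\<exists>W\<subseteq>{..<n}. digraph_iso H (induced_sub G' W))))"
proof -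
  \<comment> \<open>\<open>m + 2\<close> guarantees at least two copies also for small
    \<open>m\<close>.\<close>
  obtain t where ram: "\<And>f :: nat \<Rightarrow> nat \<Rightarrow> color. \<exists>S c. S \<subseteq> {..<t} \<and> card S = m + 2 \<and> (\<forall>a\<in>S. \<forall>b\<in>S. a < b \<longrightarrow> f a b = c)"
    using monochromatic_subset[of "m + 2"] by blast
  have t: "t > 0"
  proof (rule ccontr)
    assume "\<not> t > 0"
    then show False using ram[of "\<lambda>_ _. NoArc"] by auto
  qed
  define e where "e = card (blow_up_pairs k t)"
  define \<rho> where "\<rho> = (\<epsilon> / 8 / 16 ^ (k * k)) ^ (t ^ k)"
  define \<eta> where "\<eta> = \<epsilon> / 32"
  have \<rho>: "\<rho> > 0" using \<epsilon> by (simp add: \<rho>_def)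
  have \<eta>: "0 < \<eta>" "\<eta> \<le> 1 / 8" using \<epsilon> by (auto simp: \<eta>_def)
  \<comment> \<open>The factor \<open>e + 1\<close> in place of \<open>e\<close> makes the
    inequality \<open>small\<close> strict and keeps the denominator positive when
    \<open>e = 0\<close>.\<close>
  define s where "s = \<rho> / 2 * \<eta> ^ e / (real (e + 1) * 5 ^ e)"
  have s: "s > 0" using \<rho> \<eta> by (simp add: s_def)
  define \<tau> where "\<tau> = s ^ 2"
  have \<tau>: "\<tau> > 0" "sqrt \<tau> = s" using s by (auto simp: \<tau>_def)
  have "real e * s * 5 ^ e < real (e + 1) * s * 5 ^ e" using s by (intro mult_strict_right_mono) auto
  also have "\<dots> = \<rho> / 2 * \<eta> ^ e" unfolding s_def by simp
  finally have small: "real e * sqrt \<tau> * 5 ^ e < \<rho> / 2 * \<eta> ^ e" unfolding \<tau>(2) .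
  define l where "l = (k * t) * (nat \<lceil>real (card (UNIV :: color option set)) / \<tau>\<rceil> + 1)"
  define \<kappa> where "\<kappa> = \<epsilon> / (32 * (5 ^ l) ^ 2)"
  have \<kappa>: "\<kappa> > 0" using \<epsilon> by (simp add: \<kappa>_def)
  \<comment> \<open>The first term makes pairs with empty support negligible, the second one the
    diagonal.\<close>
  define n0 where "n0 = nat \<lceil>4 * real e / \<rho>\<rceil> + nat \<lceil>4 / \<epsilon>\<rceil> + 1"
  show ?thesis
  proof (intro exI[of _ \<kappa>] conjI exI[of _ n0] allI impI)
    show "\<kappa> > 0" by fact
    fix n G G'
    assume n: "n0 \<le> n" and G: "is_digraph P G" "verts G = {..<n}" and G': "is_digraph P G'" "verts G' = {..<n}"
      and qr: "quasirandom \<kappa> d n G"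
    have n1: "4 * real e / \<rho> \<le> real n" "4 / \<epsilon> \<le> real n" "n > 0"
      using n unfolding n0_def by linarith+
    interpret sampled_digraph P n G'
      by unfold_locales (use G' n1 in auto)
    obtain u where u: "length u \<le> l" "stable (k * t) \<tau> u"
      using exists_stable[OF \<tau>(1), of "k * t"] unfolding l_def by blast
    let ?b = "edit_dist G G'"
    have S1: "(\<Sum>z\<in>{..<n} \<times> {..<n}. miss d (support u \<eta> z))
      \<le> (?b + 4 * \<eta> + 4 * \<kappa> * (5 ^ l) ^ 2) * real n ^ 2 + real n"
      by (rule sum_miss_support_le[OF G qr dv _ _ u(1)]) (use \<eta> \<kappa> in auto)
    have S2: "4 * \<kappa> * (5 ^ l) ^ 2 = \<epsilon> / 8" by (simp add: \<kappa>_def)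
    note S1[unfolded S2]
    moreover have "real n \<le> \<epsilon> / 4 * real n ^ 2"
      using n1 \<epsilon> by (simp add: power2_eq_square field_simps)
    moreover have "(?b + 4 * \<eta> + \<epsilon> / 8) * real n ^ 2 + \<epsilon> / 4 * real n ^ 2 = (?b + \<epsilon> / 2) * real n ^ 2"
      by (simp add: \<eta>_def algebra_simps)
    ultimately have le: "(\<Sum>z\<in>{..<n} \<times> {..<n}. miss d (support u \<eta> z)) \<le> (?b + \<epsilon> / 2) * real n ^ 2"
      by linarith
    have b: "0 \<le> ?b" "?b \<le> 1" using edit_dist_bounds[of G G'] G by auto
    have nn: "4 * real (card (blow_up_pairs k t)) \<le> \<rho> * real n"
      using n1(1) \<rho> by (simp add: e_def pos_divide_le_eq mult.commute)
    obtain K where "K \<in> types_on k" "is_dir_type P K" "f_fun K d \<le> ?b + \<epsilon> + 1 / real k"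
      and real: "\<forall>H. is_digraph P H \<longrightarrow> card (verts H) \<le> m + 2 \<longrightarrow> embeds H K \<longrightarrow>
        (\<exists>W\<subseteq>{..<n}. digraph_iso H (induced_sub G' W))"
      using types_realised[OF P dv k t ram _ \<epsilon> b le u(2) less_imp_le[OF \<tau>(1)] \<eta> \<rho>_def nn small[unfolded e_def]]
      by auto
    then show "\<exists>K\<in>types_on k. is_dir_type P K \<and> f_fun K d \<le> ?b + \<epsilon> + 1 / real k \<and>
      (\<forall>H. is_digraph P H \<longrightarrow> card (verts H) \<le> m \<longrightarrow> embeds H K \<longrightarrow>
        (\<exists>W\<subseteq>{..<n}. digraph_iso H (induced_sub G' W)))"
      by (intro bexI[of _ K]) auto
  qed
qed

text \<open>Suppose that for every \<open>\<kappa>\<close> there are counterexamples of arbitrarily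
  large order. For every \<open>m\<close> they give a type on \<open>k\<close> vertices with
  \<open>f_fun\<close> below \<open>\<beta>\<close> such that all digraphs of order at most
  \<open>m\<close> embedded in it occur in a member of the property. There are finitely many types
  on \<open>k\<close> vertices, so one of them works for infinitely many \<open>m\<close>. No
  forbidden digraph embeds in that type, whence it lies in the family, against the choice of
  \<open>\<beta>\<close>.\<close>

lemma edit_dist_ge:
  assumes P: "P \<in> palettes" and dv: "density_vector P d" and F: "forbidden_family P \<H> F"
    and \<beta>: "\<And>K. K \<in> type_family P F \<Longrightarrow> \<beta> \<le> f_fun K d" and \<epsilon>: "\<epsilon> > 0"
  shows "\<exists>\<kappa>>0. \<exists>n0. \<forall>n\<ge>n0. \<forall>G G'. is_digraph P G \<longrightarrow> verts G = {..<n} \<longrightarrow> G' \<in> \<H> \<longrightarrow> verts G' = {..<n} \<longrightarrow>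
    quasirandom \<kappa> d n G \<longrightarrow> \<beta> - \<epsilon> \<le> edit_dist G G'"
proof (rule ccontr)
  assume neg: "\<not> ?thesis"
  \<comment> \<open>The error is shared between \<open>\<epsilon>'\<close> and the diagonal term
    \<open>1 / real k\<close>, each at most \<open>\<epsilon> / 2\<close>.\<close>
  define \<epsilon>' where "\<epsilon>' = min 1 (\<epsilon> / 2)"
  have \<epsilon>': "0 < \<epsilon>'" "\<epsilon>' \<le> 1" "\<epsilon>' \<le> \<epsilon> / 2" using \<epsilon> by (auto simp: \<epsilon>'_def)
  define k where "k = nat \<lceil>2 / \<epsilon>\<rceil> + 1"
  have k: "k > 0" "1 / real k \<le> \<epsilon> / 2"
  proof -
    have "2 / \<epsilon> \<le> real k" "real k > 0" unfolding k_def by linarith+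
    then show "1 / real k \<le> \<epsilon> / 2" using \<epsilon> by (simp add: field_simps)
  qed (simp add: k_def)
  define Q where "Q m K \<longleftrightarrow> is_dir_type P K \<and> f_fun K d < \<beta> \<and>
    (\<exists>G'\<in>\<H>. \<forall>H. is_digraph P H \<longrightarrow> card (verts H) \<le> m \<longrightarrow> embeds H K \<longrightarrow>
      (\<exists>W\<subseteq>verts G'. digraph_iso H (induced_sub G' W)))" for m K
  have "\<exists>K\<in>types_on k. Q m K" for m
  proof -
    obtain \<kappa> n0 where \<kappa>: "\<kappa> > 0" and close: "\<And>n G G'. n \<ge> n0 \<Longrightarrow> is_digraph P G \<Longrightarrow> verts G = {..<n} \<Longrightarrow>
      is_digraph P G' \<Longrightarrow> verts G' = {..<n} \<Longrightarrow>
      quasirandom \<kappa> d n G \<Longrightarrow> (\<exists>K\<in>types_on k. is_dir_type P K \<and> f_fun K d \<le> edit_dist G G' + \<epsilon>' + 1 / real k \<and>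
      (\<forall>H. is_digraph P H \<longrightarrow> card (verts H) \<le> m \<longrightarrow> embeds H K \<longrightarrow>
        (\<exists>W\<subseteq>{..<n}. digraph_iso H (induced_sub G' W))))"
      using ex_close_type[OF P dv k(1) \<epsilon>'(1,2), of m] by metis
    have "\<not> (\<forall>n\<ge>n0. \<forall>G G'. is_digraph P G \<longrightarrow> verts G = {..<n} \<longrightarrow> G' \<in> \<H> \<longrightarrow> verts G' = {..<n} \<longrightarrow>
      quasirandom \<kappa> d n G \<longrightarrow> \<beta> - \<epsilon> \<le> edit_dist G G')"
      using neg \<kappa> by blast
    then obtain n G G' where *: "n \<ge> n0" "is_digraph P G" "verts G = {..<n}" "G' \<in> \<H>" "verts G' = {..<n}"
      "quasirandom \<kappa> d n G" "edit_dist G G' < \<beta> - \<epsilon>"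
      by (meson not_le)
    have "is_digraph P G'" using F *(4) unfolding forbidden_family_def by auto
    from close[OF *(1-3) this *(5,6)] obtain K where K: "K \<in> types_on k" "is_dir_type P K"
      "f_fun K d \<le> edit_dist G G' + \<epsilon>' + 1 / real k"
      "\<forall>H. is_digraph P H \<longrightarrow> card (verts H) \<le> m \<longrightarrow> embeds H K \<longrightarrow>
        (\<exists>W\<subseteq>{..<n}. digraph_iso H (induced_sub G' W))" by blast
    have "f_fun K d < \<beta>" using K(3) *(7) \<epsilon>'(3) k(2) by linarith
    then show ?thesis
      unfolding Q_def using K *(4,5) by (intro bexI[of _ K] conjI bexI[of _ G']) simp_all
  qed
  then obtain K where K: "\<And>m. K m \<in> types_on k" "\<And>m. Q m (K m)" by metis
  have "finite (range K)" using K(1) by (intro finite_subset[OF _ finite_types_on[of k]]) auto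
  then obtain m0 where inf: "infinite {m. K m = K m0}"
    using pigeonhole_infinite[of UNIV K] by auto
  have "K m0 \<in> type_family P F"
    unfolding type_family_def
  proof (intro CollectI conjI ballI notI)
    show "is_dir_type P (K m0)" using K(2) by (auto simp: Q_def)
    fix H assume H: "H \<in> F" "embeds H (K m0)"
    obtain m where m: "m \<ge> card (verts H)" "K m = K m0"
      using inf unfolding infinite_nat_iff_unbounded_le by blast
    from K(2)[of m] obtain G' where G': "G' \<in> \<H>" "\<forall>H. is_digraph P H \<longrightarrow> card (verts H) \<le> m \<longrightarrow> embeds H (K m0) \<longrightarrow>
      (\<exists>W\<subseteq>verts G'. digraph_iso H (induced_sub G' W))" unfolding Q_def m(2) by blast
    have "is_digraph P H" using F H(1) by (auto simp: forbidden_family_def)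
    with G'(2) m(1) H(2) have "\<exists>W\<subseteq>verts G'. digraph_iso H (induced_sub G' W)" by blast
    moreover have "G' \<in> Forb P H" using F H(1) G'(1) unfolding forbidden_family_def by blast
    ultimately show False by (auto simp: Forb_def)
  qed
  from \<beta>[OF this] K(2)[of m0] show False by (auto simp: Q_def)
qed


subsection \<open>Distance to a hereditary property\<close>

text \<open>Infinitely many records share a vertex set, since \<open>col\<close> is free outside it;
  the values are nevertheless finitely many, as only the set of differing pairs matters.\<close>

lemma finite_edit_dists:
  assumes "finite (verts G)"
  shows "finite {edit_dist G G' |G'. Q G'}"
proof (rule finite_subset)
  show "{edit_dist G G' |G'. Q G'} \<subseteq> (\<lambda>S. real (card S) / real (card (verts G) choose 2)) ` Pow (Pow (verts G))"
    unfolding edit_dist_def by (auto intro!: imageI)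
qed (use assms in simp)

lemma dist_prop_le:
  assumes "finite (verts G)" "G' \<in> \<H>" "verts G' = verts G"
  shows "dist_prop G \<H> \<le> edit_dist G G'"
  unfolding dist_prop_def by (rule Min_le[OF finite_edit_dists[OF assms(1)]]) (use assms in blast)

text \<open>An induced copy of a forbidden digraph inside \<open>G\<close> would embed in
  \<open>K\<close> by composition of maps, because the fibre conditions, acyclicity included, pass
  to induced subgraphs.\<close>

lemma embeds_in_property:
  assumes K: "K \<in> type_family P F" and F: "forbidden_family P \<H> F"
    and G: "is_digraph P G" "embeds G K"
  shows "G \<in> \<H>"
proof -
  have "G \<in> Forb P H" if H: "H \<in> F" for H
    unfolding Forb_def
  proof (intro CollectI conjI notI)
    show "is_digraph P G" by fact
    assume "\<exists>W\<subseteq>verts G. digraph_iso H (induced_sub G W)"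
    then obtain W f where W: "W \<subseteq> verts G" and f: "bij_betw f (verts H) W"
      and fc: "\<And>v w. v \<in> verts H \<Longrightarrow> w \<in> verts H \<Longrightarrow> v \<noteq> w \<Longrightarrow> col G (f v) (f w) = col H v w"
      unfolding digraph_iso_def induced_sub_def by (auto simp: Int_absorb1)
    have fG: "f v \<in> verts G" if "v \<in> verts H" for v using f W that by (auto simp: bij_betw_def)
    have fne: "f v \<noteq> f w" if "v \<in> verts H" "w \<in> verts H" "v \<noteq> w" for v w
      using f that by (auto simp: bij_betw_def inj_on_def)
    from G(2) obtain \<gamma> where \<gamma>: "\<gamma> ` verts G \<subseteq> tverts K"
      and o1: "\<And>v w. v \<in> verts G \<Longrightarrow> w \<in> verts G \<Longrightarrow> v \<noteq> w \<Longrightarrow> \<gamma> v \<noteq> \<gamma> w \<Longrightarrow> col G v w \<in> tcol K (\<gamma> v) (\<gamma> w)"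
      and d0: "\<forall>u\<in>tverts K.
        (\<forall>a\<in>{NoArc, Both}. a \<notin> tcol K u u \<longrightarrow>
           (\<forall>(v, w)\<in>fiber_pairs G \<gamma> u. col G v w \<noteq> a)) \<and>
        ({Bwd, Fwd} \<inter> tcol K u u = {} \<longrightarrow>
           (\<forall>(v, w)\<in>fiber_pairs G \<gamma> u. col G v w \<notin> {Bwd, Fwd})) \<and>
        (card ({Bwd, Fwd} \<inter> tcol K u u) = 1 \<longrightarrow>
           acyclic {(v, w)\<in>fiber_pairs G \<gamma> u. col G v w = Fwd})"
      unfolding embeds_def by blast
    have d1: "\<forall>(v, w)\<in>fiber_pairs G \<gamma> u. col G v w \<noteq> a"
      if "u \<in> tverts K" "a \<in> {NoArc, Both}" "a \<notin> tcol K u u" for u a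
      using bspec[OF d0 that(1)] that(2,3) by blast
    have d2: "\<forall>(v, w)\<in>fiber_pairs G \<gamma> u. col G v w \<notin> {Bwd, Fwd}"
      if "u \<in> tverts K" "{Bwd, Fwd} \<inter> tcol K u u = {}" for u
      using bspec[OF d0 that(1)] that(2) by blast
    have d3: "acyclic {(v, w)\<in>fiber_pairs G \<gamma> u. col G v w = Fwd}"
      if "u \<in> tverts K" "card ({Bwd, Fwd} \<inter> tcol K u u) = 1" for u
      using bspec[OF d0 that(1)] that(2) by blast
    have fp: "(f v, f w) \<in> fiber_pairs G \<gamma> u \<and> col G (f v) (f w) = col H v w"
      if "(v, w) \<in> fiber_pairs H (\<gamma> \<circ> f) u" for u v w
      using that fG fne fc by (auto simp: fiber_pairs_def)
    have "embeds H K"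
      unfolding embeds_def
    proof (intro exI[of _ "\<gamma> \<circ> f"] conjI ballI impI)
      show "(\<gamma> \<circ> f) ` verts H \<subseteq> tverts K" using \<gamma> fG by auto
      show "col H v w \<in> tcol K ((\<gamma> \<circ> f) v) ((\<gamma> \<circ> f) w)"
        if "v \<in> verts H" "w \<in> verts H" "v \<noteq> w" "(\<gamma> \<circ> f) v \<noteq> (\<gamma> \<circ> f) w" for v w
        using o1[OF fG[OF that(1)] fG[OF that(2)] fne[OF that(1-3)]] that(4) fc[OF that(1-3)] by simp
    next
      fix u a e assume u: "u \<in> tverts K" "a \<in> {NoArc, Both}" "a \<notin> tcol K u u" and e: "e \<in> fiber_pairs H (\<gamma> \<circ> f) u"
      obtain v w where vw: "e = (v, w)" by (cases e)
      have "col H v w \<noteq> a" using d1[OF u] fp[of v w u] e unfolding vw by fastforce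
      then show "case e of (v, w) \<Rightarrow> col H v w \<noteq> a" by (simp add: vw)
    next
      fix u e assume u: "u \<in> tverts K" "{Bwd, Fwd} \<inter> tcol K u u = {}" and e: "e \<in> fiber_pairs H (\<gamma> \<circ> f) u"
      obtain v w where vw: "e = (v, w)" by (cases e)
      have "col H v w \<notin> {Bwd, Fwd}" using d2[OF u] fp[of v w u] e unfolding vw by fastforce
      then show "case e of (v, w) \<Rightarrow> col H v w \<notin> {Bwd, Fwd}" by (simp add: vw)
    next
      fix u assume u: "u \<in> tverts K" "card ({Bwd, Fwd} \<inter> tcol K u u) = 1"
      let ?R = "{(v, w)\<in>fiber_pairs H (\<gamma> \<circ> f) u. col H v w = Fwd}"
      let ?S = "{(v, w)\<in>fiber_pairs G \<gamma> u. col G v w = Fwd}"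
      have "(f v, f w) \<in> ?S\<^sup>+" if "(v, w) \<in> ?R\<^sup>+" for v w
        using that
      proof (induction rule: trancl_induct)
        case (base y)
        then show ?case using fp[of v y u] by (intro r_into_trancl) auto
      next
        case (step y z)
        then have "(f y, f z) \<in> ?S" using fp[of y z u] by auto
        then show ?case by (rule trancl_into_trancl[OF step.IH])
      qed
      then show "acyclic ?R" using d3[OF u] unfolding acyclic_def by blast
    qed
    then show False using K H by (auto simp: type_family_def)
  qed
  then show ?thesis using F G(1) unfolding forbidden_family_def by blast
qed

subsection \<open>Random partitions into the classes of a type\<close>

text \<open>The vertices are sent to \<open>U\<close> independently with law \<open>w\<close>; the
  images of two distinct vertices then have the product law.\<close>

lemma sum_weighted_pair:
  fixes w :: "'u \<Rightarrow> real" and g :: "'u \<Rightarrow> 'u \<Rightarrow> real"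
  assumes "finite V" "finite U" "a \<in> V" "b \<in> V" "a \<noteq> b" and w: "(\<Sum>x\<in>U. w x) = 1"
  shows "(\<Sum>\<gamma>\<in>PiE V (\<lambda>_. U). (\<Prod>v\<in>V. w (\<gamma> v)) * g (\<gamma> a) (\<gamma> b)) = (\<Sum>x\<in>U. \<Sum>y\<in>U. w x * w y * g x y)"
proof -
  let ?V = "V - {a, b}"
  have V: "V = insert a (insert b ?V)" using assms by auto
  have pr: "(\<Prod>v\<in>V. w ((\<gamma>(a := x, b := y)) v)) = w x * w y * (\<Prod>v\<in>?V. w (\<gamma> v))" for \<gamma> x y
  proof -
    have "(\<Prod>v\<in>V. w ((\<gamma>(a := x, b := y)) v)) = (\<Prod>v\<in>insert a (insert b ?V). w ((\<gamma>(a := x, b := y)) v))"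
      using V by simp
    also have "\<dots> = w x * w y * (\<Prod>v\<in>?V. w ((\<gamma>(a := x, b := y)) v))"
      using assms by simp
    also have "(\<Prod>v\<in>?V. w ((\<gamma>(a := x, b := y)) v)) = (\<Prod>v\<in>?V. w (\<gamma> v))"
      by (rule prod.cong) auto
    finally show ?thesis .
  qed
  have "(\<Sum>\<gamma>\<in>PiE V (\<lambda>_. U). (\<Prod>v\<in>V. w (\<gamma> v)) * g (\<gamma> a) (\<gamma> b))
    = (\<Sum>\<gamma>\<in>PiE ?V (\<lambda>_. U). \<Sum>(x, y)\<in>U \<times> U. (\<Prod>v\<in>V. w ((\<gamma>(a := x, b := y)) v)) * g x y)"
    using assms by (subst sum_PiE_two[OF assms(1,3-5)]) (auto intro!: sum.cong)
  also have "\<dots> = (\<Sum>\<gamma>\<in>PiE ?V (\<lambda>_. U). (\<Prod>v\<in>?V. w (\<gamma> v)) * (\<Sum>(x, y)\<in>U \<times> U. w x * w y * g x y))"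
    unfolding pr by (simp add: sum_distrib_left split_def mult_ac)
  also have "\<dots> = (\<Prod>v\<in>?V. \<Sum>x\<in>U. w x) * (\<Sum>(x, y)\<in>U \<times> U. w x * w y * g x y)"
    using assms by (subst prod_sum_PiE) (simp_all add: sum_distrib_right)
  finally show ?thesis by (simp add: w sum.cartesian_product)
qed

text \<open>A class that admits only one direction of arcs keeps the arcs that agree with a fixed linear
  order of the vertices; \<open>s\<close> selects the natural order or its reverse.\<close>

definition allowed :: "dir_type \<Rightarrow> color \<Rightarrow> nat \<Rightarrow> nat \<Rightarrow> color set" where
  "allowed K s x y = (if x = y \<and> card ({Bwd, Fwd} \<inter> tcol K x x) = 1
     then tcol K x x \<inter> {NoArc, Both} \<union> {s} else tcol K x y)"

definition fix_colour :: "dir_type \<Rightarrow> color \<Rightarrow> digraph \<Rightarrow> (nat \<Rightarrow> nat) \<Rightarrow> nat \<Rightarrow> nat \<Rightarrow> color" where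
  "fix_colour K s G \<gamma> v w = (if col G v w \<in> allowed K s (\<gamma> v) (\<gamma> w) then col G v w
     else SOME c. c \<in> allowed K s (\<gamma> v) (\<gamma> w))"

definition retype :: "dir_type \<Rightarrow> color \<Rightarrow> digraph \<Rightarrow> (nat \<Rightarrow> nat) \<Rightarrow> digraph" where
  "retype K s G \<gamma> = \<lparr>verts = verts G, col = (\<lambda>v w. if v < w then fix_colour K s G \<gamma> v w
     else rev_color (fix_colour K s G \<gamma> w v))\<rparr>"

lemma dir_type_flip:
  assumes "is_dir_type P K" "x \<in> tverts K" "y \<in> tverts K" "x \<noteq> y"
  shows "c \<in> tcol K y x \<longleftrightarrow> rev_color c \<in> tcol K x y"
proof -
  have *: "\<forall>x\<in>tverts K. \<forall>y\<in>tverts K. x \<noteq> y \<longrightarrow>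
      (\<forall>a\<in>{NoArc, Both}. a \<in> tcol K x y \<longleftrightarrow> a \<in> tcol K y x) \<and>
      (Fwd \<in> tcol K x y \<longleftrightarrow> Bwd \<in> tcol K y x)" using assms(1) unfolding is_dir_type_def by blast
  note bspec[OF bspec[OF * assms(2)] assms(3), THEN mp, OF assms(4)]
    and bspec[OF bspec[OF * assms(3)] assms(2), THEN mp, OF assms(4)[symmetric]]
  then show ?thesis by (cases c) auto
qed

lemma card_dir_eq_1: "card ({Bwd, Fwd} \<inter> T) = 1 \<longleftrightarrow> (Bwd \<in> T) \<noteq> (Fwd \<in> T)"
proof -
  have "{Bwd, Fwd} \<inter> T = (if Bwd \<in> T then {Bwd} else {}) \<union> (if Fwd \<in> T then {Fwd} else {})" by auto
  then show ?thesis by auto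
qed

lemma allowed_props:
  assumes P: "P \<in> palettes" and K: "is_dir_type P K" and xy: "x \<in> tverts K" "y \<in> tverts K" and s: "s \<in> {Bwd, Fwd}"
  shows "allowed K s x y \<noteq> {}" "allowed K s x y \<subseteq> P"
proof -
  have T: "tcol K x y \<subseteq> P" "tcol K x y \<noteq> {}" using K xy unfolding is_dir_type_def by blast+
  then show "allowed K s x y \<noteq> {}" by (auto simp: allowed_def)
  show "allowed K s x y \<subseteq> P"
  proof (cases "x = y \<and> card ({Bwd, Fwd} \<inter> tcol K x x) = 1")
    case True
    then have "Bwd \<in> P \<or> Fwd \<in> P" using T unfolding card_dir_eq_1 by auto
    then have "s \<in> P" using palettes_rev[OF P, of Bwd] s by auto
    then show ?thesis using True T by (auto simp: allowed_def)
  next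
    case False
    then have "allowed K s x y = tcol K x y" unfolding allowed_def by (rule if_not_P)
    then show ?thesis using T by simp
  qed
qed

lemma fix_colour_allowed:
  assumes "P \<in> palettes" "is_dir_type P K" "\<gamma> v \<in> tverts K" "\<gamma> w \<in> tverts K" "s \<in> {Bwd, Fwd}"
  shows "fix_colour K s G \<gamma> v w \<in> allowed K s (\<gamma> v) (\<gamma> w)"
  using allowed_props(1)[OF assms] by (auto simp: fix_colour_def some_in_eq)

lemma retype_digraph:
  assumes P: "P \<in> palettes" and K: "is_dir_type P K" and \<gamma>: "\<And>v. v \<in> verts G \<Longrightarrow> \<gamma> v \<in> tverts K"
    and s: "s \<in> {Bwd, Fwd}" and G: "finite (verts G)"
  shows "is_digraph P (retype K s G \<gamma>)"
proof (rule is_digraphI)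
  show "finite (verts (retype K s G \<gamma>))" using G by (simp add: retype_def)
  fix v w assume v: "v \<in> verts (retype K s G \<gamma>)" "w \<in> verts (retype K s G \<gamma>)" "v \<noteq> w"
  then have \<gamma>v: "\<gamma> v \<in> tverts K" "\<gamma> w \<in> tverts K" using \<gamma> by (auto simp: retype_def)
  have "fix_colour K s G \<gamma> v w \<in> P" "fix_colour K s G \<gamma> w v \<in> P"
    using fix_colour_allowed[where \<gamma> = \<gamma>, OF P K \<gamma>v s] fix_colour_allowed[where \<gamma> = \<gamma>, OF P K \<gamma>v(2,1) s]
      allowed_props(2)[OF P K \<gamma>v s] allowed_props(2)[OF P K \<gamma>v(2,1) s] by blast+
  then show "col (retype K s G \<gamma>) v w \<in> P" using palettes_rev[OF P] by (simp add: retype_def)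
  show "col (retype K s G \<gamma>) w v = rev_color (col (retype K s G \<gamma>) v w)"
    using v(3) by (auto simp: retype_def)
qed

text \<open>In a one-way class all directed arcs run along the vertex order, or all run against it,
  so they form no cycle. Between classes the colour is corrected for \<open>v < w\<close>, and the
  symmetry of the type settles the reversed pair.\<close>

lemma retype_embeds:
  assumes P: "P \<in> palettes" and K: "is_dir_type P K" and \<gamma>: "\<And>v. v \<in> verts G \<Longrightarrow> \<gamma> v \<in> tverts K"
    and s: "s \<in> {Bwd, Fwd}"
  shows "embeds (retype K s G \<gamma>) K"
proof -
  let ?G = "retype K s G \<gamma>"
  have V: "verts ?G = verts G" by (simp add: retype_def)
  have c: "col ?G v w = (if v < w then fix_colour K s G \<gamma> v w else rev_color (fix_colour K s G \<gamma> w v))" for v w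
    by (simp add: retype_def)
  have fc: "fix_colour K s G \<gamma> v w \<in> allowed K s (\<gamma> v) (\<gamma> w)" if "v \<in> verts G" "w \<in> verts G" for v w
    by (rule fix_colour_allowed[where \<gamma> = \<gamma>, OF P K \<gamma>[OF that(1)] \<gamma>[OF that(2)] s])
  have fib: "v \<in> verts G \<and> w \<in> verts G \<and> v \<noteq> w \<and> \<gamma> v = u \<and> \<gamma> w = u"
    if "(v, w) \<in> fiber_pairs ?G \<gamma> u" for v w u
    using that by (simp add: fiber_pairs_def V)
  have colf: "(v < w \<and> col ?G v w \<in> allowed K s u u) \<or> (w < v \<and> rev_color (col ?G v w) \<in> allowed K s u u)"
    if "(v, w) \<in> fiber_pairs ?G \<gamma> u" for v w u
    using fib[OF that] fc[of v w] fc[of w v] c[of v w] by (cases "v < w") auto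
  show ?thesis
    unfolding embeds_def
  proof (intro exI[of _ \<gamma>] conjI ballI impI)
    show "\<gamma> ` verts ?G \<subseteq> tverts K" using \<gamma> V by auto
    fix v w assume vw: "v \<in> verts ?G" "w \<in> verts ?G" "v \<noteq> w" "\<gamma> v \<noteq> \<gamma> w"
    then have "fix_colour K s G \<gamma> v w \<in> tcol K (\<gamma> v) (\<gamma> w)" "fix_colour K s G \<gamma> w v \<in> tcol K (\<gamma> w) (\<gamma> v)"
      using fc[of v w] fc[of w v] V by (auto simp: allowed_def)
    then show "col ?G v w \<in> tcol K (\<gamma> v) (\<gamma> w)"
      using c[of v w] dir_type_flip[OF K, of "\<gamma> v" "\<gamma> w"] vw \<gamma> V by (cases "v < w") auto
  next
    fix u a e assume u: "u \<in> tverts K" "a \<in> {NoArc, Both}" "a \<notin> tcol K u u" and e: "e \<in> fiber_pairs ?G \<gamma> u"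
    obtain v w where vw: "e = (v, w)" by (cases e)
    have "a \<notin> allowed K s u u" "rev_color a = a" using u s by (auto simp: allowed_def)
    then have "col ?G v w \<noteq> a" using colf[of v w u] e unfolding vw by metis
    then show "case e of (v, w) \<Rightarrow> col ?G v w \<noteq> a" by (simp add: vw)
  next
    fix u e assume u: "u \<in> tverts K" "{Bwd, Fwd} \<inter> tcol K u u = {}" and e: "e \<in> fiber_pairs ?G \<gamma> u"
    obtain v w where vw: "e = (v, w)" by (cases e)
    have "allowed K s u u \<inter> {Bwd, Fwd} = {}" using u(2) by (auto simp: allowed_def)
    then have "col ?G v w \<notin> {Bwd, Fwd}" using colf[of v w u] e unfolding vw by (cases "col ?G v w") auto
    then show "case e of (v, w) \<Rightarrow> col ?G v w \<notin> {Bwd, Fwd}" by (simp add: vw)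
  next
    fix u assume u: "u \<in> tverts K" "card ({Bwd, Fwd} \<inter> tcol K u u) = 1"
    have al: "allowed K s u u \<inter> {Bwd, Fwd} = {s}" using u(2) s by (auto simp: allowed_def)
    let ?R = "{(v, w)\<in>fiber_pairs ?G \<gamma> u. col ?G v w = Fwd}"
    show "acyclic ?R"
    proof (cases "s = Fwd")
      case True
      have "v < w" if "(v, w) \<in> ?R" for v w
        using colf[of v w u] al that True by auto
      then show ?thesis by (intro acyclicI_order[of _ "\<lambda>x. - int x"]) auto
    next
      case False
      then have "s = Bwd" using s by auto
      then have "w < v" if "(v, w) \<in> ?R" for v w
        using colf[of v w u] al that by auto
      then show ?thesis by (intro acyclicI_order[of _ "\<lambda>x. x"]) auto
    qed
  qed
qed

section \<open>Colour densities of a digraph and the upper bound\<close>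

definition arc_count :: "digraph \<Rightarrow> color \<Rightarrow> nat" where
  "arc_count G c = card {(v, w). v \<in> verts G \<and> w \<in> verts G \<and> v < w \<and> col G v w = c}"

text \<open>A density vector gives \<open>Fwd\<close> and \<open>Bwd\<close> equal shares, so their
  counts are averaged; the upper bound on the distance depends only on their sum.\<close>

definition arc_density :: "digraph \<Rightarrow> real \<times> real" where
  "arc_density G = (real (arc_count G Both) / real (card (verts G) choose 2),
     (real (arc_count G Fwd) + real (arc_count G Bwd)) / (2 * real (card (verts G) choose 2)))"

text \<open>Symmetrised under reversal, as \<open>c\<close> and \<open>rev_color c\<close> have the
  same probability. This makes the loss a sum over colours that treats \<open>Fwd\<close> and
  \<open>Bwd\<close> alike.\<close>

definition miss_colour :: "color set \<Rightarrow> color \<Rightarrow> real" where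
  "miss_colour T c = (of_bool (c \<notin> T) + of_bool (rev_color c \<notin> T)) / 2"

lemma miss_eq: "miss d T = (\<Sum>c\<in>UNIV. color_prob d c * miss_colour T c)"
proof -
  obtain p q where d: "d = (p, q)" by (cases d)
  have "(\<Sum>c\<in>T. color_prob d c) = (\<Sum>c\<in>UNIV. if c \<in> T then color_prob d c else 0)"
    by (simp add: sum.If_cases)
  then show ?thesis
    unfolding miss_def d UNIV_color by (simp add: miss_colour_def field_simps)
qed

lemma sum_arc_count:
  assumes "finite (verts G)"
  shows "(\<Sum>c\<in>UNIV. real (arc_count G c) * g c) = (\<Sum>(v, w)\<in>{(v, w). v \<in> verts G \<and> w \<in> verts G \<and> v < w}. g (col G v w))"
    and "card {(v, w). v \<in> verts G \<and> w \<in> verts G \<and> v < w} = card (verts G) choose 2"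
proof -
  let ?E = "{(v, w). v \<in> verts G \<and> w \<in> verts G \<and> v < w}"
  have fin: "finite ?E" using assms by (auto intro: finite_subset[of _ "verts G \<times> verts G"])
  have "(\<Sum>(v, w)\<in>?E. g (col G v w)) = (\<Sum>c\<in>UNIV. \<Sum>e\<in>{e \<in> ?E. col G (fst e) (snd e) = c}. g (col G (fst e) (snd e)))"
    by (subst sum.group[OF fin]) (simp_all add: split_def)
  also have "\<dots> = (\<Sum>c\<in>UNIV. real (arc_count G c) * g c)"
  proof (rule sum.cong[OF refl])
    fix c
    have eq: "{e \<in> ?E. col G (fst e) (snd e) = c} = {(v, w). v \<in> verts G \<and> w \<in> verts G \<and> v < w \<and> col G v w = c}" by auto
    have "(\<Sum>e\<in>{e \<in> ?E. col G (fst e) (snd e) = c}. g (col G (fst e) (snd e))) = (\<Sum>e\<in>{e \<in> ?E. col G (fst e) (snd e) = c}. g c)"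
      by (rule sum.cong) auto
    then show "(\<Sum>e\<in>{e \<in> ?E. col G (fst e) (snd e) = c}. g (col G (fst e) (snd e))) = real (arc_count G c) * g c"
      unfolding eq by (simp add: arc_count_def)
  qed
  finally show "(\<Sum>c\<in>UNIV. real (arc_count G c) * g c) = (\<Sum>(v, w)\<in>?E. g (col G v w))" by simp
  have "card ?E = card {{v, w} |v w. v \<in> verts G \<and> w \<in> verts G \<and> v \<noteq> w}"
    using card_ordered_pairs(1)[OF assms, of "\<lambda>_ _. True"] by simp
  also have "{{v, w} |v w. v \<in> verts G \<and> w \<in> verts G \<and> v \<noteq> w} = {S. S \<subseteq> verts G \<and> card S = 2}"
    by (auto simp: card_2_iff)
  finally show "card ?E = card (verts G) choose 2" by (simp add: n_subsets[OF assms])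
qed

lemma sum_arc_count_UNIV:
  assumes "finite (verts G)"
  shows "(\<Sum>c\<in>UNIV. real (arc_count G c)) = real (card (verts G) choose 2)"
  using sum_arc_count(1)[OF assms, of "\<lambda>_. 1"] sum_arc_count(2)[OF assms] by (simp add: split_def)

lemma color_prob_arc_density:
  assumes "finite (verts G)" "card (verts G) \<ge> 2"
  shows "color_prob (arc_density G) c
    = (real (arc_count G c) + real (arc_count G (rev_color c))) / (2 * real (card (verts G) choose 2))"
proof -
  define N where "N = real (card (verts G) choose 2)"
  have N: "N > 0" using assms(2) by (simp add: N_def zero_less_binomial)
  have s: "real (arc_count G NoArc) + real (arc_count G Both) + real (arc_count G Bwd) + real (arc_count G Fwd) = N"
    using sum_arc_count_UNIV[OF assms(1)] unfolding N_def UNIV_color by simp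
  show ?thesis
    unfolding arc_density_def N_def[symmetric]
    by (cases c) (use N s in \<open>auto simp: field_simps\<close>)
qed

lemma density_vector_arc_density:
  assumes P: "P \<in> palettes" and G: "is_digraph P G" and n: "card (verts G) \<ge> 2"
  shows "density_vector P (arc_density G)"
proof -
  have fin: "finite (verts G)" using G by (simp add: is_digraph_def)
  have N: "real (card (verts G) choose 2) > 0" using n by (simp add: zero_less_binomial)
  have zero: "arc_count G c = 0" if "c \<notin> P" for c
  proof -
    have "{(v, w). v \<in> verts G \<and> w \<in> verts G \<and> v < w \<and> col G v w = c} = {}"
      using G that unfolding is_digraph_def by fastforce
    then show ?thesis unfolding arc_count_def by (rule ssubst) simp
  qed
  have z: "color_prob (arc_density G) c = 0" if "c \<notin> P" for c
    using zero[OF that] zero[of "rev_color c"] palettes_rev[OF P, of c] that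
    by (simp add: color_prob_arc_density[OF fin n])
  have nn: "0 \<le> color_prob (arc_density G) c" for c
    by (simp add: color_prob_arc_density[OF fin n])
  obtain p q where d: "arc_density G = (p, q)" by (cases "arc_density G")
  show ?thesis
    unfolding density_vector_def d
    using z[of NoArc] z[of Both] z[of Fwd] nn[of NoArc] nn[of Both] nn[of Fwd]
    by (auto simp: d palette_compl_def palette_orien_def palette_undir_def palette_tourn_def)
qed

text \<open>Depending on \<open>s\<close>, a one-way class gives up either the \<open>Fwd\<close> or
  the \<open>Bwd\<close> arcs; over both choices this averages to half of the directed arcs, exactly
  what its matrix entry charges. For distinct classes the terms of \<open>(x, y)\<close> and
  \<open>(y, x)\<close> are combined; two values of \<open>s\<close> and two orders give the factor
  4 in \<open>pt\<close>.\<close>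

lemma sum_allowed:
  assumes K: "is_dir_type P K"
  shows "(\<Sum>s\<in>{Bwd, Fwd}. \<Sum>x\<in>tverts K. \<Sum>y\<in>tverts K. w x * w y * of_bool (c \<notin> allowed K s x y))
    = 2 * (\<Sum>x\<in>tverts K. \<Sum>y\<in>tverts K. w x * w y * miss_colour (tcol K x y) c)"
proof -
  let ?U = "tverts K"
  define a where "a x y = (\<Sum>s\<in>{Bwd, Fwd}. of_bool (c \<notin> allowed K s x y) :: real)" for x y
  have pt: "a x y + a y x = 4 * miss_colour (tcol K x y) c" if "x \<in> ?U" "y \<in> ?U" for x y
  proof (cases "x = y")
    case True
    then show ?thesis
      unfolding a_def miss_colour_def allowed_def card_dir_eq_1 by (cases c) auto
  next
    case False
    have "c \<in> tcol K y x \<longleftrightarrow> rev_color c \<in> tcol K x y"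
      "rev_color c \<in> tcol K y x \<longleftrightarrow> c \<in> tcol K x y"
      using dir_type_flip[OF K that False, of c] dir_type_flip[OF K that False, of "rev_color c"] by simp_all
    then show ?thesis
      using False unfolding a_def miss_colour_def allowed_def by (cases c) auto
  qed
  have "(\<Sum>s\<in>{Bwd, Fwd}. \<Sum>x\<in>?U. \<Sum>y\<in>?U. w x * w y * of_bool (c \<notin> allowed K s x y))
      = (\<Sum>x\<in>?U. \<Sum>y\<in>?U. w x * w y * a x y)"
    unfolding a_def by (simp add: sum.distrib[symmetric] algebra_simps del: sum_of_bool_eq)
  moreover have "2 * (\<Sum>x\<in>?U. \<Sum>y\<in>?U. w x * w y * a x y)
      = (\<Sum>x\<in>?U. \<Sum>y\<in>?U. w x * w y * a x y) + (\<Sum>x\<in>?U. \<Sum>y\<in>?U. w y * w x * a y x)"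
    by (subst (3) sum.swap) simp
  moreover have "\<dots> = (\<Sum>x\<in>?U. \<Sum>y\<in>?U. w x * w y * (a x y + a y x))"
    by (simp add: sum.distrib[symmetric] algebra_simps)
  moreover have "\<dots> = 4 * (\<Sum>x\<in>?U. \<Sum>y\<in>?U. w x * w y * miss_colour (tcol K x y) c)"
    unfolding sum_distrib_left by (intro sum.cong refl) (simp add: pt)
  ultimately show ?thesis by simp
qed

lemma edit_dist_retype_le:
  assumes "finite (verts G)"
    and rev: "\<And>v w. v \<in> verts G \<Longrightarrow> w \<in> verts G \<Longrightarrow> v \<noteq> w \<Longrightarrow> col G w v = rev_color (col G v w)"
  shows "edit_dist G (retype K s G \<gamma>) * real (card (verts G) choose 2)
    \<le> (\<Sum>(v, w)\<in>{(v, w). v \<in> verts G \<and> w \<in> verts G \<and> v < w}. of_bool (col G v w \<notin> allowed K s (\<gamma> v) (\<gamma> w)))"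
proof -
  let ?V = "verts G" and ?G = "retype K s G \<gamma>"
  let ?E = "{(v, w). v \<in> ?V \<and> w \<in> ?V \<and> v < w}"
  let ?B = "{(v, w). v \<in> ?V \<and> w \<in> ?V \<and> v < w \<and> col G v w \<noteq> col ?G v w}"
  have fin: "finite ?E" using assms(1) by (auto intro: finite_subset[of _ "?V \<times> ?V"])
  have sym: "w \<noteq> v \<and> col G w v \<noteq> col ?G w v"
    if "v \<in> ?V" "w \<in> ?V" "v \<noteq> w \<and> col G v w \<noteq> col ?G v w" for v w
  proof -
    have "col ?G w v = rev_color (col ?G v w)" using that by (auto simp: retype_def)
    then show ?thesis using that rev[of v w] by (metis rev_color_rev_color)
  qed
  have "card {{v, w} |v w. v \<in> ?V \<and> w \<in> ?V \<and> v \<noteq> w \<and> (v \<noteq> w \<and> col G v w \<noteq> col ?G v w)}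
    = card {(v, w). v \<in> ?V \<and> w \<in> ?V \<and> v < w \<and> (v \<noteq> w \<and> col G v w \<noteq> col ?G v w)}"
    by (rule card_ordered_pairs(1)[OF assms(1) sym])
  also have "{(v, w). v \<in> ?V \<and> w \<in> ?V \<and> v < w \<and> (v \<noteq> w \<and> col G v w \<noteq> col ?G v w)} = ?B" by auto
  finally have c: "card {{v, w} |v w. v \<in> ?V \<and> w \<in> ?V \<and> v \<noteq> w \<and> col G v w \<noteq> col ?G v w} = card ?B" by simp
  have "edit_dist G ?G * real (card ?V choose 2) \<le> real (card ?B)"
    unfolding edit_dist_def c by (cases "card ?V choose 2 = 0") (simp_all del: binomial_eq_0_iff)
  also have "\<dots> \<le> real (card {e \<in> ?E. col G (fst e) (snd e) \<notin> allowed K s (\<gamma> (fst e)) (\<gamma> (snd e))})"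
    using fin by (intro of_nat_mono card_mono) (auto simp: retype_def fix_colour_def split: if_splits)
  also have "\<dots> = (\<Sum>e\<in>?E. of_bool (col G (fst e) (snd e) \<notin> allowed K s (\<gamma> (fst e)) (\<gamma> (snd e))))"
    using fin by (simp add: Int_def)
  finally show ?thesis by (simp add: split_def)
qed

text \<open>Send the vertices to the type independently with law \<open>w\<close> and apply
  \<open>retype\<close> for either \<open>s\<close>. The result always lies in the property, so the
  distance is at most the mean number of recoloured pairs, and this mean is the quadratic form at
  the densities of \<open>G\<close>.\<close>

lemma dist_prop_le_type_form:
  assumes P: "P \<in> palettes" and F: "forbidden_family P \<H> F" and K: "K \<in> type_family P F"
    and w: "w \<in> weightings K" and G: "is_digraph P G" and n: "card (verts G) \<ge> 2"
  shows "dist_prop G \<H> \<le> type_form K (arc_density G) w"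
proof -
  let ?V = "verts G" and ?U = "tverts K"
  let ?E = "{(v, w). v \<in> ?V \<and> w \<in> ?V \<and> v < w}" and ?\<Gamma> = "PiE ?V (\<lambda>_. ?U)"
  define N where "N = real (card ?V choose 2)"
  have N: "N > 0" using n by (simp add: N_def zero_less_binomial)
  have fin: "finite ?V" using G by (simp add: is_digraph_def)
  have K': "is_dir_type P K" using K by (simp add: type_family_def)
  then have finU: "finite ?U" by (simp add: is_dir_type_def)
  have w1: "(\<Sum>x\<in>?U. w x) = 1" "\<And>x. x \<in> ?U \<Longrightarrow> 0 \<le> w x" using w by (auto simp: weightings_def)
  define wt where "wt \<gamma> = (\<Prod>v\<in>?V. w (\<gamma> v))" for \<gamma>
  have wt0: "0 \<le> wt \<gamma>" if "\<gamma> \<in> ?\<Gamma>" for \<gamma>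
    unfolding wt_def using that by (intro prod_nonneg w1(2)) auto
  have wt1: "(\<Sum>\<gamma>\<in>?\<Gamma>. wt \<gamma>) = 1"
    using prod_sum_PiE[of ?V "\<lambda>_. ?U" "\<lambda>_. w"] fin finU w1(1) by (simp add: wt_def)
  define bad where "bad s \<gamma> v u = (of_bool (col G v u \<notin> allowed K s (\<gamma> v) (\<gamma> u)) :: real)" for s \<gamma> v u
  have main: "dist_prop G \<H> * N \<le> (\<Sum>(v, u)\<in>?E. bad s \<gamma> v u)" if s: "s \<in> {Bwd, Fwd}" and \<gamma>: "\<gamma> \<in> ?\<Gamma>" for s \<gamma>
  proof -
    have \<gamma>': "\<gamma> v \<in> ?U" if "v \<in> ?V" for v using \<gamma> that by auto
    have "retype K s G \<gamma> \<in> \<H>"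
      by (rule embeds_in_property[OF K F retype_digraph[OF P K' \<gamma>' s fin] retype_embeds[OF P K' \<gamma>' s]])
    then have "dist_prop G \<H> \<le> edit_dist G (retype K s G \<gamma>)"
      by (rule dist_prop_le[OF fin]) (simp add: retype_def)
    then have "dist_prop G \<H> * N \<le> edit_dist G (retype K s G \<gamma>) * N" using N by (intro mult_right_mono) auto
    also have "\<dots> \<le> (\<Sum>(v, u)\<in>?E. bad s \<gamma> v u)"
      unfolding N_def bad_def by (rule edit_dist_retype_le[OF fin digraph_rev[OF G]])
    finally show ?thesis .
  qed
  have "2 * (dist_prop G \<H> * N) = (\<Sum>s\<in>{Bwd, Fwd}. \<Sum>\<gamma>\<in>?\<Gamma>. wt \<gamma> * (dist_prop G \<H> * N))"
    by (simp add: sum_distrib_right[symmetric] wt1)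
  also have "\<dots> \<le> (\<Sum>s\<in>{Bwd, Fwd}. \<Sum>\<gamma>\<in>?\<Gamma>. wt \<gamma> * (\<Sum>(v, u)\<in>?E. bad s \<gamma> v u))"
    by (intro sum_mono mult_left_mono main wt0)
  also have "\<dots> = (\<Sum>s\<in>{Bwd, Fwd}. \<Sum>e\<in>?E. \<Sum>\<gamma>\<in>?\<Gamma>. wt \<gamma> * bad s \<gamma> (fst e) (snd e))"
    unfolding split_def sum_distrib_left by (intro sum.cong refl sum.swap)
  also have "\<dots> = (\<Sum>s\<in>{Bwd, Fwd}. \<Sum>e\<in>?E. \<Sum>x\<in>?U. \<Sum>y\<in>?U. w x * w y * of_bool (col G (fst e) (snd e) \<notin> allowed K s x y))"
  proof (intro sum.cong refl)
    fix s e assume "e \<in> ?E"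
    then have "fst e \<in> ?V" "snd e \<in> ?V" "fst e \<noteq> snd e" by auto
    from sum_weighted_pair[OF fin finU this w1(1), of "\<lambda>x y. of_bool (col G (fst e) (snd e) \<notin> allowed K s x y)"]
    show "(\<Sum>\<gamma>\<in>?\<Gamma>. wt \<gamma> * bad s \<gamma> (fst e) (snd e))
       = (\<Sum>x\<in>?U. \<Sum>y\<in>?U. w x * w y * of_bool (col G (fst e) (snd e) \<notin> allowed K s x y))"
      unfolding wt_def bad_def .
  qed
  also have "\<dots> = (\<Sum>e\<in>?E. \<Sum>s\<in>{Bwd, Fwd}. \<Sum>x\<in>?U. \<Sum>y\<in>?U. w x * w y * of_bool (col G (fst e) (snd e) \<notin> allowed K s x y))"
    by (rule sum.swap)
  also have "\<dots> = (\<Sum>e\<in>?E. 2 * (\<Sum>x\<in>?U. \<Sum>y\<in>?U. w x * w y * miss_colour (tcol K x y) (col G (fst e) (snd e))))"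
    unfolding sum_allowed[OF K'] ..
  also have "\<dots> = 2 * (\<Sum>c\<in>UNIV. real (arc_count G c) * (\<Sum>x\<in>?U. \<Sum>y\<in>?U. w x * w y * miss_colour (tcol K x y) c))"
    unfolding sum_arc_count(1)[OF fin] by (simp add: sum_distrib_left split_def)
  finally have up: "dist_prop G \<H> * N \<le> (\<Sum>c\<in>UNIV. real (arc_count G c) * (\<Sum>x\<in>?U. \<Sum>y\<in>?U. w x * w y * miss_colour (tcol K x y) c))"
    by simp
  define m where "m c = (\<Sum>x\<in>?U. \<Sum>y\<in>?U. w x * w y * miss_colour (tcol K x y) c)" for c
  \<comment> \<open>Invariance under reversal allows the separate counts of \<open>Fwd\<close> and
    \<open>Bwd\<close> to be replaced by the average used in \<open>arc_density\<close>.\<close>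
  have mrev: "m (rev_color c) = m c" for c unfolding m_def miss_colour_def by (simp add: add.commute)
  have "type_form K (arc_density G) w = (\<Sum>x\<in>?U. \<Sum>y\<in>?U. \<Sum>c\<in>UNIV. color_prob (arc_density G) c * (w x * w y * miss_colour (tcol K x y) c))"
    unfolding type_form_def type_matrix_eq_miss miss_eq
    by (simp add: sum_distrib_left sum_distrib_right mult_ac)
  also have "\<dots> = (\<Sum>x\<in>?U. \<Sum>c\<in>UNIV. \<Sum>y\<in>?U. color_prob (arc_density G) c * (w x * w y * miss_colour (tcol K x y) c))"
    by (intro sum.cong refl sum.swap)
  also have "\<dots> = (\<Sum>c\<in>UNIV. \<Sum>x\<in>?U. \<Sum>y\<in>?U. color_prob (arc_density G) c * (w x * w y * miss_colour (tcol K x y) c))"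
    by (rule sum.swap)
  also have "\<dots> = (\<Sum>c\<in>UNIV. color_prob (arc_density G) c * m c)"
    by (simp add: m_def sum_distrib_left)
  also have "\<dots> = (\<Sum>c\<in>UNIV. real (arc_count G c) * m c) / N"
    using mrev[of Fwd] mrev[of Bwd] unfolding color_prob_arc_density[OF fin n] N_def[symmetric] UNIV_color
    using N by (simp add: field_simps)
  finally have "type_form K (arc_density G) w * N = (\<Sum>c\<in>UNIV. real (arc_count G c) * m c)" using N by simp
  then have "dist_prop G \<H> * N \<le> type_form K (arc_density G) w * N" using up unfolding m_def by simp
  then show ?thesis by (rule mult_right_le_imp_le[OF _ N])
qed


subsection \<open>Random digraphs are quasirandom\<close>

definition up_pairs :: "nat \<Rightarrow> (nat \<times> nat) set" where
  "up_pairs n = {(i, j). i < j \<and> j < n}"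

lemma finite_up_pairs [simp]: "finite (up_pairs n)"
  by (rule finite_subset[of _ "{..<n} \<times> {..<n}"]) (auto simp: up_pairs_def)

lemma card_up_pairs: "card (up_pairs n) = n choose 2"
proof -
  have "up_pairs n = {(v, w). v \<in> verts \<lparr>verts = {..<n}, col = \<lambda>_ _. NoArc\<rparr> \<and> w \<in> verts \<lparr>verts = {..<n}, col = \<lambda>_ _. NoArc\<rparr> \<and> v < w}"
    by (auto simp: up_pairs_def)
  then show ?thesis using sum_arc_count(2)[of "\<lparr>verts = {..<n}, col = \<lambda>_ _. NoArc\<rparr>"] by simp
qed

definition mk_digraph :: "nat \<Rightarrow> (nat \<times> nat \<Rightarrow> color) \<Rightarrow> digraph" where
  "mk_digraph n \<omega> = \<lparr>verts = {..<n}, col = (\<lambda>i j. if i < j then \<omega> (i, j) else rev_color (\<omega> (j, i)))\<rparr>"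

lemma random_digraph_eq:
  "random_digraph n d = map_pmf (mk_digraph n) (Pi_pmf (up_pairs n) NoArc (\<lambda>_. color_pmf d))"
  unfolding random_digraph_def mk_digraph_def up_pairs_def ..

lemma set_pmf_random_digraph:
  assumes P: "P \<in> palettes" and dv: "density_vector P d" and G: "G \<in> set_pmf (random_digraph n d)"
  shows "is_digraph P G" "verts G = {..<n}"
proof -
  have cP: "c \<in> P" if "c \<in> set_pmf (color_pmf d)" for c
  proof (rule ccontr)
    assume "c \<notin> P"
    then have "color_prob d c = 0" by (rule color_prob_outside[OF P dv])
    then show False using that by (simp add: set_pmf_iff pmf_color_pmf[OF dv])
  qed
  from G obtain \<omega> where \<omega>: "\<omega> \<in> set_pmf (Pi_pmf (up_pairs n) NoArc (\<lambda>_. color_pmf d))" "G = mk_digraph n \<omega>"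
    by (auto simp: random_digraph_eq)
  have \<omega>P: "\<omega> (i, j) \<in> P" if "i < j" "j < n" for i j
  proof -
    have "\<omega> \<in> PiE_dflt (up_pairs n) NoArc (set_pmf \<circ> (\<lambda>_. color_pmf d))"
      using \<omega>(1) by (simp add: set_Pi_pmf)
    moreover have "(i, j) \<in> up_pairs n" using that by (simp add: up_pairs_def)
    ultimately have "\<omega> (i, j) \<in> set_pmf (color_pmf d)" by (auto simp: PiE_dflt_def)
    then show ?thesis by (rule cP)
  qed
  show "verts G = {..<n}" by (simp add: \<omega> mk_digraph_def)
  show "is_digraph P G"
  proof (rule is_digraphI)
    fix v w assume "v \<in> verts G" "w \<in> verts G" "v \<noteq> w"
    then have vw: "v < n" "w < n" "v \<noteq> w" by (auto simp: \<omega> mk_digraph_def)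
    show "col G v w \<in> P"
      using vw \<omega>P[of v w] \<omega>P[of w v] palettes_rev[OF P] by (auto simp: \<omega> mk_digraph_def)
    show "col G w v = rev_color (col G v w)"
      using vw by (auto simp: \<omega> mk_digraph_def)
  qed (simp add: \<omega> mk_digraph_def)
qed

lemma finite_set_pmf_random_digraph: "finite (set_pmf (random_digraph n d))"
proof -
  have "finite (PiE_dflt (up_pairs n) NoArc (set_pmf \<circ> (\<lambda>_. color_pmf d)))"
    by (intro finite_PiE_dflt) auto
  then show ?thesis unfolding random_digraph_eq by (simp add: set_Pi_pmf)
qed

lemma Hoeffding_pairs:
  fixes Z :: "nat \<times> nat \<Rightarrow> color \<Rightarrow> real"
  assumes Z: "\<And>e c. 0 \<le> Z e c \<and> Z e c \<le> 2" and n: "n \<ge> 2" and \<kappa>: "\<kappa> > 0"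
    and \<mu>: "(\<Sum>e\<in>up_pairs n. measure_pmf.expectation (color_pmf d) (Z e)) \<le> \<mu>"
  shows "measure_pmf.prob (Pi_pmf (up_pairs n) NoArc (\<lambda>_. color_pmf d))
      {\<omega>. \<mu> + \<kappa> * real n ^ 2 < (\<Sum>e\<in>up_pairs n. Z e (\<omega> e))} \<le> exp (- (\<kappa> ^ 2 * real n ^ 2))"
proof -
  let ?M = "Pi_pmf (up_pairs n) NoArc (\<lambda>_. color_pmf d)"
  let ?X = "\<lambda>e \<omega>. Z e (\<omega> e)"
  define N where "N = real (n choose 2)"
  have N: "N > 0" using n by (simp add: N_def zero_less_binomial)
  have N2: "2 * N \<le> real n ^ 2" unfolding N_def two_choose_two by (simp add: power2_eq_square algebra_simps)
  have ind: "prob_space.indep_vars (measure_pmf ?M) (\<lambda>_. borel) ?X (up_pairs n)"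
    by (rule prob_space.indep_vars_compose2[OF measure_pmf.prob_space_axioms indep_vars_Pi_pmf[OF finite_up_pairs]]) auto
  interpret Hoeffding_ineq "measure_pmf ?M" "up_pairs n" ?X "\<lambda>_. 0" "\<lambda>_. 2" "\<Sum>e\<in>up_pairs n. measure_pmf.expectation ?M (?X e)"
    by unfold_locales (use ind Z in auto)
  have ex: "measure_pmf.expectation ?M (?X e) = measure_pmf.expectation (color_pmf d) (Z e)" if "e \<in> up_pairs n" for e
  proof -
    have "measure_pmf.expectation (map_pmf (\<lambda>\<omega>. \<omega> e) ?M) (Z e) = measure_pmf.expectation ?M (?X e)" by simp
    then show ?thesis using that by (simp add: Pi_pmf_component)
  qed
  have "measure_pmf.prob ?M {\<omega>. \<mu> + \<kappa> * real n ^ 2 < (\<Sum>e\<in>up_pairs n. Z e (\<omega> e))}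
     \<le> measure_pmf.prob ?M {x \<in> space (measure_pmf ?M). (\<Sum>e\<in>up_pairs n. ?X e x) \<ge> (\<Sum>e\<in>up_pairs n. measure_pmf.expectation ?M (?X e)) + \<kappa> * real n ^ 2}"
    using \<mu> ex by (intro measure_pmf.finite_measure_mono) auto
  also have "\<dots> \<le> exp (-2 * (\<kappa> * real n ^ 2)\<^sup>2 / (\<Sum>e\<in>up_pairs n. (2 - 0)\<^sup>2))"
    by (rule Hoeffding_ineq_ge) (use \<kappa> N in \<open>auto simp: card_up_pairs N_def\<close>)
  also have "\<dots> \<le> exp (- (\<kappa> ^ 2 * real n ^ 2))"
  proof -
    have "\<kappa> ^ 2 * real n ^ 2 * (2 * N) \<le> \<kappa> ^ 2 * real n ^ 2 * real n ^ 2"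
      using N2 by (intro mult_left_mono) auto
    then have "\<kappa> ^ 2 * real n ^ 2 \<le> 2 * (\<kappa> * real n ^ 2)\<^sup>2 / (4 * N)"
      using N by (simp add: pos_le_divide_eq power_mult_distrib power2_eq_square algebra_simps)
    then show ?thesis by (simp add: card_up_pairs N_def mult.commute)
  qed
  finally show ?thesis .
qed

lemma expectation_color_pmf:
  assumes "density_vector P d"
  shows "measure_pmf.expectation (color_pmf d) f = (\<Sum>c\<in>UNIV. f c * color_prob d c)"
  by (subst integral_measure_pmf_real[of UNIV]) (auto simp: pmf_color_pmf[OF assms])

text \<open>On the whole vertex set quasirandomness counts every directed pair once as
  \<open>Fwd\<close> and once as \<open>Bwd\<close>. The second clause counts only
  \<open>v < w\<close> and thereby bounds the two separately, as prescribed counts demand.\<close>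

definition typical :: "real \<Rightarrow> real \<times> real \<Rightarrow> nat \<Rightarrow> digraph \<Rightarrow> bool" where
  "typical \<kappa> d n G \<longleftrightarrow> quasirandom \<kappa> d n G \<and>
     (\<forall>c. real (arc_count G c) \<le> color_prob d c * real (n choose 2) + \<kappa> * real n ^ 2)"

text \<open>Hoeffding's inequality with a union bound over two vertex sets and a colour, and over
  the four total counts.\<close>

lemma prob_typical:
  assumes dv: "density_vector P d" and \<kappa>: "\<kappa> > 0"
  shows "(\<lambda>n. measure_pmf.prob (random_digraph n d) {G. typical \<kappa> d n G}) \<longlonglongrightarrow> 1"
proof -
  define b where "b n = (4 * (2 ^ n * 2 ^ n) + 4) * exp (- (\<kappa> ^ 2 * real n ^ 2))" for n :: nat
  have b0: "b \<longlonglongrightarrow> 0" unfolding b_def using \<kappa> by real_asymp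
  have low: "1 - b n \<le> measure_pmf.prob (random_digraph n d) {G. typical \<kappa> d n G}" if n: "n \<ge> 2" for n
  proof -
    let ?M = "Pi_pmf (up_pairs n) NoArc (\<lambda>_. color_pmf d)"
    \<comment> \<open>The random pair \<open>i < j\<close> stands for two ordered pairs, the second
      of which shows the reversed colour.\<close>
    define Z where "Z A B c = (\<lambda>(i, j) c'. of_bool (i \<in> A \<and> j \<in> B \<and> c' = c) + of_bool (j \<in> A \<and> i \<in> B \<and> rev_color c' = c) :: real)"
      for A B :: "nat set" and c :: color
    define Y where "Y c = (\<lambda>(e :: nat \<times> nat) c'. of_bool (c' = c) :: real)" for c :: color
    define bad1 where "bad1 = (\<lambda>(A, B, c). {\<omega>. color_prob d c * (real (card A) * real (card B)) + \<kappa> * real n ^ 2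
        < (\<Sum>e\<in>up_pairs n. Z A B c e (\<omega> e))})"
    define bad2 where "bad2 c = {\<omega>. color_prob d c * real (n choose 2) + \<kappa> * real n ^ 2
        < (\<Sum>e\<in>up_pairs n. Y c e (\<omega> e))}" for c
    let ?I = "Pow {..<n} \<times> Pow {..<n} \<times> (UNIV :: color set)"
    have card: "real (card {(x, y). x \<in> A \<and> y \<in> B \<and> x \<noteq> y \<and> col (mk_digraph n \<omega>) x y = c})
        = (\<Sum>e\<in>up_pairs n. Z A B c e (\<omega> e))" if AB: "A \<subseteq> {..<n}" "B \<subseteq> {..<n}" for A B c \<omega>
    proof -
      let ?L = "{(i, j). i < j \<and> j < n \<and> i \<in> A \<and> j \<in> B \<and> \<omega> (i, j) = c}"
      let ?R = "{(i, j). i < j \<and> j < n \<and> j \<in> A \<and> i \<in> B \<and> rev_color (\<omega> (i, j)) = c}"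
      have fin: "finite ?L" "finite ?R" by (rule finite_subset[OF _ finite_up_pairs[of n]]; auto simp: up_pairs_def)+
      have "{(x, y). x \<in> A \<and> y \<in> B \<and> x \<noteq> y \<and> col (mk_digraph n \<omega>) x y = c} = ?L \<union> prod.swap ` ?R"
        using AB by (auto simp: mk_digraph_def image_iff)
      moreover have "?L \<inter> prod.swap ` ?R = {}" by auto
      moreover have "card (prod.swap ` ?R) = card ?R" by (simp add: card_image)
      ultimately have "card {(x, y). x \<in> A \<and> y \<in> B \<and> x \<noteq> y \<and> col (mk_digraph n \<omega>) x y = c} = card ?L + card ?R"
        using fin by (simp add: card_Un_disjoint)
      moreover have "(\<Sum>e\<in>up_pairs n. Z A B c e (\<omega> e)) = real (card ?L) + real (card ?R)"
      proof -
        have "(\<Sum>e\<in>up_pairs n. of_bool (fst e \<in> A \<and> snd e \<in> B \<and> \<omega> e = c) :: real) = real (card ?L)"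
          by (subst sum_of_bool_eq, simp) (intro arg_cong[where f = "\<lambda>S. real (card S)"], auto simp: up_pairs_def)
        moreover have "(\<Sum>e\<in>up_pairs n. of_bool (snd e \<in> A \<and> fst e \<in> B \<and> rev_color (\<omega> e) = c) :: real) = real (card ?R)"
          by (subst sum_of_bool_eq, simp) (intro arg_cong[where f = "\<lambda>S. real (card S)"], auto simp: up_pairs_def)
        ultimately show ?thesis by (simp add: Z_def split_def sum.distrib del: sum_of_bool_eq)
      qed
      ultimately show ?thesis by simp
    qed
    have arc: "real (arc_count (mk_digraph n \<omega>) c) = (\<Sum>e\<in>up_pairs n. Y c e (\<omega> e))" for \<omega> c
      unfolding arc_count_def Y_def
      by (subst sum_of_bool_eq, simp) (intro arg_cong[where f = "\<lambda>S. real (card S)"], auto simp: up_pairs_def mk_digraph_def)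
    have p1: "measure_pmf.prob ?M (bad1 i) \<le> exp (- (\<kappa> ^ 2 * real n ^ 2))" if i: "i \<in> ?I" for i
    proof -
      obtain A B c where i': "i = (A, B, c)" "A \<subseteq> {..<n}" "B \<subseteq> {..<n}" using i by auto
      have fAB: "finite (A \<times> B)" using i' by (auto intro: finite_subset)
      have "measure_pmf.expectation (color_pmf d) (Z A B c e)
          = color_prob d c * (of_bool (fst e \<in> A \<and> snd e \<in> B) + of_bool (snd e \<in> A \<and> fst e \<in> B))" for e
      proof -
        have "(\<Sum>c'\<in>UNIV. Z A B c e c' * color_prob d c')
          = (\<Sum>c'\<in>UNIV. (if c' = c then of_bool (fst e \<in> A \<and> snd e \<in> B) * color_prob d c' else 0)
            + (if c' = rev_color c then of_bool (snd e \<in> A \<and> fst e \<in> B) * color_prob d c' else 0))"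
          by (rule sum.cong) (auto simp: Z_def split_def algebra_simps)
        also have "\<dots> = color_prob d c * (of_bool (fst e \<in> A \<and> snd e \<in> B) + of_bool (snd e \<in> A \<and> fst e \<in> B))"
          by (simp add: sum.distrib algebra_simps)
        finally show ?thesis by (simp add: expectation_color_pmf[OF dv])
      qed
      then have "(\<Sum>e\<in>up_pairs n. measure_pmf.expectation (color_pmf d) (Z A B c e))
        = color_prob d c * (\<Sum>e\<in>up_pairs n. of_bool (fst e \<in> A \<and> snd e \<in> B) + of_bool (snd e \<in> A \<and> fst e \<in> B))"
        by (simp add: sum_distrib_left del: sum_of_bool_eq)
      also have "(\<Sum>e\<in>up_pairs n. of_bool (fst e \<in> A \<and> snd e \<in> B) + of_bool (snd e \<in> A \<and> fst e \<in> B))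
        = real (card {e \<in> up_pairs n. fst e \<in> A \<and> snd e \<in> B}) + real (card {e \<in> up_pairs n. snd e \<in> A \<and> fst e \<in> B})"
        by (simp add: sum.distrib Int_def)
      also have "card {e \<in> up_pairs n. snd e \<in> A \<and> fst e \<in> B} = card (prod.swap ` {e \<in> up_pairs n. snd e \<in> A \<and> fst e \<in> B})"
        by (simp add: card_image)
      also have "real (card {e \<in> up_pairs n. fst e \<in> A \<and> snd e \<in> B}) + real (card (prod.swap ` {e \<in> up_pairs n. snd e \<in> A \<and> fst e \<in> B}))
        = real (card ({e \<in> up_pairs n. fst e \<in> A \<and> snd e \<in> B} \<union> prod.swap ` {e \<in> up_pairs n. snd e \<in> A \<and> fst e \<in> B}))"
      proof -
        have "finite {e \<in> up_pairs n. fst e \<in> A \<and> snd e \<in> B}"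
          "finite (prod.swap ` {e \<in> up_pairs n. snd e \<in> A \<and> fst e \<in> B})" by simp_all
        moreover have "{e \<in> up_pairs n. fst e \<in> A \<and> snd e \<in> B} \<inter> prod.swap ` {e \<in> up_pairs n. snd e \<in> A \<and> fst e \<in> B} = {}"
          by (auto simp: up_pairs_def)
        ultimately show ?thesis by (simp add: card_Un_disjoint)
      qed
      also have "color_prob d c * \<dots> \<le> color_prob d c * (real (card A) * real (card B))"
      proof -
        have "card ({e \<in> up_pairs n. fst e \<in> A \<and> snd e \<in> B} \<union> prod.swap ` {e \<in> up_pairs n. snd e \<in> A \<and> fst e \<in> B}) \<le> card (A \<times> B)"
          by (rule card_mono[OF fAB]) auto
        then show ?thesis
          by (intro mult_left_mono color_prob_nonneg[OF dv])
            (simp add: card_cartesian_product flip: of_nat_mult)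
      qed
      finally have "(\<Sum>e\<in>up_pairs n. measure_pmf.expectation (color_pmf d) (Z A B c e)) \<le> color_prob d c * (real (card A) * real (card B))" .
      from Hoeffding_pairs[OF _ n \<kappa> this] show ?thesis
        unfolding bad1_def i' prod.case by (auto simp: Z_def split_def)
    qed
    have p2: "measure_pmf.prob ?M (bad2 c) \<le> exp (- (\<kappa> ^ 2 * real n ^ 2))" for c
      unfolding bad2_def
    proof (rule Hoeffding_pairs[OF _ n \<kappa>])
      have "(\<Sum>c'\<in>UNIV. of_bool (c' = c) * color_prob d c') = (\<Sum>c'\<in>UNIV. if c' = c then color_prob d c' else 0)"
        by (rule sum.cong) auto
      then have "measure_pmf.expectation (color_pmf d) (Y c e) = color_prob d c" for e
        by (simp add: expectation_color_pmf[OF dv] Y_def)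
      then show "(\<Sum>e\<in>up_pairs n. measure_pmf.expectation (color_pmf d) (Y c e)) \<le> color_prob d c * real (n choose 2)"
        by (simp add: card_up_pairs)
    qed (simp add: Y_def)
    let ?bad = "(\<Union>i\<in>?I. bad1 i) \<union> (\<Union>c\<in>UNIV. bad2 c)"
    have "measure_pmf.prob ?M ?bad \<le> measure_pmf.prob ?M (\<Union>i\<in>?I. bad1 i) + measure_pmf.prob ?M (\<Union>c\<in>UNIV. bad2 c)"
      by (rule measure_Un_le) auto
    also have "\<dots> \<le> (\<Sum>i\<in>?I. measure_pmf.prob ?M (bad1 i)) + (\<Sum>c\<in>UNIV. measure_pmf.prob ?M (bad2 c))"
      by (intro add_mono measure_UNION_le) auto
    also have "\<dots> \<le> (\<Sum>i\<in>?I. exp (- (\<kappa> ^ 2 * real n ^ 2))) + (\<Sum>c\<in>(UNIV :: color set). exp (- (\<kappa> ^ 2 * real n ^ 2)))"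
      by (intro add_mono sum_mono p1 p2)
    also have "\<dots> = b n"
      by (simp add: b_def card_cartesian_product card_Pow card_UNIV_color algebra_simps)
    finally have "measure_pmf.prob ?M ?bad \<le> b n" .
    moreover have "measure_pmf.prob ?M (- ?bad) = 1 - measure_pmf.prob ?M ?bad"
      using measure_pmf.prob_compl[of ?bad ?M] by (simp add: Compl_eq_Diff_UNIV)
    moreover have "measure_pmf.prob ?M (- ?bad) \<le> measure_pmf.prob ?M (mk_digraph n -` {G. typical \<kappa> d n G})"
    proof (rule measure_pmf.finite_measure_mono)
      show "- ?bad \<subseteq> mk_digraph n -` {G. typical \<kappa> d n G}"
      proof
        fix \<omega> assume \<omega>: "\<omega> \<in> - ?bad"
        have "typical \<kappa> d n (mk_digraph n \<omega>)"
          unfolding typical_def quasirandom_def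
        proof (intro conjI allI impI)
          fix A B c assume AB: "A \<subseteq> {..<n}" "B \<subseteq> {..<n}"
          have "\<omega> \<notin> bad1 (A, B, c)" using \<omega> AB by blast
          then show "real (card {(x, y). x \<in> A \<and> y \<in> B \<and> x \<noteq> y \<and> col (mk_digraph n \<omega>) x y = c})
            \<le> color_prob d c * (real (card A) * real (card B)) + \<kappa> * real n ^ 2"
            unfolding card[OF AB] by (simp add: bad1_def not_less)
        next
          fix c
          have "\<omega> \<notin> bad2 c" using \<omega> by blast
          then show "real (arc_count (mk_digraph n \<omega>) c) \<le> color_prob d c * real (n choose 2) + \<kappa> * real n ^ 2"
            unfolding arc by (simp add: bad2_def not_less)
        qed
        then show "\<omega> \<in> mk_digraph n -` {G. typical \<kappa> d n G}" by simp
      qed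
    qed simp
    ultimately show ?thesis unfolding random_digraph_eq measure_map_pmf by simp
  qed
  show ?thesis
  proof (rule tendsto_sandwich[of "\<lambda>n. 1 - b n" _ _ "\<lambda>_. 1"])
    show "(\<lambda>n. 1 - b n) \<longlonglongrightarrow> 1" using tendsto_diff[OF tendsto_const[of 1] b0] by simp
    show "eventually (\<lambda>n. 1 - b n \<le> measure_pmf.prob (random_digraph n d) {G. typical \<kappa> d n G}) sequentially"
      using low by (intro eventually_sequentiallyI[of 2])
  qed auto
qed


subsection \<open>Prescribed colour counts\<close>

text \<open>Induction on the total surplus, to which truncated subtraction lets only overfull
  colours contribute. As both totals equal \<open>card E\<close>, an overfull colour comes with a
  deficient one, and one element is moved from the former to the latter.\<close>

lemma recolour_counts:
  fixes f :: "'e \<Rightarrow> color"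
  assumes "finite E" and "(\<Sum>c\<in>UNIV. b c) = card E"
  shows "\<exists>g. (\<forall>c. card {e \<in> E. g e = c} = b c) \<and>
    card {e \<in> E. f e \<noteq> g e} \<le> (\<Sum>c\<in>UNIV. card {e \<in> E. f e = c} - b c)"
proof (induction "\<Sum>c\<in>UNIV. card {e \<in> E. f e = c} - b c" arbitrary: f)
  case (0 f)
  define a where "a c = card {e \<in> E. f e = c}" for c
  have sa: "(\<Sum>c\<in>UNIV. a c) = card E"
    using sum_fun_comp[OF assms(1), of UNIV f "\<lambda>_. 1 :: nat"] unfolding a_def by simp
  have le: "a c \<le> b c" for c using 0 by (simp add: a_def)
  have "a c = b c" for c
  proof (rule ccontr)
    assume "a c \<noteq> b c"
    then have "a c < b c" using le[of c] by simp
    then have "\<exists>c\<in>UNIV. a c < b c" by blast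
    then have "(\<Sum>c\<in>UNIV. a c) < (\<Sum>c\<in>UNIV. b c)"
      using le by (intro sum_strict_mono_ex1) auto
    then show False using sa assms(2) by simp
  qed
  then show ?case by (intro exI[of _ f]) (simp add: a_def)
next
  case (Suc m f)
  define a where "a c = card {e \<in> E. f e = c}" for c
  have sa: "(\<Sum>c\<in>UNIV. a c) = card E"
    using sum_fun_comp[OF assms(1), of UNIV f "\<lambda>_. 1 :: nat"] unfolding a_def by simp
  have m: "Suc m = (\<Sum>c\<in>UNIV. a c - b c)" using Suc.hyps(2) by (simp add: a_def)
  have "\<exists>c. a c > b c"
  proof (rule ccontr)
    assume "\<nexists>c. a c > b c"
    then have "(\<Sum>c\<in>UNIV. a c - b c) = 0" by (simp add: not_less)
    then show False using m by simp
  qed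
  then obtain c1 where c1: "a c1 > b c1" ..
  have "\<exists>c. a c < b c"
  proof (rule ccontr)
    assume "\<nexists>c. a c < b c"
    then have "(\<Sum>c\<in>UNIV. b c) < (\<Sum>c\<in>UNIV. a c)"
      using c1 by (intro sum_strict_mono_ex1) (auto simp: not_less)
    then show False using sa assms(2) by simp
  qed
  then obtain c2 where c2: "a c2 < b c2" ..
  have ne: "c1 \<noteq> c2" using c1 c2 by auto
  have "{e \<in> E. f e = c1} \<noteq> {}" using c1 unfolding a_def by (intro notI) simp
  then obtain e where e: "e \<in> E" "f e = c1" by blast
  define f' where "f' = f(e := c2)"
  define a' where "a' c = card {e \<in> E. f' e = c}" for c
  have "{x \<in> E. f' x = c1} = {x \<in> E. f x = c1} - {e}" using ne by (auto simp: f'_def)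
  then have a1: "a' c1 = a c1 - 1" using e assms(1) by (simp add: a_def a'_def)
  have "{x \<in> E. f' x = c2} = insert e {x \<in> E. f x = c2}" using e ne by (auto simp: f'_def)
  then have a2: "a' c2 = Suc (a c2)" using e ne assms(1) by (simp add: a_def a'_def)
  have a3: "a' c = a c" if "c \<noteq> c1" "c \<noteq> c2" for c
  proof -
    have "{x \<in> E. f' x = c} = {x \<in> E. f x = c}" using that e by (auto simp: f'_def)
    then show ?thesis by (simp add: a_def a'_def)
  qed
  have r: "(\<Sum>c\<in>UNIV. a c - b c) = (a c1 - b c1) + (a c2 - b c2) + (\<Sum>c\<in>UNIV - {c1} - {c2}. a c - b c)"
    "(\<Sum>c\<in>UNIV. a' c - b c) = (a' c1 - b c1) + (a' c2 - b c2) + (\<Sum>c\<in>UNIV - {c1} - {c2}. a' c - b c)"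
    using ne by (simp_all add: sum.remove[of UNIV c1] sum.remove[of "UNIV - {c1}" c2])
  have "(\<Sum>c\<in>UNIV - {c1} - {c2}. a' c - b c) = (\<Sum>c\<in>UNIV - {c1} - {c2}. a c - b c)"
    by (rule sum.cong) (auto simp: a3)
  then have m': "m = (\<Sum>c\<in>UNIV. a' c - b c)" using r m a1 a2 c1 c2 by linarith
  from Suc.hyps(1)[of f'] m' obtain g where g: "\<forall>c. card {e \<in> E. g e = c} = b c"
    "card {e \<in> E. f' e \<noteq> g e} \<le> m" unfolding a'_def by auto
  have "{x \<in> E. f x \<noteq> g x} \<subseteq> insert e {x \<in> E. f' x \<noteq> g x}" by (auto simp: f'_def)
  then have "card {x \<in> E. f x \<noteq> g x} \<le> card (insert e {x \<in> E. f' x \<noteq> g x})"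
    using assms(1) by (intro card_mono) auto
  also have "\<dots> \<le> Suc m" using g(2) assms(1) by (simp add: card_insert_if)
  finally have "card {x \<in> E. f x \<noteq> g x} \<le> Suc m" .
  then show ?case using g(1) Suc.hyps(2) by (intro exI[of _ g] conjI) simp_all
qed

subsection \<open>The limit\<close>

lemma color_prob_affine:
  assumes "u + v = 1"
  shows "color_prob (u *\<^sub>R x + v *\<^sub>R y) c = u * color_prob x c + v * color_prob y c"
proof -
  obtain p q where x: "x = (p, q)" by (cases x)
  obtain p' q' where y: "y = (p', q')" by (cases y)
  have v: "v = 1 - u" using assms by simp
  show ?thesis unfolding v by (cases c) (simp_all add: x y algebra_simps)
qed

definition prob_diff :: "real \<times> real \<Rightarrow> real \<times> real \<Rightarrow> real" where
  "prob_diff d d' = (\<Sum>c\<in>UNIV. \<bar>color_prob d c - color_prob d' c\<bar>)"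

lemma miss_diff: "miss d T \<le> miss d' T + prob_diff d d'"
proof -
  have "miss d T - miss d' T = (\<Sum>c\<in>T. color_prob d' c - color_prob d c)"
    by (simp add: miss_def sum_subtractf)
  also have "\<dots> \<le> (\<Sum>c\<in>T. \<bar>color_prob d c - color_prob d' c\<bar>)" by (rule sum_mono) auto
  also have "\<dots> \<le> prob_diff d d'" unfolding prob_diff_def by (rule sum_mono2) auto
  finally show ?thesis by simp
qed

lemma weightings_sum:
  assumes "w \<in> weightings K"
  shows "(\<Sum>x\<in>tverts K. \<Sum>y\<in>tverts K. w x * w y) = 1"
  using assms by (simp add: weightings_def sum_product[symmetric])

text \<open>The weights sum to one, so the Lipschitz constant is the same for all types and survives
  the passage to infima.\<close>

lemma type_form_diff:
  assumes "w \<in> weightings K"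
  shows "type_form K d w \<le> type_form K d' w + prob_diff d d'"
proof -
  have "type_form K d w \<le> (\<Sum>x\<in>tverts K. \<Sum>y\<in>tverts K. w x * (miss d' (tcol K x y) + prob_diff d d') * w y)"
    unfolding type_form_def type_matrix_eq_miss using assms
    by (intro sum_mono mult_right_mono mult_left_mono miss_diff) (auto simp: weightings_def)
  also have "\<dots> = type_form K d' w + prob_diff d d' * (\<Sum>x\<in>tverts K. \<Sum>y\<in>tverts K. w x * w y)"
    unfolding type_form_def type_matrix_eq_miss by (simp add: sum.distrib[symmetric] sum_distrib_left algebra_simps)
  finally show ?thesis by (simp add: weightings_sum[OF assms])
qed

lemma type_form_nonneg:
  assumes "w \<in> weightings K" "density_vector P d"
  shows "0 \<le> type_form K d w"
  unfolding type_form_def type_matrix_eq_miss using assms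
  by (intro sum_nonneg mult_nonneg_nonneg miss_bounds(1)) (auto simp: weightings_def)

lemma uniform_weighting:
  assumes "is_dir_type P K"
  shows "(\<lambda>_. 1 / real (card (tverts K))) \<in> weightings K"
  using assms by (simp add: weightings_def is_dir_type_def)

lemma f_fun_affine:
  assumes "u + v = 1"
  shows "f_fun K (u *\<^sub>R x + v *\<^sub>R y) = u * f_fun K x + v * f_fun K y"
proof -
  have "miss (u *\<^sub>R x + v *\<^sub>R y) T = u * miss x T + v * miss y T" for T
  proof -
    have "miss (u *\<^sub>R x + v *\<^sub>R y) T = (u + v) - (\<Sum>c\<in>T. u * color_prob x c + v * color_prob y c)"
      by (simp add: miss_def color_prob_affine[OF assms] assms)
    then show ?thesis by (simp add: miss_def sum.distrib sum_distrib_left algebra_simps)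
  qed
  then show ?thesis
    unfolding f_fun_def type_form_def type_matrix_eq_miss
    by (simp add: sum.distrib sum_distrib_left algebra_simps add_divide_distrib)
qed

section \<open>The infimum over types and the distance of typical digraphs\<close>

locale hereditary_property =
  fixes P :: "color set" and \<H> F :: "digraph set"
  assumes P: "P \<in> palettes" and her: "hereditary P \<H>"
    and ex_order: "\<And>n. \<exists>G\<in>\<H>. card (verts G) = n" and F: "forbidden_family P \<H> F"
begin

definition \<beta> :: "real \<times> real \<Rightarrow> real" where
  "\<beta> d = (INF K\<in>type_family P F. f_fun K d)"

lemma member_digraph: "G \<in> \<H> \<Longrightarrow> is_digraph P G"
  using her by (simp add: hereditary_def)

text \<open>Closure under isomorphism carries a member of the right order over to \<open>V\<close>;
  hence the minimum in \<open>dist_prop\<close> is taken over a nonempty set.\<close>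

lemma ex_member:
  assumes "finite V"
  shows "\<exists>G'\<in>\<H>. verts G' = V"
proof -
  obtain G where G: "G \<in> \<H>" "card (verts G) = card V" using ex_order by blast
  have dG: "is_digraph P G" by (rule member_digraph[OF G(1)])
  then obtain f where f: "bij_betw f (verts G) V"
    using finite_same_card_bij[of "verts G" V] G(2) assms by (auto simp: is_digraph_def)
  define g where "g = inv_into (verts G) f"
  have g: "bij_betw g V (verts G)" unfolding g_def by (rule bij_betw_inv_into[OF f])
  have gv: "g x \<in> verts G" if "x \<in> V" for x using g that by (auto simp: bij_betw_def)
  have gne: "g x \<noteq> g y" if "x \<in> V" "y \<in> V" "x \<noteq> y" for x y using g that by (auto simp: bij_betw_def inj_on_def)
  define G' where "G' = \<lparr>verts = V, col = (\<lambda>x y. col G (g x) (g y))\<rparr>"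
  have "is_digraph P G'"
    using dG gv gne assms unfolding is_digraph_def G'_def by auto
  moreover have "digraph_iso G G'"
    unfolding digraph_iso_def using f
    by (intro exI[of _ f]) (auto simp: G'_def g_def bij_betw_def)
  ultimately have "G' \<in> \<H>" using her G(1) unfolding hereditary_def by blast
  then show ?thesis by (intro bexI[of _ G']) (simp_all add: G'_def)
qed

lemma dist_prop_attained:
  assumes "finite (verts G)"
  obtains G' where "G' \<in> \<H>" "verts G' = verts G" "dist_prop G \<H> = edit_dist G G'"
proof -
  let ?S = "{edit_dist G G' |G'. G' \<in> \<H> \<and> verts G' = verts G}"
  have "?S \<noteq> {}" using ex_member[OF assms] by blast
  then have "Min ?S \<in> ?S" by (rule Min_in[OF finite_edit_dists[OF assms]])
  then show thesis using that unfolding dist_prop_def by blast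
qed

lemma dist_prop_bounds:
  assumes "finite (verts G)"
  shows "0 \<le> dist_prop G \<H>" "dist_prop G \<H> \<le> 1"
  using dist_prop_attained[OF assms] edit_dist_bounds[OF assms] by metis+

lemma finite_dist_props: "finite {dist_prop G \<H> |G. finite (verts G) \<and> card (verts G) = n \<and> Q G}"
proof (rule finite_subset)
  show "{dist_prop G \<H> |G. finite (verts G) \<and> card (verts G) = n \<and> Q G} \<subseteq> (\<lambda>k. real k / real (n choose 2)) ` {..n choose 2}"
  proof
    fix x assume "x \<in> {dist_prop G \<H> |G. finite (verts G) \<and> card (verts G) = n \<and> Q G}"
    then obtain G where G: "x = dist_prop G \<H>" "finite (verts G)" "card (verts G) = n" by blast
    obtain G' where G': "dist_prop G \<H> = edit_dist G G'" using dist_prop_attained[OF G(2)] by blast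
    have "{{v, w} |v w. v \<in> verts G \<and> w \<in> verts G \<and> v \<noteq> w \<and> col G v w \<noteq> col G' v w}
      \<subseteq> {K. K \<subseteq> verts G \<and> card K = 2}" by auto
    then have "card {{v, w} |v w. v \<in> verts G \<and> w \<in> verts G \<and> v \<noteq> w \<and> col G v w \<noteq> col G' v w} \<le> n choose 2"
      using G by (subst n_subsets[of "verts G" 2, unfolded G(3), symmetric]) (auto intro!: card_mono)
    then show "x \<in> (\<lambda>k. real k / real (n choose 2)) ` {..n choose 2}"
      unfolding G(1) G' edit_dist_def G(3) by blast
  qed
qed simp

lemma typical_exists:
  assumes "density_vector P d" "\<kappa> > 0"
  shows "\<forall>\<^sub>F n in sequentially. \<exists>G. is_digraph P G \<and> verts G = {..<n} \<and> typical \<kappa> d n G"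
proof -
  have "\<forall>\<^sub>F n in sequentially. measure_pmf.prob (random_digraph n d) {G. typical \<kappa> d n G} > 0"
    by (rule order_tendstoD(1)[OF prob_typical[OF assms]]) simp
  then show ?thesis
  proof (rule eventually_mono)
    fix n assume pos: "measure_pmf.prob (random_digraph n d) {G. typical \<kappa> d n G} > 0"
    have "set_pmf (random_digraph n d) \<inter> {G. typical \<kappa> d n G} \<noteq> {}"
      using pos by (auto simp: measure_pmf_zero_iff[symmetric])
    then show "\<exists>G. is_digraph P G \<and> verts G = {..<n} \<and> typical \<kappa> d n G"
      using set_pmf_random_digraph[OF P assms(1)] by blast
  qed
qed

lemma typical_imp_quasirandom: "typical \<kappa> d n G \<Longrightarrow> quasirandom \<kappa> d n G"
  by (simp add: typical_def)

lemma quasirandom_mono: "quasirandom \<kappa> d n G \<Longrightarrow> \<kappa> \<le> \<kappa>' \<Longrightarrow> quasirandom \<kappa>' d n G"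
  unfolding quasirandom_def
  by (meson add_left_mono mult_right_mono order_trans zero_le_power2)

text \<open>For an empty family any lower bound on \<open>f_fun\<close> holds vacuously; with 3 and
  error 1, \<open>edit_dist_ge\<close> would produce distances of at least 2. Without this fact the
  infimum of reals in \<open>\<beta>\<close> would have no meaning.\<close>

lemma type_family_nonempty:
  assumes dv: "density_vector P d"
  shows "type_family P F \<noteq> {}"
proof
  assume "type_family P F = {}"
  then have "3 \<le> f_fun K d" if "K \<in> type_family P F" for K using that by simp
  from edit_dist_ge[OF P dv F this zero_less_one] obtain \<kappa> n0 where \<kappa>: "\<kappa> > 0" and low: "\<And>n G G'. n \<ge> n0 \<Longrightarrow> is_digraph P G \<Longrightarrow> verts G = {..<n} \<Longrightarrow>
      G' \<in> \<H> \<Longrightarrow> verts G' = {..<n} \<Longrightarrow> quasirandom \<kappa> d n G \<Longrightarrow> 3 - 1 \<le> edit_dist G G'"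
    by metis
  have "\<forall>\<^sub>F n in sequentially. n \<ge> n0 \<and> (\<exists>G. is_digraph P G \<and> verts G = {..<n} \<and> typical \<kappa> d n G)"
    using typical_exists[OF dv \<kappa>] eventually_ge_at_top[of n0] by (rule eventually_conj[rotated])
  from eventually_happens'[OF sequentially_bot this] obtain n G where G: "is_digraph P G" "verts G = {..<n}" "typical \<kappa> d n G" "n \<ge> n0" by blast
  obtain G' where "G' \<in> \<H>" "verts G' = {..<n}" using ex_member[of "{..<n}"] by auto
  from low[OF G(4,1,2) this typical_imp_quasirandom[OF G(3)]] edit_dist_bounds(2)[of G G'] G(2)
  show False by simp
qed

lemma type_family_dir: "K \<in> type_family P F \<Longrightarrow> is_dir_type P K"
  by (simp add: type_family_def)

lemma f_fun_nonneg: "density_vector P d \<Longrightarrow> K \<in> type_family P F \<Longrightarrow> 0 \<le> f_fun K d"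
  unfolding f_fun_def by (rule type_form_nonneg[OF uniform_weighting[OF type_family_dir]])

lemma \<beta>_le: "density_vector P d \<Longrightarrow> K \<in> type_family P F \<Longrightarrow> \<beta> d \<le> f_fun K d"
  unfolding \<beta>_def by (rule cINF_lower) (auto intro!: bdd_belowI2[of _ 0] f_fun_nonneg)

lemma \<beta>_greatest:
  assumes "density_vector P d" "\<And>K. K \<in> type_family P F \<Longrightarrow> b \<le> f_fun K d"
  shows "b \<le> \<beta> d"
  unfolding \<beta>_def by (rule cINF_greatest[OF type_family_nonempty[OF assms(1)] assms(2)])

lemma \<beta>_diff:
  assumes d: "density_vector P d" and d': "density_vector P d'"
  shows "\<beta> d \<le> \<beta> d' + prob_diff d d'"
proof -
  have "\<beta> d - prob_diff d d' \<le> \<beta> d'"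
  proof (rule \<beta>_greatest[OF d'])
    fix K assume K: "K \<in> type_family P F"
    have "f_fun K d \<le> f_fun K d' + prob_diff d d'"
      unfolding f_fun_def by (rule type_form_diff[OF uniform_weighting[OF type_family_dir[OF K]]])
    then show "\<beta> d - prob_diff d d' \<le> f_fun K d'" using \<beta>_le[OF d K] by simp
  qed
  then show ?thesis by simp
qed

lemma dist_prop_le_\<beta>:
  assumes G: "is_digraph P G" "card (verts G) \<ge> 2"
  shows "dist_prop G \<H> \<le> \<beta> (arc_density G)"
proof (rule \<beta>_greatest[OF density_vector_arc_density[OF P G]])
  fix K assume K: "K \<in> type_family P F"
  show "dist_prop G \<H> \<le> f_fun K (arc_density G)"
    unfolding f_fun_def
    by (rule dist_prop_le_type_form[OF P F K uniform_weighting[OF type_family_dir[OF K]] G])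
qed

lemma dist_prop_ge:
  assumes dv: "density_vector P d" and \<epsilon>: "\<epsilon> > 0"
  shows "\<exists>\<kappa>>0. \<exists>n0. \<forall>n\<ge>n0. \<forall>G. is_digraph P G \<longrightarrow> verts G = {..<n} \<longrightarrow> quasirandom \<kappa> d n G \<longrightarrow>
    \<beta> d - \<epsilon> \<le> dist_prop G \<H>"
proof -
  obtain \<kappa> n0 where \<kappa>: "\<kappa> > 0" and low: "\<And>n G G'. n \<ge> n0 \<Longrightarrow> is_digraph P G \<Longrightarrow> verts G = {..<n} \<Longrightarrow>
      G' \<in> \<H> \<Longrightarrow> verts G' = {..<n} \<Longrightarrow> quasirandom \<kappa> d n G \<Longrightarrow> \<beta> d - \<epsilon> \<le> edit_dist G G'"
    using edit_dist_ge[OF P dv F \<beta>_le[OF dv] \<epsilon>] by metis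
  have "\<beta> d - \<epsilon> \<le> dist_prop G \<H>"
    if G: "n \<ge> n0" "is_digraph P G" "verts G = {..<n}" "quasirandom \<kappa> d n G" for n G
  proof -
    have "finite (verts G)" using G by simp
    then obtain G' where "G' \<in> \<H>" "verts G' = verts G" "dist_prop G \<H> = edit_dist G G'"
      by (rule dist_prop_attained)
    then show ?thesis using low[OF G(1-3) _ _ G(4), of G'] G(3) by simp
  qed
  then show ?thesis using \<kappa> by blast
qed

text \<open>Both vectors of probabilities sum to one, so the absolute differences add up to twice
  the positive parts, which are at most \<open>e\<close> for each of four colours.\<close>

lemma prob_diff_le:
  assumes "\<And>c. color_prob d c \<le> color_prob d' c + e"
  shows "prob_diff d d' \<le> 8 * e"
proof -
  have low: "color_prob d' c - 3 * e \<le> color_prob d c" for c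
  proof -
    have "(\<Sum>x\<in>UNIV - {c}. color_prob d x) \<le> (\<Sum>x\<in>UNIV - {c}. color_prob d' x + e)"
      by (intro sum_mono assms)
    also have "\<dots> = (\<Sum>x\<in>UNIV - {c}. color_prob d' x) + 3 * e"
      by (simp add: sum.distrib card_UNIV_color)
    finally show ?thesis
      using sum.remove[of UNIV c "color_prob d"] sum.remove[of UNIV c "color_prob d'"]
        sum_color_prob[of d] sum_color_prob[of d'] by simp
  qed
  have e: "e \<ge> 0"
  proof -
    have "(\<Sum>x\<in>UNIV. color_prob d x) \<le> (\<Sum>x\<in>UNIV. color_prob d' x + e)" by (intro sum_mono assms)
    also have "\<dots> = 1 + 4 * e" by (simp add: sum.distrib card_UNIV_color sum_color_prob)
    finally show ?thesis by (simp add: sum_color_prob)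
  qed
  have *: "\<bar>color_prob d c - color_prob d' c\<bar> = 2 * max 0 (color_prob d c - color_prob d' c) - (color_prob d c - color_prob d' c)" for c
    by (simp add: max_def abs_if)
  have "prob_diff d d' = 2 * (\<Sum>c\<in>UNIV. max 0 (color_prob d c - color_prob d' c))"
    unfolding prob_diff_def * by (simp add: sum_subtractf sum_distrib_left sum_color_prob)
  also have "\<dots> \<le> 2 * (\<Sum>c\<in>(UNIV :: color set). e)"
    using e assms by (intro mult_left_mono sum_mono) (auto simp: algebra_simps)
  finally show ?thesis by (simp add: card_UNIV_color)
qed

lemma half_square_le_choose: "n \<ge> 2 \<Longrightarrow> real n ^ 2 \<le> 4 * real (n choose 2)"
proof -
  assume "n \<ge> 2"
  then have "real n * (real n - 2) \<ge> 0" by simp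
  then have "real n ^ 2 \<le> 2 * (real n * (real n - 1))" by (simp add: power2_eq_square algebra_simps)
  then show ?thesis using two_choose_two[of n] by linarith
qed

lemma arc_density_close:
  assumes G: "is_digraph P G" "card (verts G) = n" "n \<ge> 2"
    and le: "\<And>c. real (arc_count G c) \<le> color_prob d c * real (n choose 2) + \<delta> * real (n choose 2)"
  shows "prob_diff (arc_density G) d \<le> 8 * \<delta>"
proof (rule prob_diff_le)
  fix c
  have N: "real (n choose 2) > 0" using G(3) by (simp add: zero_less_binomial)
  have fin: "finite (verts G)" using G by (simp add: is_digraph_def)
  have "real (arc_count G c) + real (arc_count G (rev_color c)) \<le> (color_prob d c + \<delta>) * (2 * real (n choose 2))"
    using le[of c] le[of "rev_color c"] by (simp add: algebra_simps)
  then show "color_prob (arc_density G) c \<le> color_prob d c + \<delta>"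
    using N G(2,3) by (simp add: color_prob_arc_density[OF fin] pos_divide_le_eq)
qed

text \<open>The upper bound holds at the densities of \<open>G\<close> and is moved to
  \<open>d\<close> by the Lipschitz estimate; the lower bound is quasirandomness at
  \<open>d\<close>.\<close>

lemma typical_close:
  assumes dv: "density_vector P d" and \<epsilon>: "\<epsilon> > 0"
  shows "\<exists>\<kappa>>0. \<forall>\<^sub>F n in sequentially. \<forall>G. is_digraph P G \<longrightarrow> verts G = {..<n} \<longrightarrow> typical \<kappa> d n G \<longrightarrow>
    prob_diff (arc_density G) d \<le> \<epsilon> \<and> \<bar>dist_prop G \<H> - \<beta> d\<bar> \<le> \<epsilon>"
proof -
  obtain \<kappa>1 n0 where \<kappa>1: "\<kappa>1 > 0" and low: "\<And>n G. n \<ge> n0 \<Longrightarrow> is_digraph P G \<Longrightarrow> verts G = {..<n} \<Longrightarrow>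
      quasirandom \<kappa>1 d n G \<Longrightarrow> \<beta> d - \<epsilon> \<le> dist_prop G \<H>"
    using dist_prop_ge[OF dv \<epsilon>] by metis
  \<comment> \<open>\<open>real n ^ 2\<close> is at most four times the number of pairs, and
    \<open>arc_density_close\<close> contributes a factor 8; hence 32.\<close>
  define \<kappa> where "\<kappa> = min \<kappa>1 (\<epsilon> / 32)"
  have \<kappa>: "\<kappa> > 0" "\<kappa> \<le> \<kappa>1" "32 * \<kappa> \<le> \<epsilon>" using \<kappa>1 \<epsilon> by (auto simp: \<kappa>_def)
  have "prob_diff (arc_density G) d \<le> \<epsilon> \<and> \<bar>dist_prop G \<H> - \<beta> d\<bar> \<le> \<epsilon>"
    if n: "n \<ge> max n0 2" and G: "is_digraph P G" "verts G = {..<n}" "typical \<kappa> d n G" for n G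
  proof -
    have c: "card (verts G) = n" "n \<ge> 2" using G n by auto
    have "real (arc_count G c) \<le> color_prob d c * real (n choose 2) + (4 * \<kappa>) * real (n choose 2)" for c
    proof -
      have "real (arc_count G c) \<le> color_prob d c * real (n choose 2) + \<kappa> * real n ^ 2"
        using G(3) by (simp add: typical_def)
      also have "\<kappa> * real n ^ 2 \<le> \<kappa> * (4 * real (n choose 2))"
        using half_square_le_choose[OF c(2)] \<kappa>(1) by (intro mult_left_mono) auto
      finally show ?thesis by simp
    qed
    from arc_density_close[OF G(1) c this] \<kappa>(3) have pd: "prob_diff (arc_density G) d \<le> \<epsilon>" by simp
    have "dist_prop G \<H> \<le> \<beta> (arc_density G)" using dist_prop_le_\<beta>[OF G(1)] c by simp
    also have "\<dots> \<le> \<beta> d + prob_diff (arc_density G) d"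
      by (rule \<beta>_diff[OF density_vector_arc_density[OF P G(1)] dv]) (use c in simp)
    finally have "dist_prop G \<H> \<le> \<beta> d + \<epsilon>" using pd by simp
    moreover have "\<beta> d - \<epsilon> \<le> dist_prop G \<H>"
      using low[of n G] n G quasirandom_mono[OF typical_imp_quasirandom[OF G(3)] \<kappa>(2)] by simp
    ultimately show ?thesis using pd by (simp add: abs_le_iff)
  qed
  then have "\<forall>\<^sub>F n in sequentially. \<forall>G. is_digraph P G \<longrightarrow> verts G = {..<n} \<longrightarrow> typical \<kappa> d n G \<longrightarrow>
    prob_diff (arc_density G) d \<le> \<epsilon> \<and> \<bar>dist_prop G \<H> - \<beta> d\<bar> \<le> \<epsilon>"
    unfolding eventually_sequentially by blast
  then show ?thesis using \<kappa>(1) by blast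
qed

text \<open>A typical digraph has distance close to \<open>\<beta> d\<close>, and each weighted type
  bounds this distance from above. The detour through digraphs avoids approximating \<open>w\<close>
  by uniform weights on a larger type.\<close>

lemma \<beta>_le_type_form:
  assumes dv: "density_vector P d" and K: "K \<in> type_family P F" and w: "w \<in> weightings K"
  shows "\<beta> d \<le> type_form K d w"
proof (rule field_le_epsilon)
  fix e :: real assume e: "e > 0"
  obtain \<kappa> where \<kappa>: "\<kappa> > 0" and close: "\<forall>\<^sub>F n in sequentially. \<forall>G. is_digraph P G \<longrightarrow> verts G = {..<n} \<longrightarrow> typical \<kappa> d n G \<longrightarrow>
    prob_diff (arc_density G) d \<le> e / 2 \<and> \<bar>dist_prop G \<H> - \<beta> d\<bar> \<le> e / 2"
    using typical_close[OF dv, of "e / 2"] e by auto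
  have "\<forall>\<^sub>F n in sequentially. \<beta> d \<le> type_form K d w + e"
    using close typical_exists[OF dv \<kappa>] eventually_ge_at_top[of 2]
  proof eventually_elim
    case (elim n)
    then obtain G where G: "is_digraph P G" "verts G = {..<n}"
      "prob_diff (arc_density G) d \<le> e / 2" "\<bar>dist_prop G \<H> - \<beta> d\<bar> \<le> e / 2" by blast
    have "dist_prop G \<H> \<le> type_form K (arc_density G) w"
      by (rule dist_prop_le_type_form[OF P F K w G(1)]) (use G elim in simp)
    also have "\<dots> \<le> type_form K d w + prob_diff (arc_density G) d" by (rule type_form_diff[OF w])
    finally show ?case using G(3,4) by linarith
  qed
  then show "\<beta> d \<le> type_form K d w + e" by simp
qed

lemma \<beta>_eq_g_fun:
  assumes dv: "density_vector P d"
  shows "(INF K\<in>type_family P F. g_fun K d) = \<beta> d"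
proof (rule antisym)
  have gb: "\<beta> d \<le> g_fun K d" if "K \<in> type_family P F" for K
    unfolding g_fun_def using uniform_weighting[OF type_family_dir[OF that]]
    by (intro cINF_greatest \<beta>_le_type_form[OF dv that]) auto
  have bdd: "bdd_below ((\<lambda>K. g_fun K d) ` type_family P F)" using gb by (intro bdd_belowI2)
  show "\<beta> d \<le> (INF K\<in>type_family P F. g_fun K d)"
    by (rule cINF_greatest[OF type_family_nonempty[OF dv] gb])
  show "(INF K\<in>type_family P F. g_fun K d) \<le> \<beta> d"
  proof (rule \<beta>_greatest[OF dv])
    fix K assume K: "K \<in> type_family P F"
    have "(INF K\<in>type_family P F. g_fun K d) \<le> g_fun K d" by (rule cINF_lower[OF bdd K])
    also have "\<dots> \<le> f_fun K d"
      unfolding g_fun_def f_fun_def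
      by (rule cINF_lower[OF _ uniform_weighting[OF type_family_dir[OF K]]])
        (intro bdd_belowI2[of _ 0] type_form_nonneg[OF _ dv])
    finally show "(INF K\<in>type_family P F. g_fun K d) \<le> f_fun K d" .
  qed
qed

text \<open>The error is two-sided: the densities of a random digraph fluctuate around
  \<open>d\<close>, and the upper bound \<open>\<beta> (arc_density G)\<close> fluctuates with
  them.\<close>

lemma prob_close:
  assumes dv: "density_vector P d" and \<epsilon>: "\<epsilon> > 0"
  shows "(\<lambda>n. measure_pmf.prob (random_digraph n d) {G. \<bar>dist_prop G \<H> - \<beta> d\<bar> \<le> \<epsilon>}) \<longlonglongrightarrow> 1"
proof -
  obtain \<kappa> where \<kappa>: "\<kappa> > 0" and close: "\<forall>\<^sub>F n in sequentially. \<forall>G. is_digraph P G \<longrightarrow> verts G = {..<n} \<longrightarrow> typical \<kappa> d n G \<longrightarrow>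
    prob_diff (arc_density G) d \<le> \<epsilon> \<and> \<bar>dist_prop G \<H> - \<beta> d\<bar> \<le> \<epsilon>"
    using typical_close[OF dv \<epsilon>] by auto
  show ?thesis
  proof (rule tendsto_sandwich[of "\<lambda>n. measure_pmf.prob (random_digraph n d) {G. typical \<kappa> d n G}" _ _ "\<lambda>_. 1"])
    show "\<forall>\<^sub>F n in sequentially. measure_pmf.prob (random_digraph n d) {G. typical \<kappa> d n G}
        \<le> measure_pmf.prob (random_digraph n d) {G. \<bar>dist_prop G \<H> - \<beta> d\<bar> \<le> \<epsilon>}"
      using close
    proof (rule eventually_mono)
      fix n assume *: "\<forall>G. is_digraph P G \<longrightarrow> verts G = {..<n} \<longrightarrow> typical \<kappa> d n G \<longrightarrow>
        prob_diff (arc_density G) d \<le> \<epsilon> \<and> \<bar>dist_prop G \<H> - \<beta> d\<bar> \<le> \<epsilon>"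
      show "measure_pmf.prob (random_digraph n d) {G. typical \<kappa> d n G}
        \<le> measure_pmf.prob (random_digraph n d) {G. \<bar>dist_prop G \<H> - \<beta> d\<bar> \<le> \<epsilon>}"
        by (rule measure_pmf.finite_measure_mono_AE)
          (use * set_pmf_random_digraph[OF P dv] in \<open>auto simp: AE_measure_pmf_iff\<close>)
    qed
    show "(\<lambda>n. measure_pmf.prob (random_digraph n d) {G. typical \<kappa> d n G}) \<longlonglongrightarrow> 1"
      by (rule prob_typical[OF dv \<kappa>])
  qed auto
qed

lemma \<beta>_bounds:
  assumes dv: "density_vector P d"
  shows "0 \<le> \<beta> d" "\<beta> d \<le> 1"
proof -
  show "0 \<le> \<beta> d" by (rule \<beta>_greatest[OF dv f_fun_nonneg[OF dv]])
  obtain K where K: "K \<in> type_family P F" using type_family_nonempty[OF dv] by blast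
  let ?w = "\<lambda>_. 1 / real (card (tverts K))"
  have w: "?w \<in> weightings K" by (rule uniform_weighting[OF type_family_dir[OF K]])
  have "f_fun K d \<le> (\<Sum>x\<in>tverts K. \<Sum>y\<in>tverts K. ?w x * 1 * ?w y)"
    unfolding f_fun_def type_form_def type_matrix_eq_miss
    by (intro sum_mono mult_right_mono mult_left_mono miss_bounds(2)[OF dv]) auto
  also have "\<dots> = 1" using weightings_sum[OF w] by simp
  finally show "\<beta> d \<le> 1" using \<beta>_le[OF dv K] by simp
qed

text \<open>Distance and limit both lie between 0 and 1, so the exceptional event contributes no
  more than its probability.\<close>

lemma expectation_tendsto:
  assumes dv: "density_vector P d"
  shows "(\<lambda>n. measure_pmf.expectation (random_digraph n d) (\<lambda>G. dist_prop G \<H>)) \<longlonglongrightarrow> \<beta> d"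
proof (rule tendstoI)
  fix e :: real assume e: "e > 0"
  have "\<forall>\<^sub>F n in sequentially. measure_pmf.prob (random_digraph n d) {G. \<bar>dist_prop G \<H> - \<beta> d\<bar> \<le> e / 2} > 1 - e / 2"
    by (rule order_tendstoD(1)[OF prob_close[OF dv]]) (use e in auto)
  then show "\<forall>\<^sub>F n in sequentially. dist (measure_pmf.expectation (random_digraph n d) (\<lambda>G. dist_prop G \<H>)) (\<beta> d) < e"
  proof (rule eventually_mono)
    fix n
    let ?M = "random_digraph n d" and ?S = "{G. \<bar>dist_prop G \<H> - \<beta> d\<bar> \<le> e / 2}"
    assume pr: "measure_pmf.prob ?M ?S > 1 - e / 2"
    have int: "integrable (measure_pmf ?M) f" for f :: "digraph \<Rightarrow> real"
      by (rule integrable_measure_pmf_finite[OF finite_set_pmf_random_digraph])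
    have "\<bar>measure_pmf.expectation ?M (\<lambda>G. dist_prop G \<H>) - \<beta> d\<bar> = \<bar>measure_pmf.expectation ?M (\<lambda>G. dist_prop G \<H> - \<beta> d)\<bar>"
      by (subst Bochner_Integration.integral_diff[OF int int]) simp
    also have "\<dots> \<le> measure_pmf.expectation ?M (\<lambda>G. \<bar>dist_prop G \<H> - \<beta> d\<bar>)"
      by (rule integral_abs_bound)
    also have "\<dots> \<le> measure_pmf.expectation ?M (\<lambda>G. e / 2 + indicator (- ?S) G)"
    proof (rule integral_mono_AE[OF int int])
      show "AE G in measure_pmf ?M. \<bar>dist_prop G \<H> - \<beta> d\<bar> \<le> e / 2 + indicator (- ?S) G"
      proof (rule AE_pmfI)
        fix G assume "G \<in> set_pmf ?M"
        then have "finite (verts G)" using set_pmf_random_digraph[OF P dv] by simp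
        from dist_prop_bounds[OF this] \<beta>_bounds[OF dv] have "\<bar>dist_prop G \<H> - \<beta> d\<bar> \<le> 1"
          by (simp add: abs_le_iff)
        then show "\<bar>dist_prop G \<H> - \<beta> d\<bar> \<le> e / 2 + indicator (- ?S) G"
          using e by (auto simp: indicator_def)
      qed
    qed
    also have "\<dots> = e / 2 + measure_pmf.prob ?M (- ?S)"
      by (subst Bochner_Integration.integral_add[OF int int]) simp
    also have "measure_pmf.prob ?M (- ?S) = 1 - measure_pmf.prob ?M ?S"
      using measure_pmf.prob_compl[of ?S ?M] by (simp add: Compl_eq_Diff_UNIV)
    finally show "dist (measure_pmf.expectation ?M (\<lambda>G. dist_prop G \<H>)) (\<beta> d) < e"
      using pr by (simp add: dist_real_def)
  qed
qed

end


section \<open>Convexity and compactness of the set of density vectors\<close>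

lemma density_vector_affine:
  assumes "density_vector P x" "density_vector P y" "0 \<le> u" "0 \<le> v" "u + v = 1"
  shows "density_vector P (u *\<^sub>R x + v *\<^sub>R y)"
proof -
  obtain p q where x: "x = (p, q)" by (cases x)
  obtain p' q' where y: "y = (p', q')" by (cases y)
  have pq: "0 \<le> p" "0 \<le> q" "p + 2 * q \<le> 1" "0 \<le> p'" "0 \<le> q'" "p' + 2 * q' \<le> 1"
    "P = palette_compl \<Longrightarrow> p + 2 * q = 1 \<and> p' + 2 * q' = 1"
    "P = palette_orien \<Longrightarrow> p = 0 \<and> p' = 0"
    "P = palette_undir \<Longrightarrow> q = 0 \<and> q' = 0"
    "P = palette_tourn \<Longrightarrow> p = 0 \<and> q = 1 / 2 \<and> p' = 0 \<and> q' = 1 / 2"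
    using assms(1,2) by (simp_all add: density_vector_def x y)
  have eq: "u * p + v * p' + 2 * (u * q + v * q') = u * (p + 2 * q) + v * (p' + 2 * q')"
    by (simp add: algebra_simps)
  show ?thesis
    unfolding density_vector_def x y scaleR_Pair add_Pair prod.case real_scaleR_def
  proof (intro conjI impI)
    show "0 \<le> u * p + v * p'" "0 \<le> u * q + v * q'" using pq(1,2,4,5) assms(3,4) by simp_all
    have "u * (p + 2 * q) + v * (p' + 2 * q') \<le> u * 1 + v * 1"
      using pq(3,6) assms(3,4) by (intro add_mono mult_left_mono)
    then show "u * p + v * p' + 2 * (u * q + v * q') \<le> 1" unfolding eq using assms(5) by simp
    show "u * p + v * p' + 2 * (u * q + v * q') = 1" if "P = palette_compl"
      unfolding eq using pq(7)[OF that] assms(5) by simp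
    show "u * q + v * q' = 1 / 2" if "P = palette_tourn"
    proof -
      have q: "q = 1 / 2" "q' = 1 / 2" using pq(10)[OF that] by blast+
      have "u * q + v * q' = (u + v) / 2" unfolding q by (simp add: add_divide_distrib)
      then show ?thesis using assms(5) by simp
    qed
  qed (use pq(8-10) in simp_all)
qed

lemma compact_density_vectors: "compact {d. density_vector P d}"
proof -
  have "closed {d. density_vector P d}"
    unfolding density_vector_def split_def
    by (intro closed_Collect_conj closed_Collect_imp closed_Collect_le closed_Collect_eq open_Collect_const continuous_intros)
  moreover have "{d. density_vector P d} \<subseteq> cbox (0, 0) (1, 1)"
    by (auto simp: density_vector_def cbox_Pair_eq)
  ultimately show ?thesis
    by (metis bounded_subset bounded_cbox compact_eq_bounded_closed)
qed

lemma density_vector_exists: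
  assumes "P \<in> palettes" shows "\<exists>d. density_vector P d"
proof -
  \<comment> \<open>Directed pairs only: this fits every palette but the undirected one, which gets
    non-arcs only.\<close>
  have "density_vector P (if P = palette_undir then (0, 0) else (0, 1 / 2))"
    using assms by (auto simp: density_vector_def palette_compl_def palette_orien_def
        palette_undir_def palette_tourn_def)
  then show ?thesis by blast
qed

lemma arc_count_eq_up_pairs:
  assumes "verts G = {..<n}"
  shows "arc_count G c = card {(i, j). i < j \<and> j < n \<and> col G i j = c}"
  unfolding arc_count_def assms by (rule arg_cong[where f = card]) auto

section \<open>Digraphs with prescribed colour counts\<close>

context hereditary_property
begin

definition prescribed :: "color \<Rightarrow> real \<times> real \<Rightarrow> nat \<Rightarrow> digraph set" where
  "prescribed c0 d n = {G. is_digraph P G \<and> verts G = {..<n} \<and>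
     (\<forall>c\<in>P - {c0}. int (card {(i, j). i < j \<and> j < n \<and> col G i j = c}) = \<lfloor>color_prob d c * real (n choose 2)\<rfloor>)}"

lemma dist_dens_eq: "dist_dens P c0 \<H> d n = Max ((\<lambda>G. dist_prop G \<H>) ` prescribed c0 d n)"
  unfolding dist_dens_def prescribed_def by (rule arg_cong[where f = Max]) blast

lemma finite_prescribed: "finite ((\<lambda>G. dist_prop G \<H>) ` prescribed c0 d n)"
  by (rule finite_subset[OF _ finite_dist_props[of n "\<lambda>_. True"]]) (auto simp: prescribed_def)

text \<open>At most three other colours lose less than one pair each by rounding down, and
  \<open>c0\<close> receives what they lose.\<close>

lemma prescribed_count_le:
  assumes dv: "density_vector P d" and G: "G \<in> prescribed c0 d n"
  shows "real (arc_count G c) \<le> color_prob d c * real (n choose 2) + 3"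
proof -
  define N where "N = real (n choose 2)"
  have G': "is_digraph P G" "verts G = {..<n}" using G by (auto simp: prescribed_def)
  have fl: "int (arc_count G c) = \<lfloor>color_prob d c * N\<rfloor>" if "c \<in> P - {c0}" for c
    using G that unfolding N_def arc_count_eq_up_pairs[OF G'(2)] by (simp add: prescribed_def)
  have up: "real (arc_count G c) \<le> color_prob d c * N" if "c \<in> P - {c0}" for c
    using fl[OF that] by linarith
  have out: "arc_count G c = 0" if "c \<notin> P" for c
  proof -
    have "{(v, w). v \<in> verts G \<and> w \<in> verts G \<and> v < w \<and> col G v w = c} = {}"
      using G'(1) that unfolding is_digraph_def by fastforce
    then show ?thesis unfolding arc_count_def by (rule ssubst) simp
  qed
  have lo: "color_prob d c * N - 1 \<le> real (arc_count G c)" if "c \<noteq> c0" for c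
  proof (cases "c \<in> P")
    case True
    then show ?thesis using fl[of c] that by simp linarith
  next
    case False
    then show ?thesis using color_prob_outside[OF P dv] by simp
  qed
  show ?thesis
  proof (cases "c = c0")
    case True
    have "(\<Sum>x\<in>UNIV - {c0}. color_prob d x * N - 1) \<le> (\<Sum>x\<in>UNIV - {c0}. real (arc_count G x))"
      using lo by (intro sum_mono) auto
    moreover have "(\<Sum>x\<in>UNIV - {c0}. color_prob d x * N - 1) = (\<Sum>x\<in>UNIV - {c0}. color_prob d x) * N - 3"
      by (simp add: sum_subtractf sum_distrib_right card_UNIV_color)
    moreover have "(\<Sum>x\<in>UNIV. real (arc_count G x)) = N"
      using sum_arc_count_UNIV[of G] G'(2) by (simp add: N_def)
    moreover have "(\<Sum>x\<in>UNIV - {c0}. color_prob d x) = 1 - color_prob d c0"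
      using sum.remove[of UNIV c0 "color_prob d"] sum_color_prob[of d] by simp
    ultimately have "real (arc_count G c0) \<le> N - ((1 - color_prob d c0) * N - 3)"
      using sum.remove[of UNIV c0 "\<lambda>x. real (arc_count G x)"] by simp
    then show ?thesis by (simp add: True N_def algebra_simps)
  next
    case False
    show ?thesis
    proof (cases "c \<in> P")
      case True
      then show ?thesis using up[of c] False by (simp add: N_def)
    next
      case nP: False
      then show ?thesis using out[OF nP] color_prob_outside[OF P dv nP] by simp
    qed
  qed
qed

text \<open>\<open>recolour_counts\<close> changes no more pairs than the total surplus. This is at
  most \<open>\<delta> + 1\<close> for each of four colours, the 1 coming from the floor, and every
  changed pair appears in two orders; hence 8.\<close>

lemma ex_prescribed_near:
  assumes dv: "density_vector P d" and c0: "c0 \<in> P" and G: "is_digraph P G" "verts G = {..<n}"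
    and le: "\<And>c. real (arc_count G c) \<le> color_prob d c * real (n choose 2) + \<delta>" and \<delta>: "\<delta> \<ge> 0"
  shows "\<exists>G'\<in>prescribed c0 d n. real (card {(x, y). x < n \<and> y < n \<and> x \<noteq> y \<and> col G x y \<noteq> col G' x y}) \<le> 8 * (\<delta> + 1)"
proof -
  define N where "N = real (n choose 2)"
  let ?E = "up_pairs n"
  define b0 where "b0 c = (if c \<in> P - {c0} then nat \<lfloor>color_prob d c * N\<rfloor> else 0)" for c
  define b where "b c = (if c = c0 then (n choose 2) - (\<Sum>x\<in>UNIV - {c0}. b0 x) else b0 c)" for c
  have b0le: "real (b0 c) \<le> color_prob d c * N" for c
    using color_prob_nonneg[OF dv, of c] by (auto simp: b0_def N_def)
  have "real (\<Sum>x\<in>UNIV - {c0}. b0 x) \<le> (\<Sum>x\<in>UNIV - {c0}. color_prob d x * N)"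
    unfolding of_nat_sum by (intro sum_mono b0le)
  also have "\<dots> = (1 - color_prob d c0) * N"
    using sum.remove[of UNIV c0 "color_prob d"] sum_color_prob[of d] by (simp flip: sum_distrib_right)
  finally have s: "real (\<Sum>x\<in>UNIV - {c0}. b0 x) \<le> (1 - color_prob d c0) * N" .
  also have "\<dots> \<le> 1 * N" using color_prob_nonneg[OF dv, of c0] by (intro mult_right_mono) (auto simp: N_def)
  finally have "real (\<Sum>x\<in>UNIV - {c0}. b0 x) \<le> real (n choose 2)" by (simp only: N_def mult_1)
  then have s1: "(\<Sum>x\<in>UNIV - {c0}. b0 x) \<le> n choose 2" by (simp only: of_nat_le_iff)
  have "(\<Sum>c\<in>UNIV. b c) = b c0 + (\<Sum>c\<in>UNIV - {c0}. b c)" by (simp add: sum.remove)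
  also have "(\<Sum>c\<in>UNIV - {c0}. b c) = (\<Sum>c\<in>UNIV - {c0}. b0 c)" by (rule sum.cong) (auto simp: b_def)
  finally have sb: "(\<Sum>c\<in>UNIV. b c) = card ?E" using s1 by (simp add: b_def card_up_pairs)
  have blo: "color_prob d c * N - 1 \<le> real (b c)" for c
  proof (cases "c = c0")
    case True
    have "real (b c0) = N - real (\<Sum>x\<in>UNIV - {c0}. b0 x)" by (simp add: b_def N_def of_nat_diff[OF s1] del: of_nat_sum)
    then show ?thesis using s True by (simp add: algebra_simps)
  next
    case False
    show ?thesis
    proof (cases "c \<in> P")
      case True
      then show ?thesis
        using False color_prob_nonneg[OF dv, of c] by (auto simp: b_def b0_def N_def; linarith)
    next
      case nP: False
      then show ?thesis by (simp add: color_prob_outside[OF P dv nP])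
    qed
  qed
  define f where "f = (\<lambda>(i, j). col G i j)"
  have cf: "card {e \<in> ?E. f e = c} = arc_count G c" for c
    unfolding arc_count_eq_up_pairs[OF G(2)] by (rule arg_cong[where f = card]) (auto simp: f_def up_pairs_def)
  obtain g where g: "\<And>c. card {e \<in> ?E. g e = c} = b c"
    and ch: "card {e \<in> ?E. f e \<noteq> g e} \<le> (\<Sum>c\<in>UNIV. arc_count G c - b c)"
    using recolour_counts[OF finite_up_pairs sb, of f] unfolding cf by blast
  define G' where "G' = mk_digraph n g"
  have vG': "verts G' = {..<n}" by (simp add: G'_def mk_digraph_def)
  have gP: "g e \<in> P" if "e \<in> ?E" for e
  proof (rule ccontr)
    assume "g e \<notin> P"
    then have "b (g e) = 0" using c0 by (auto simp: b_def b0_def)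
    then have "{x \<in> ?E. g x = g e} = {}" using g[of "g e"] by simp
    then show False using that by blast
  qed
  have dG': "is_digraph P G'"
  proof (rule is_digraphI)
    fix v w assume "v \<in> verts G'" "w \<in> verts G'" "v \<noteq> w"
    then have vw: "v < n" "w < n" "v \<noteq> w" using vG' by auto
    show "col G' v w \<in> P"
      using vw gP[of "(v, w)"] gP[of "(w, v)"] palettes_rev[OF P] by (auto simp: G'_def mk_digraph_def up_pairs_def)
    show "col G' w v = rev_color (col G' v w)" using vw by (auto simp: G'_def mk_digraph_def)
  qed (simp add: vG')
  have cG': "card {(i, j). i < j \<and> j < n \<and> col G' i j = c} = b c" for c
    unfolding g[symmetric] by (rule arg_cong[where f = card]) (auto simp: G'_def mk_digraph_def up_pairs_def)
  have pres: "G' \<in> prescribed c0 d n"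
    unfolding prescribed_def
  proof (intro CollectI conjI ballI dG' vG')
    fix c assume "c \<in> P - {c0}"
    then show "int (card {(i, j). i < j \<and> j < n \<and> col G' i j = c}) = \<lfloor>color_prob d c * real (n choose 2)\<rfloor>"
      using color_prob_nonneg[OF dv, of c] by (simp add: cG' b_def b0_def N_def)
  qed
  have "real (card {e \<in> ?E. f e \<noteq> g e}) \<le> (\<Sum>c\<in>UNIV. real (arc_count G c - b c))"
    using ch by (metis of_nat_le_iff of_nat_sum)
  also have "\<dots> \<le> (\<Sum>c\<in>(UNIV :: color set). \<delta> + 1)"
  proof (rule sum_mono)
    fix c
    show "real (arc_count G c - b c) \<le> \<delta> + 1"
      using le[of c] blo[of c] \<delta> by (cases "arc_count G c \<le> b c") (auto simp: N_def of_nat_diff)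
  qed
  finally have c4: "real (card {e \<in> ?E. f e \<noteq> g e}) \<le> 4 * (\<delta> + 1)" by (simp add: card_UNIV_color)
  have sym: "col G w v \<noteq> col G' w v" if "v \<in> {..<n}" "w \<in> {..<n}" "v \<noteq> w \<and> col G v w \<noteq> col G' v w" for v w
    using that digraph_rev[OF G(1), of v w] digraph_rev[OF dG', of v w] G(2) vG' by (metis rev_color_rev_color)
  have "card {(x, y). x \<in> {..<n} \<and> y \<in> {..<n} \<and> x \<noteq> y \<and> (x \<noteq> y \<and> col G x y \<noteq> col G' x y)}
    = 2 * card {(x, y). x \<in> {..<n} \<and> y \<in> {..<n} \<and> x < y \<and> (x \<noteq> y \<and> col G x y \<noteq> col G' x y)}"
    by (rule card_ordered_pairs(2)) (use sym in auto)
  also have "{(x, y). x \<in> {..<n} \<and> y \<in> {..<n} \<and> x < y \<and> (x \<noteq> y \<and> col G x y \<noteq> col G' x y)} = {e \<in> ?E. f e \<noteq> g e}"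
    by (auto simp: up_pairs_def f_def G'_def mk_digraph_def)
  also have "{(x, y). x \<in> {..<n} \<and> y \<in> {..<n} \<and> x \<noteq> y \<and> (x \<noteq> y \<and> col G x y \<noteq> col G' x y)}
    = {(x, y). x < n \<and> y < n \<and> x \<noteq> y \<and> col G x y \<noteq> col G' x y}" by auto
  finally show ?thesis using pres c4 by (intro bexI[of _ G']) auto
qed

lemma quasirandom_perturb:
  assumes "quasirandom \<kappa> d n G" and ch: "real (card {(x, y). x < n \<and> y < n \<and> x \<noteq> y \<and> col G x y \<noteq> col G' x y}) \<le> \<delta> * real n ^ 2"
  shows "quasirandom (\<kappa> + \<delta>) d n G'"
  unfolding quasirandom_def
proof (intro allI impI)
  fix A B c assume AB: "A \<subseteq> {..<n}" "B \<subseteq> {..<n}"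
  let ?S = "\<lambda>G. {(x, y). x \<in> A \<and> y \<in> B \<and> x \<noteq> y \<and> col G x y = c}"
  let ?D = "{(x, y). x < n \<and> y < n \<and> x \<noteq> y \<and> col G x y \<noteq> col G' x y}"
  have fin: "finite (?S G)" "finite ?D"
    by (rule finite_subset[of _ "{..<n} \<times> {..<n}"]; use AB in auto)+
  have "?S G' \<subseteq> ?S G \<union> ?D" using AB by auto
  then have "card (?S G') \<le> card (?S G) + card ?D"
    using card_mono[of "?S G \<union> ?D" "?S G'"] card_Un_le[of "?S G" ?D] fin by simp
  then have "real (card (?S G')) \<le> real (card (?S G)) + real (card ?D)" by linarith
  also have "real (card (?S G)) \<le> color_prob d c * (real (card A) * real (card B)) + \<kappa> * real n ^ 2"
    using assms(1) AB unfolding quasirandom_def by blast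
  finally show "real (card (?S G')) \<le> color_prob d c * (real (card A) * real (card B)) + (\<kappa> + \<delta>) * real n ^ 2"
    using ch by (simp add: algebra_simps)
qed

text \<open>Upper bound: prescribed counts force the densities to tend to \<open>d\<close>, and
  \<open>\<beta>\<close> is Lipschitz. Lower bound: a typical digraph is recoloured on few pairs
  until its counts are the prescribed ones, which hardly affects its quasirandomness.\<close>

lemma dist_dens_tendsto:
  assumes dv: "density_vector P d" and c0: "c0 \<in> P"
  shows "(\<lambda>n. dist_dens P c0 \<H> d n) \<longlonglongrightarrow> \<beta> d"
proof (rule tendstoI)
  fix e :: real assume e: "e > 0"
  obtain \<kappa> n0 where \<kappa>: "\<kappa> > 0" and low: "\<And>n G. n \<ge> n0 \<Longrightarrow> is_digraph P G \<Longrightarrow> verts G = {..<n} \<Longrightarrow>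
      quasirandom \<kappa> d n G \<Longrightarrow> \<beta> d - e / 2 \<le> dist_prop G \<H>"
    using dist_prop_ge[OF dv, of "e / 2"] e by (metis half_gt_zero)
  \<comment> \<open>Recolouring affects at most \<open>8 * (\<kappa>' * real n ^ 2 + 1)\<close>
    ordered pairs, at most \<open>9 * \<kappa>' * real n ^ 2\<close> once
    \<open>real n \<ge> 8 / \<kappa>'\<close>; with the original \<open>\<kappa>'\<close> this makes
    ten parts.\<close>
  define \<kappa>' where "\<kappa>' = \<kappa> / 10"
  have \<kappa>': "\<kappa>' > 0" using \<kappa> by (simp add: \<kappa>'_def)
  \<comment> \<open>The rounding error 3 gives a density error of 24 divided by
    \<open>n choose 2\<close>. It is at most \<open>e / 2\<close> once
    \<open>e * real (n choose 2) \<ge> 48\<close>, and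
    \<open>real n ^ 2 \<le> 4 * real (n choose 2)\<close> turns 48 into 192.\<close>
  have big: "\<forall>\<^sub>F n in sequentially. real n \<ge> 8 / \<kappa>'" "\<forall>\<^sub>F n in sequentially. real n > 192 / e"
    using filterlim_real_sequentially[unfolded filterlim_at_top]
      filterlim_real_sequentially[unfolded filterlim_at_top_dense] by blast+
  show "\<forall>\<^sub>F n in sequentially. dist (dist_dens P c0 \<H> d n) (\<beta> d) < e"
    using typical_exists[OF dv \<kappa>'] big eventually_ge_at_top[of n0] eventually_ge_at_top[of 2]
  proof eventually_elim
    case (elim n)
    then obtain G where G: "is_digraph P G" "verts G = {..<n}" "typical \<kappa>' d n G" by blast
    have n1: "real n \<le> real n ^ 2" using elim by (simp add: power2_eq_square)
    obtain G' where G': "G' \<in> prescribed c0 d n"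
      and ch: "real (card {(x, y). x < n \<and> y < n \<and> x \<noteq> y \<and> col G x y \<noteq> col G' x y}) \<le> 8 * (\<kappa>' * real n ^ 2 + 1)"
      using ex_prescribed_near[OF dv c0 G(1,2), of "\<kappa>' * real n ^ 2"] G(3) \<kappa>' by (auto simp: typical_def)
    have "8 \<le> \<kappa>' * real n" using elim(2) \<kappa>' by (simp add: pos_divide_le_eq mult.commute)
    also have "\<dots> \<le> \<kappa>' * real n ^ 2" using n1 \<kappa>' by (intro mult_left_mono) auto
    finally have "8 * (\<kappa>' * real n ^ 2 + 1) \<le> (9 * \<kappa>') * real n ^ 2" by simp
    with ch have "quasirandom (\<kappa>' + 9 * \<kappa>') d n G'"
      by (intro quasirandom_perturb[OF typical_imp_quasirandom[OF G(3)]]) simp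
    then have "quasirandom \<kappa> d n G'" by (simp add: \<kappa>'_def)
    then have lo: "\<beta> d - e / 2 \<le> dist_prop G' \<H>" using low[of n G'] G' elim by (simp add: prescribed_def)
    have N: "real (n choose 2) > 0" using elim by (simp add: zero_less_binomial)
    have up: "dist_prop H \<H> \<le> \<beta> d + e / 2" if H: "H \<in> prescribed c0 d n" for H
    proof -
      have H': "is_digraph P H" "card (verts H) = n" using H by (auto simp: prescribed_def)
      have "prob_diff (arc_density H) d \<le> 8 * (3 / real (n choose 2))"
        by (rule arc_density_close[OF H']) (use prescribed_count_le[OF dv H] N elim in auto)
      also have "\<dots> \<le> e / 2"
      proof -
        have "192 < e * real n" using elim e by (simp add: pos_divide_less_eq mult.commute)
        also have "\<dots> \<le> e * real n ^ 2" using n1 e by (intro mult_left_mono) auto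
        also have "\<dots> \<le> e * (4 * real (n choose 2))"
          using half_square_le_choose[of n] elim e by (intro mult_left_mono) auto
        finally have "48 \<le> e * real (n choose 2)" by simp
        then show ?thesis using N by (simp add: pos_divide_le_eq)
      qed
      finally have pd: "prob_diff (arc_density H) d \<le> e / 2" .
      have "dist_prop H \<H> \<le> \<beta> (arc_density H)" using dist_prop_le_\<beta>[OF H'(1)] H' elim by simp
      also have "\<dots> \<le> \<beta> d + prob_diff (arc_density H) d"
        by (rule \<beta>_diff[OF density_vector_arc_density[OF P H'(1)] dv]) (use H' elim in simp)
      finally show ?thesis using pd by simp
    qed
    have "dist_dens P c0 \<H> d n \<le> \<beta> d + e / 2"
      unfolding dist_dens_eq using up G' by (subst Max_le_iff[OF finite_prescribed]) auto
    moreover have "dist_prop G' \<H> \<le> dist_dens P c0 \<H> d n"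
      unfolding dist_dens_eq using G' by (intro Max_ge[OF finite_prescribed]) auto
    ultimately show ?case using lo e by (simp add: dist_real_def abs_less_iff)
  qed
qed

section \<open>Continuity, concavity and the maximum\<close>

lemma prob_diff_le_dist: "prob_diff d d' \<le> 10 * dist d d'"
proof -
  obtain p q p' q' where dd: "d = (p, q)" "d' = (p', q')" by (cases d; cases d')
  have 1: "\<bar>p - p'\<bar> \<le> dist d d'" using dist_fst_le[of d d'] by (simp add: dd dist_real_def)
  have 2: "\<bar>q - q'\<bar> \<le> dist d d'" using dist_snd_le[of d d'] by (simp add: dd dist_real_def)
  have "prob_diff d d' \<le> 2 * \<bar>p - p'\<bar> + 4 * \<bar>q - q'\<bar>"
    unfolding prob_diff_def UNIV_color dd by (simp add: abs_if)
  also have "\<dots> \<le> 2 * dist d d' + 4 * dist d d'" by (intro add_mono mult_left_mono 1 2) simp_all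
  also have "\<dots> \<le> 10 * dist d d'" by simp
  finally show ?thesis .
qed

lemma continuous_on_\<beta>: "continuous_on {d. density_vector P d} \<beta>"
  unfolding continuous_on_iff
proof (intro ballI allI impI)
  fix d and e :: real assume d: "d \<in> {d. density_vector P d}" and e: "0 < e"
  show "\<exists>\<delta>>0. \<forall>d'\<in>{d. density_vector P d}. dist d' d < \<delta> \<longrightarrow> dist (\<beta> d') (\<beta> d) < e"
  proof (intro exI[of _ "e / 10"] conjI ballI impI)
    fix d' assume d': "d' \<in> {d. density_vector P d}" "dist d' d < e / 10"
    have "\<beta> d' \<le> \<beta> d + prob_diff d' d" "\<beta> d \<le> \<beta> d' + prob_diff d d'"
      using \<beta>_diff d d' by auto
    moreover have "prob_diff d' d < e" "prob_diff d d' < e"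
      using prob_diff_le_dist[of d' d] prob_diff_le_dist[of d d'] d'(2) by (auto simp: dist_commute)
    ultimately show "dist (\<beta> d') (\<beta> d) < e" by (simp add: dist_real_def abs_less_iff)
  qed (use e in simp)
qed

lemma \<beta>_concave:
  assumes "density_vector P x" "density_vector P y" "0 \<le> u" "0 \<le> v" "u + v = 1"
  shows "u * \<beta> x + v * \<beta> y \<le> \<beta> (u *\<^sub>R x + v *\<^sub>R y)"
proof (rule \<beta>_greatest[OF density_vector_affine[OF assms]])
  fix K assume K: "K \<in> type_family P F"
  show "u * \<beta> x + v * \<beta> y \<le> f_fun K (u *\<^sub>R x + v *\<^sub>R y)"
    unfolding f_fun_affine[OF assms(5)]
    using \<beta>_le[OF assms(1) K] \<beta>_le[OF assms(2) K] assms(3,4) by (intro add_mono mult_left_mono) auto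
qed

lemma concave_on_\<beta>: "concave_on {d. density_vector P d} \<beta>"
  unfolding concave_on_def convex_on_def convex_def
proof (intro conjI ballI allI impI)
  fix x y and u v :: real
  assume xy: "x \<in> {d. density_vector P d}" "y \<in> {d. density_vector P d}" and uv: "0 \<le> u" "0 \<le> v" "u + v = 1"
  show "u *\<^sub>R x + v *\<^sub>R y \<in> {d. density_vector P d}" using density_vector_affine[OF _ _ uv] xy by blast
  have "u * \<beta> x + v * \<beta> y \<le> \<beta> (u *\<^sub>R x + v *\<^sub>R y)" using \<beta>_concave[OF _ _ uv] xy by blast
  then show "- \<beta> (u *\<^sub>R x + v *\<^sub>R y) \<le> u * - \<beta> x + v * - \<beta> y" by simp
qed

text \<open>Every digraph is measured at its own densities, where \<open>\<beta>\<close> is at most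
  \<open>\<beta> dm\<close>, so the upper bound is exact for every order from 2 on. Typical digraphs
  for \<open>dm\<close> come arbitrarily close to it.\<close>

lemma max_dist_tendsto:
  assumes dm: "density_vector P dm" and mx: "\<And>d. density_vector P d \<Longrightarrow> \<beta> d \<le> \<beta> dm"
  shows "(\<lambda>n. max_dist P \<H> n) \<longlonglongrightarrow> \<beta> dm"
proof (rule tendstoI)
  fix e :: real assume e: "e > 0"
  obtain \<kappa> where \<kappa>: "\<kappa> > 0" and close: "\<forall>\<^sub>F n in sequentially. \<forall>G. is_digraph P G \<longrightarrow> verts G = {..<n} \<longrightarrow> typical \<kappa> dm n G \<longrightarrow>
    prob_diff (arc_density G) dm \<le> e / 2 \<and> \<bar>dist_prop G \<H> - \<beta> dm\<bar> \<le> e / 2"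
    using typical_close[OF dm, of "e / 2"] e by auto
  show "\<forall>\<^sub>F n in sequentially. dist (max_dist P \<H> n) (\<beta> dm) < e"
    using close typical_exists[OF dm \<kappa>] eventually_ge_at_top[of 2]
  proof eventually_elim
    case (elim n)
    let ?S = "{dist_prop G \<H> |G. is_digraph P G \<and> card (verts G) = n}"
    obtain G where G: "is_digraph P G" "verts G = {..<n}" "\<bar>dist_prop G \<H> - \<beta> dm\<bar> \<le> e / 2"
      using elim by blast
    have fin: "finite ?S"
      by (rule finite_subset[OF _ finite_dist_props[of n "\<lambda>_. True"]]) (auto simp: is_digraph_def)
    have mem: "dist_prop G \<H> \<in> ?S" using G by auto
    have "dist_prop H \<H> \<le> \<beta> dm" if "is_digraph P H" "card (verts H) = n" for H
      using dist_prop_le_\<beta>[of H] mx[OF density_vector_arc_density[OF P, of H]] that elim by fastforce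
    then have "max_dist P \<H> n \<le> \<beta> dm"
      unfolding max_dist_def using mem by (subst Max_le_iff[OF fin]) auto
    moreover have "dist_prop G \<H> \<le> max_dist P \<H> n"
      unfolding max_dist_def by (rule Max_ge[OF fin mem])
    ultimately show ?case using G(3) e by (simp add: dist_real_def abs_less_iff abs_le_iff)
  qed
qed

lemma \<beta>_attains_max: "\<exists>dm. density_vector P dm \<and> (\<forall>d. density_vector P d \<longrightarrow> \<beta> d \<le> \<beta> dm)"
proof -
  have "{d. density_vector P d} \<noteq> {}" using density_vector_exists[OF P] by blast
  from continuous_attains_sup[OF compact_density_vectors this continuous_on_\<beta>] show ?thesis
    by auto
qed

end

subsection \<open>Free coordinates of density vectors\<close>

lemma palette_dim_simps:
  "palette_dim palette_all = 3" "palette_dim palette_compl = 2" "palette_dim palette_orien = 2"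
  "palette_dim palette_undir = 2" "palette_dim palette_tourn = 1"
  by (simp_all add: palette_dim_def palette_all_def palette_compl_def palette_orien_def
      palette_undir_def palette_tourn_def)

lemma palette_distinct:
  "palette_compl \<noteq> palette_all" "palette_orien \<noteq> palette_all" "palette_undir \<noteq> palette_all" "palette_tourn \<noteq> palette_all"
  "palette_orien \<noteq> palette_compl" "palette_orien \<noteq> palette_undir" "palette_tourn \<noteq> palette_compl" "palette_tourn \<noteq> palette_undir"
  "palette_tourn \<noteq> palette_orien" "palette_undir \<noteq> palette_compl"
  by (auto simp: palette_all_def palette_compl_def palette_orien_def palette_undir_def palette_tourn_def)

text \<open>Each free coordinate is one of the two projections, which spares later arguments the
  case distinction on the palette.\<close>

lemma free_coord:
  assumes "P \<in> palettes" "i < palette_dim P - 1"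
  shows "(\<forall>d. free_coord_list P d ! i = fst d) \<or> (\<forall>d. free_coord_list P d ! i = snd d)"
  using assms unfolding palettes_def
  by (elim insertE) (auto simp: free_coord_list_def palette_dim_simps palette_distinct less_Suc_eq numeral_3_eq_3 numeral_2_eq_2)

lemma free_coords_affine:
  assumes "P \<in> palettes" and "u + v = (1 :: real)"
  shows "(\<lambda>i\<in>{..<palette_dim P - 1}. u * free_coords P x i + v * free_coords P y i) = free_coords P (u *\<^sub>R x + v *\<^sub>R y)"
proof
  fix i
  show "(\<lambda>i\<in>{..<palette_dim P - 1}. u * free_coords P x i + v * free_coords P y i) i = free_coords P (u *\<^sub>R x + v *\<^sub>R y) i"
  proof (cases "i < palette_dim P - 1")
    case True
    from free_coord[OF assms(1) True] show ?thesis
    proof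
      assume h: "\<forall>d. free_coord_list P d ! i = fst d"
      show ?thesis unfolding free_coords_def using True by (simp add: h[rule_format])
    next
      assume h: "\<forall>d. free_coord_list P d ! i = snd d"
      show ?thesis unfolding free_coords_def using True by (simp add: h[rule_format])
    qed
  qed (simp add: free_coords_def)
qed

lemma free_coords_in_cube:
  assumes P: "P \<in> palettes" and "density_vector P d"
  shows "free_coords P d \<in> real_cube (palette_dim P - 1)"
proof -
  have "fst d \<in> {0..1}" "snd d \<in> {0..1}" using assms(2) by (auto simp: density_vector_def split: prod.splits)
  then have "free_coord_list P d ! i \<in> {0..1}" if "i < palette_dim P - 1" for i
    using free_coord[OF P that] by metis
  then show ?thesis by (auto simp: real_cube_def free_coords_def)
qed

text \<open>The coordinate map is continuous, so the image of \<open>S\<close> is compact and hence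
  closed in the Hausdorff product space.\<close>

lemma closed_in_cube_free_coords:
  assumes P: "P \<in> palettes" and S: "compact S" "S \<subseteq> {d. density_vector P d}"
  shows "closed_in_cube (palette_dim P - 1) (free_coords P ` S)"
proof -
  let ?m = "palette_dim P - 1"
  let ?T = "product_topology (\<lambda>_. euclideanreal) {..<?m}"
  have "continuous_map euclidean ?T (free_coords P)"
    unfolding continuous_map_componentwise
  proof (intro conjI ballI)
    show "free_coords P ` topspace euclidean \<subseteq> extensional {..<?m}" by (auto simp: free_coords_def)
    fix i assume "i \<in> {..<?m}"
    then have i: "i < ?m" by simp
    have "(\<lambda>d. free_coords P d i) = fst \<or> (\<lambda>d. free_coords P d i) = snd"
      using free_coord[OF P i] i by (auto simp: free_coords_def fun_eq_iff)
    then show "continuous_map euclidean euclideanreal (\<lambda>d. free_coords P d i)"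
      using continuous_on_fst[OF continuous_on_id] continuous_on_snd[OF continuous_on_id] by (elim disjE) simp_all
  qed
  moreover have "compactin euclidean S" using S(1) by simp
  ultimately have "compactin ?T (free_coords P ` S)" by (rule image_compactin[rotated])
  moreover have "Hausdorff_space ?T" by (simp add: Hausdorff_space_product_topology)
  ultimately have "closedin ?T (free_coords P ` S)" by (rule compactin_imp_closedin[rotated])
  moreover have "free_coords P ` S \<subseteq> real_cube ?m" using free_coords_in_cube[OF P] S(2) by auto
  ultimately show ?thesis
    unfolding closed_in_cube_def closedin_subtopology by blast
qed

theorem theorem23:
  fixes P :: "color set" and c\<^sub>0 :: color and \<H> F :: "digraph set" and d :: "real \<times> real"
  assumes "P \<in> palettes"
    and "c\<^sub>0 \<in> P"
    and "hereditary P \<H>"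
    and "\<And>n. \<exists>G\<in>\<H>. card (verts G) = n"
    and "forbidden_family P \<H> F"
    and "density_vector P d"
  shows "convergent (\<lambda>n. dist_dens P c\<^sub>0 \<H> d n)
    \<and> dist_dens_lim P c\<^sub>0 \<H> d = (INF K\<in>type_family P F. f_fun K d)
    \<and> dist_dens_lim P c\<^sub>0 \<H> d = (INF K\<in>type_family P F. g_fun K d)
    \<and> (\<forall>\<epsilon>>0. (\<lambda>n. measure_pmf.prob (random_digraph n d)
          {G. dist_dens_lim P c\<^sub>0 \<H> d - \<epsilon> \<le> dist_prop G \<H> \<and>
              dist_prop G \<H> \<le> dist_dens_lim P c\<^sub>0 \<H> d + \<epsilon>}) \<longlonglongrightarrow> 1)
    \<and> (\<lambda>n. measure_pmf.expectation (random_digraph n d) (\<lambda>G. dist_prop G \<H>))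
          \<longlonglongrightarrow> dist_dens_lim P c\<^sub>0 \<H> d
    \<and> continuous_on {d. density_vector P d} (dist_dens_lim P c\<^sub>0 \<H>)
    \<and> concave_on {d. density_vector P d} (dist_dens_lim P c\<^sub>0 \<H>)
    \<and> convergent (\<lambda>n. max_dist P \<H> n)
    \<and> (\<exists>d\<^sub>m\<in>maximizers P c\<^sub>0 \<H>.
          dist_dens_lim P c\<^sub>0 \<H> d\<^sub>m = dist_lim P \<H> \<and>
          (\<lambda>n. measure_pmf.expectation (random_digraph n d\<^sub>m) (\<lambda>G. dist_prop G \<H>))
            \<longlonglongrightarrow> dist_lim P \<H>)
    \<and> closed_in_cube (palette_dim P - 1) (free_coords P ` maximizers P c\<^sub>0 \<H>)
    \<and> convex_in_cube (palette_dim P - 1) (free_coords P ` maximizers P c\<^sub>0 \<H>)"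
proof -
  interpret hereditary_property P \<H> F
    by unfold_locales fact+
  note dv = \<open>density_vector P d\<close>
  have lim: "dist_dens_lim P c\<^sub>0 \<H> x = \<beta> x" if "density_vector P x" for x
    unfolding dist_dens_lim_def by (rule limI[OF dist_dens_tendsto[OF that assms(2)]])
  have 1: "convergent (\<lambda>n. dist_dens P c\<^sub>0 \<H> d n)"
    using dist_dens_tendsto[OF dv assms(2)] by (rule convergentI)
  have 2: "dist_dens_lim P c\<^sub>0 \<H> d = (INF K\<in>type_family P F. f_fun K d)"
    by (simp add: lim[OF dv] \<beta>_def)
  have 3: "dist_dens_lim P c\<^sub>0 \<H> d = (INF K\<in>type_family P F. g_fun K d)"
    by (simp add: lim[OF dv] \<beta>_eq_g_fun[OF dv])
  have "{G. \<beta> d - \<epsilon> \<le> dist_prop G \<H> \<and> dist_prop G \<H> \<le> \<beta> d + \<epsilon>} = {G. \<bar>dist_prop G \<H> - \<beta> d\<bar> \<le> \<epsilon>}" for \<epsilon>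
    by (auto simp: abs_le_iff)
  then have 4: "\<forall>\<epsilon>>0. (\<lambda>n. measure_pmf.prob (random_digraph n d)
          {G. dist_dens_lim P c\<^sub>0 \<H> d - \<epsilon> \<le> dist_prop G \<H> \<and>
              dist_prop G \<H> \<le> dist_dens_lim P c\<^sub>0 \<H> d + \<epsilon>}) \<longlonglongrightarrow> 1"
    using prob_close[OF dv] by (simp add: lim[OF dv])
  have 5: "(\<lambda>n. measure_pmf.expectation (random_digraph n d) (\<lambda>G. dist_prop G \<H>)) \<longlonglongrightarrow> dist_dens_lim P c\<^sub>0 \<H> d"
    using expectation_tendsto[OF dv] by (simp add: lim[OF dv])
  have 6: "continuous_on {d. density_vector P d} (dist_dens_lim P c\<^sub>0 \<H>)"
    using continuous_on_\<beta> by (rule continuous_on_eq) (simp add: lim)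
  have 7: "concave_on {d. density_vector P d} (dist_dens_lim P c\<^sub>0 \<H>)"
    using concave_on_\<beta> density_vector_affine unfolding concave_on_def convex_on_def by (auto simp: lim)
  obtain dm where dm: "density_vector P dm" "\<And>d. density_vector P d \<Longrightarrow> \<beta> d \<le> \<beta> dm"
    using \<beta>_attains_max by blast
  have mdt: "(\<lambda>n. max_dist P \<H> n) \<longlonglongrightarrow> \<beta> dm" by (rule max_dist_tendsto[OF dm])
  then have 8: "convergent (\<lambda>n. max_dist P \<H> n)" by (rule convergentI)
  have dl: "dist_lim P \<H> = \<beta> dm" unfolding dist_lim_def by (rule limI[OF mdt])
  \<comment> \<open>The maximizers form the superlevel set of \<open>\<beta>\<close> at its maximal
    value, so closedness follows from continuity and convexity from concavity.\<close>
  have mx: "maximizers P c\<^sub>0 \<H> = {x. density_vector P x \<and> \<beta> dm \<le> \<beta> x}"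
  proof (intro equalityI subsetI)
    fix x assume "x \<in> maximizers P c\<^sub>0 \<H>"
    then have x: "density_vector P x" "dist_dens_lim P c\<^sub>0 \<H> dm \<le> dist_dens_lim P c\<^sub>0 \<H> x"
      using dm(1) unfolding maximizers_def by blast+
    then show "x \<in> {x. density_vector P x \<and> \<beta> dm \<le> \<beta> x}"
      using lim[OF x(1)] lim[OF dm(1)] by simp
  next
    fix x assume x: "x \<in> {x. density_vector P x \<and> \<beta> dm \<le> \<beta> x}"
    have "dist_dens_lim P c\<^sub>0 \<H> y \<le> dist_dens_lim P c\<^sub>0 \<H> x" if "density_vector P y" for y
      using dm(2)[OF that] x lim[OF that] lim[of x] by simp
    then show "x \<in> maximizers P c\<^sub>0 \<H>" using x by (simp add: maximizers_def)
  qed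
  have 9: "\<exists>d\<^sub>m\<in>maximizers P c\<^sub>0 \<H>. dist_dens_lim P c\<^sub>0 \<H> d\<^sub>m = dist_lim P \<H> \<and>
          (\<lambda>n. measure_pmf.expectation (random_digraph n d\<^sub>m) (\<lambda>G. dist_prop G \<H>)) \<longlonglongrightarrow> dist_lim P \<H>"
    using dm expectation_tendsto[OF dm(1)] by (intro bexI[of _ dm]) (auto simp: mx lim dl)
  have "closedin (top_of_set {d. density_vector P d}) ({d. density_vector P d} \<inter> \<beta> -` {\<beta> dm..})"
    by (rule continuous_closedin_preimage[OF continuous_on_\<beta> closed_atLeast])
  moreover have "{d. density_vector P d} \<inter> \<beta> -` {\<beta> dm..} = maximizers P c\<^sub>0 \<H>" by (auto simp: mx)
  ultimately have "compact (maximizers P c\<^sub>0 \<H>)"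
    using closedin_compact[OF compact_density_vectors] by metis
  then have 10: "closed_in_cube (palette_dim P - 1) (free_coords P ` maximizers P c\<^sub>0 \<H>)"
    by (rule closed_in_cube_free_coords[OF assms(1)]) (auto simp: mx)
  have 11: "convex_in_cube (palette_dim P - 1) (free_coords P ` maximizers P c\<^sub>0 \<H>)"
    unfolding convex_in_cube_def
  proof (intro conjI ballI)
    show "free_coords P ` maximizers P c\<^sub>0 \<H> \<subseteq> real_cube (palette_dim P - 1)"
      using free_coords_in_cube[OF assms(1)] by (auto simp: mx)
    fix fx fy and t :: real
    assume "fx \<in> free_coords P ` maximizers P c\<^sub>0 \<H>" "fy \<in> free_coords P ` maximizers P c\<^sub>0 \<H>" and t: "t \<in> {0..1}"
    then obtain x y where x: "x \<in> maximizers P c\<^sub>0 \<H>" "fx = free_coords P x"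
      and y: "y \<in> maximizers P c\<^sub>0 \<H>" "fy = free_coords P y" by blast
    have t1: "0 \<le> t" "0 \<le> 1 - t" "t + (1 - t) = 1" using t by auto
    have xy: "density_vector P x" "density_vector P y" "\<beta> dm \<le> \<beta> x" "\<beta> dm \<le> \<beta> y" using x y by (auto simp: mx)
    have "\<beta> dm = t * \<beta> dm + (1 - t) * \<beta> dm" by (simp add: algebra_simps)
    also have "\<dots> \<le> t * \<beta> x + (1 - t) * \<beta> y" using xy t1 by (intro add_mono mult_left_mono) auto
    also have "\<dots> \<le> \<beta> (t *\<^sub>R x + (1 - t) *\<^sub>R y)" by (rule \<beta>_concave[OF xy(1,2) t1])
    finally have "t *\<^sub>R x + (1 - t) *\<^sub>R y \<in> maximizers P c\<^sub>0 \<H>"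
      using density_vector_affine[OF xy(1,2) t1] by (simp add: mx)
    then show "(\<lambda>i\<in>{..<palette_dim P - 1}. t * fx i + (1 - t) * fy i) \<in> free_coords P ` maximizers P c\<^sub>0 \<H>"
      unfolding x y free_coords_affine[OF assms(1) t1(3)] by (rule imageI)
  qed
  show ?thesis by (intro conjI; fact)
qed

end
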